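(* Let $\mathcal{C}$ be a DG category with a pseudo-tensor structure $P^{\mathcal{C}}_*$. For objects $\mathcal{E}^i=\{E^i_j,\ e^i_{jk}:E^i_k\to E^i_j\}_{N_i\le j,k\le M_i}$, $i\in I=\{1,\dots,m\}$, and $\mathcal{F}=\{F_k,\ f_{jk}:F_k\to F_j\}_{N'\le j,k\le M'}$ of $\text{Pre-Tr}(\mathcal{C})$ put $$P^{\mathrm{pretr}}_m(\{\mathcal{E}^i\}_{i\in I},\mathcal{F})^n=\bigoplus_{\substack{N_i\le j_i\le M_i\\ N'\le k\le M'}}P_m^{\mathcal{C}}(\{E^i_{j_i}\}_{i\in I},F_k)^{\,n-k+\sum_{i\in I}j_i},$$ and for $\phi=(\phi_{k,\{j_i\}})$ of degree $n$ put $$(\partial\phi)_{k,\{j_i\}}=(-1)^kd\phi_{k,\{j_i\}}+\sum_lf_{kl}(\phi_{l,\{j_i\}})-(-1)^n\sum_{i=1}^m\sum_{N_i\le l\le M_i}(-1)^{s(i,j_i,l)}\phi_{k,J(i,j_i,l)}(id_{E^1_{j_1}},\dots,id_{E^{i-1}_{j_{i-1}}},e^i_{lj_i},id_{E^{i+1}_{j_{i+1}}},\dots,id_{E^m_{j_m}}),$$ where $s(i,j_i,l)=j_1+\cdots+j_{i-1}+(j_i-l+1)(j_{i+1}+\cdots+j_m)$ and $J(i,j_i,l)=\{j_1,\dots,j_{i-1},l,j_{i+1},\dots,j_m\}$. For a surjection of finite sets $\pi:J\to I=\{1,\dots,d\}$ with $J_i=\pi^{-1}(i)$, for $\phi\in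 P^{\mathrm{pretr}}_I(\{\mathcal{E}^i\}_{i\in I},\mathcal{F})^r$ and $\psi^i\in P^{\mathrm{pretr}}_{J_i}(\{\mathcal{H}^j\}_{j\in J_i},\mathcal{E}^i)^{n_i}$, define $\phi(\psi^i)\in P^{\mathrm{pretr}}_J(\{\mathcal{H}^j\}_{j\in J},\mathcal{F})^{r+\sum n_i}$ by $$(\phi(\psi^i))_{k,\{k_j\}}=\sum_{\{j_i\}}(-1)^{S(\{j_i\},\{k_j\},\{n_i\})}\,\phi_{k,\{j_i\}}(\psi^i_{j_i,\{k_j\}_{j\in J_i}}),$$ $$S(\{j_i\},\{k_j\},\{n_i\})=\sum_{p=2}^{d}\sum_{i=1}^{p-1}\Big(j_p\big(n_i-j_i+\sum_{j\in J_i}k_j\big)+\big(\sum_{j\in J_i}k_j\big)n_p\Big).$$ Then the complexes $(P^{\mathrm{pretr}}_I,\partial)$ with this composition law define a pseudo-tensor structure on $\text{Pre-Tr}(\mathcal{C})$.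
   Context: DG categories are categories enriched in cochain complexes of abelian groups, with finite direct sums, with $d(f\circ g)=df\circ g+(-1)^{\deg f}f\circ dg$. A pseudo-tensor structure on a DG category $\mathcal{C}$ consists of: (i) for every finite non-empty set $I$, objects $X_i$ ($i\in I$) and $Y$ of $\mathcal{C}$, a complex of abelian groups $(P_I(\{X_i\}_{i\in I},Y)^*,\partial)$ (written $P_n$ for $I=\{1,\dots,n\}$), with $P_1(\{X\},Y)^*=Hom_{\mathcal{C}}(X,Y)^*$; (ii) for every surjection $\pi:J\to I$ of finite sets with fibers $J_i=\pi^{-1}(i)$, composition maps $P_I(\{Y_i\},Z)^m\otimes\bigotimes_{i\in I}P_{J_i}(\{X_j\}_{j\in J_i},Y_i)^{n_i}\to P_J(\{X_j\},Z)^{m+\sum n_i}$, $(f,(g_i))\mapsto f(g_i)$. Required: (1) for $I=\{1,\dots,p\}$, $\partial(f(g_i))=(\partial f)(g_i)+\sum_{k=1}^p(-1)^{m+\sum_{i=1}^{k-1}n_i}f(g_1,\dots,g_{k-1},\partial g_k,g_{k+1},\dots,g_p)$; (2) for a further surjection $K\to J$, objects $\{W_k\}_{k\in K}$ and $h_j\in P_{K_j}(\{W_k\}_{k\in K_j},X_j)^{p_j}$, $f(g_i(h_j))=(-1)^{\sum_{i=1}^p(\sum_{l=1}^{i-1}\sum_{j\in J_l}p_j)n_i}(f(g_i))(h_j)$; (3) for each object $E$ there is $id_E\in P_1(\{E\},E)^0$ with $\partial id_E=0$ such that $id_Y(f)=f(id_{X_i})=f$ for all $f\in P_I(\{X_i\},Y)^n$.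 $\text{Pre-Tr}(\mathcal{C})$ is the DG category with objects $\mathcal{E}=\{E_i,e_{ij}\}$: a finite collection of objects $E_i$ ($N\le i\le M$, with $N,M$ depending on $\mathcal{E}$) of $\mathcal{C}$ and morphisms $e_{ij}:E_j\to E_i$ of degree $j-i+1$ with $(-1)^ide_{ij}+\sum_ke_{ik}e_{kj}=0$. A morphism $\phi:\{E_i,e_{ij}\}\to\{F_i,f_{ij}\}$ of degree $n$ is a collection of morphisms $\phi_{ij}:E_j\to F_i$ of degree $n+j-i$; composition is $(\psi\circ\phi)_{ij}=\sum_k\psi_{ik}\circ\phi_{kj}$ and the differential is $\partial(\phi)_{ij}=(-1)^id(\phi_{ij})+\sum_kf_{ik}\phi_{kj}-(-1)^n\sum_k\phi_{ik}e_{kj}$.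
   Formalization: For surjections π that are not order-preserving, the sign in axiom (2) and the exponent S get the extra Koszul term: the sum over a<b with π(b)<π(a) of p_a p_b, respectively k_a k_b; without it the claim fails for the transposition of {1,2}. Order-preserving π: formulas unchanged. *)

theory Defs
  imports Main "HOL-Library.FuncSet" "HOL-Library.Function_Algebras"
begin

text \<open>
  Graded abelian groups are families of additive subgroups, indexed by the degree, of one ambient
  abelian group type. This is no restriction: any set of abelian groups embeds in its direct sum.
  The subgroups for different degrees or different objects may overlap, so every operation receives
  the relevant objects and degrees as arguments. \<open>ksign n x\<close> is $(-1)^n x$.
\<close>

definition ksign :: "int \<Rightarrow> 'm \<Rightarrow> 'm::ab_group_add" where
  "ksign n x = (if even n then x else - x)"

definition additive_subgroup :: "'m::ab_group_add set \<Rightarrow> bool" where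
  "additive_subgroup A \<longleftrightarrow> 0 \<in> A \<and> (\<forall>x\<in>A. \<forall>y\<in>A. x + y \<in> A) \<and> (\<forall>x\<in>A. - x \<in> A)"

definition cochain_complex :: "(int \<Rightarrow> 'm::ab_group_add set) \<Rightarrow> (int \<Rightarrow> 'm \<Rightarrow> 'm) \<Rightarrow> bool" where
  "cochain_complex A d \<longleftrightarrow>
     (\<forall>n. additive_subgroup (A n)) \<and>
     (\<forall>n. d n \<in> A n \<rightarrow> A (n + 1)) \<and>
     (\<forall>n. \<forall>x\<in>A n. \<forall>y\<in>A n. d n (x + y) = d n x + d n y) \<and>
     (\<forall>n. \<forall>x\<in>A n. d (n + 1) (d n x) = 0)"


section \<open>DG categories\<close>

text \<open>
  \<open>DCmp C X Y Z m n f g\<close> is the composite of \<open>f : Y \<rightarrow> Z\<close> of degree \<open>m\<close> with \<open>g : X \<rightarrow> Y\<close> of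
  degree \<open>n\<close>; \<open>DDif C X Y n\<close> is the differential on \<open>DHom C X Y n\<close>.
\<close>

record ('o, 'm) dg_cat =
  DOb  :: "'o set"
  DHom :: "'o \<Rightarrow> 'o \<Rightarrow> int \<Rightarrow> 'm set"
  DDif :: "'o \<Rightarrow> 'o \<Rightarrow> int \<Rightarrow> 'm \<Rightarrow> 'm"
  DCmp :: "'o \<Rightarrow> 'o \<Rightarrow> 'o \<Rightarrow> int \<Rightarrow> int \<Rightarrow> 'm \<Rightarrow> 'm \<Rightarrow> 'm"
  DId  :: "'o \<Rightarrow> 'm"

locale dg_category =
  fixes C :: "('o, 'm::ab_group_add) dg_cat"
  assumes hom_complex:
      "\<lbrakk>X \<in> DOb C; Y \<in> DOb C\<rbrakk> \<Longrightarrow> cochain_complex (DHom C X Y) (DDif C X Y)"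
    and cmp_closed:
      "\<lbrakk>X \<in> DOb C; Y \<in> DOb C; Z \<in> DOb C; f \<in> DHom C Y Z m; g \<in> DHom C X Y n\<rbrakk>
        \<Longrightarrow> DCmp C X Y Z m n f g \<in> DHom C X Z (m + n)"
    and cmp_add_left:
      "\<lbrakk>X \<in> DOb C; Y \<in> DOb C; Z \<in> DOb C;
        f \<in> DHom C Y Z m; f' \<in> DHom C Y Z m; g \<in> DHom C X Y n\<rbrakk>
        \<Longrightarrow> DCmp C X Y Z m n (f + f') g = DCmp C X Y Z m n f g + DCmp C X Y Z m n f' g"
    and cmp_add_right:
      "\<lbrakk>X \<in> DOb C; Y \<in> DOb C; Z \<in> DOb C;
        f \<in> DHom C Y Z m; g \<in> DHom C X Y n; g' \<in> DHom C X Y n\<rbrakk>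
        \<Longrightarrow> DCmp C X Y Z m n f (g + g') = DCmp C X Y Z m n f g + DCmp C X Y Z m n f g'"
    and cmp_assoc:
      "\<lbrakk>W \<in> DOb C; X \<in> DOb C; Y \<in> DOb C; Z \<in> DOb C;
        f \<in> DHom C Y Z m; g \<in> DHom C X Y n; h \<in> DHom C W X p\<rbrakk>
        \<Longrightarrow> DCmp C W X Z (m + n) p (DCmp C X Y Z m n f g) h
          = DCmp C W Y Z m (n + p) f (DCmp C W X Y n p g h)"
    and id_closed: "X \<in> DOb C \<Longrightarrow> DId C X \<in> DHom C X X 0"
    and id_dif: "X \<in> DOb C \<Longrightarrow> DDif C X X 0 (DId C X) = 0"
    and id_left:
      "\<lbrakk>X \<in> DOb C; Y \<in> DOb C; f \<in> DHom C X Y n\<rbrakk> \<Longrightarrow> DCmp C X Y Y 0 n (DId C Y) f = f"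
    and id_right:
      "\<lbrakk>X \<in> DOb C; Y \<in> DOb C; f \<in> DHom C X Y n\<rbrakk> \<Longrightarrow> DCmp C X X Y n 0 f (DId C X) = f"
    and dif_cmp:
      "\<lbrakk>X \<in> DOb C; Y \<in> DOb C; Z \<in> DOb C; f \<in> DHom C Y Z m; g \<in> DHom C X Y n\<rbrakk>
        \<Longrightarrow> DDif C X Z (m + n) (DCmp C X Y Z m n f g)
          = DCmp C X Y Z (m + 1) n (DDif C Y Z m f) g
            + ksign m (DCmp C X Y Z m (n + 1) f (DDif C X Y n g))"
    and finite_direct_sums:
      "(\<And>k::nat. k < r \<Longrightarrow> A k \<in> DOb C) \<Longrightarrow>
        \<exists>S\<in>DOb C. \<exists>inc proj.
          (\<forall>k<r. inc k \<in> DHom C (A k) S 0 \<and> DDif C (A k) S 0 (inc k) = 0) \<and>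
          (\<forall>k<r. proj k \<in> DHom C S (A k) 0 \<and> DDif C S (A k) 0 (proj k) = 0) \<and>
          (\<forall>k<r. \<forall>l<r. DCmp C (A k) S (A l) 0 0 (proj l) (inc k)
                           = (if k = l then DId C (A k) else 0)) \<and>
          (\<Sum>k<r. DCmp C S (A k) S 0 0 (inc k) (proj k)) = DId C S"


section \<open>Pseudo-tensor structures\<close>

text \<open>
  Index sets are the finite non-empty sets of natural numbers, so they come with a numbering, by
  increasing order. Families over an index set \<open>I\<close> are extensional functions on \<open>I\<close>
  (members of \<^term>\<open>PiE I A\<close>).

  In \<open>TCmp P J I \<pi> X Y Z m n f g\<close>, the surjection is \<open>\<pi> : J \<rightarrow> I\<close>, \<open>f\<close> is an operation
  $\{Y_i\} \to Z$ of degree \<open>m\<close>, and \<open>g i\<close> is an operation $\{X_j\}_{j \in J_i} \to Y_i$ of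
  degree \<open>n i\<close>. \<open>TOne P i X Y n\<close> is the identification of $Hom(X,Y)^n$ with
  $P_{\{i\}}(\{X\},Y)^n$.
\<close>

definition index_set :: "nat set \<Rightarrow> bool" where
  "index_set I \<longleftrightarrow> finite I \<and> I \<noteq> {}"

definition surjection :: "nat set \<Rightarrow> nat set \<Rightarrow> (nat \<Rightarrow> nat) \<Rightarrow> bool" where
  "surjection J I \<pi> \<longleftrightarrow> index_set J \<and> index_set I \<and> \<pi> \<in> extensional J \<and> \<pi> ` J = I"

definition fiber :: "nat set \<Rightarrow> (nat \<Rightarrow> nat) \<Rightarrow> nat \<Rightarrow> nat set" where
  "fiber J \<pi> i = {j \<in> J. \<pi> j = i}"

text \<open>
  The tensor product over \<open>i \<in> I\<close> of graded groups is the one of the Koszul sign rule, with its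
  factors listed in increasing order of the index. The usual sign formula for associativity lists
  the factors $h_j$, $j \in J$, in the order $J_1, J_2, \dots, J_p$ of the fibers.
  \<open>shuffle_exp J \<pi> p\<close> is the exponent of the Koszul sign for passing between the two listings
  when the factor with index \<open>j\<close> has degree \<open>p j\<close>. The two listings agree, and the exponent is
  \<open>0\<close>, whenever \<open>\<pi>\<close> is order-preserving (see \<open>shuffle_exp_mono\<close>). For other surjections the
  sign cannot be omitted: with bijections \<open>\<pi>\<close> it expresses that $P_I$ does not depend on
  the numbering of \<open>I\<close>, and without it the Leibniz rule and associativity contradict each other
  already for the transposition of $\{1,2\}$ acting on complexes of abelian groups.
\<close>

definition shuffle_exp :: "nat set \<Rightarrow> (nat \<Rightarrow> nat) \<Rightarrow> (nat \<Rightarrow> int) \<Rightarrow> int" where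
  "shuffle_exp J \<pi> p = (\<Sum>(a, b)\<in>{(a, b). a \<in> J \<and> b \<in> J \<and> a < b \<and> \<pi> b < \<pi> a}. p a * p b)"

lemma shuffle_exp_mono: "mono_on J \<pi> \<Longrightarrow> shuffle_exp J \<pi> p = 0"
proof -
  assume m: "mono_on J \<pi>"
  have "{(a, b). a \<in> J \<and> b \<in> J \<and> a < b \<and> \<pi> b < \<pi> a} = {}"
    using mono_onD[OF m] by fastforce
  then show ?thesis
    unfolding shuffle_exp_def by (metis sum.empty)
qed

definition assoc_exp ::
    "nat set \<Rightarrow> nat set \<Rightarrow> (nat \<Rightarrow> nat) \<Rightarrow> (nat \<Rightarrow> int) \<Rightarrow> (nat \<Rightarrow> int) \<Rightarrow> int" where
  "assoc_exp J I \<pi> n p =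
     (\<Sum>i\<in>I. (\<Sum>l\<in>{l \<in> I. l < i}. \<Sum>j\<in>fiber J \<pi> l. p j) * n i) + shuffle_exp J \<pi> p"

record ('o, 'm, 'p) pseudo_tensor =
  TOp  :: "nat set \<Rightarrow> (nat \<Rightarrow> 'o) \<Rightarrow> 'o \<Rightarrow> int \<Rightarrow> 'p set"
  TDif :: "nat set \<Rightarrow> (nat \<Rightarrow> 'o) \<Rightarrow> 'o \<Rightarrow> int \<Rightarrow> 'p \<Rightarrow> 'p"
  TCmp :: "nat set \<Rightarrow> nat set \<Rightarrow> (nat \<Rightarrow> nat) \<Rightarrow> (nat \<Rightarrow> 'o) \<Rightarrow> (nat \<Rightarrow> 'o) \<Rightarrow> 'o \<Rightarrow>
           int \<Rightarrow> (nat \<Rightarrow> int) \<Rightarrow> 'p \<Rightarrow> (nat \<Rightarrow> 'p) \<Rightarrow> 'p"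
  TOne :: "nat \<Rightarrow> 'o \<Rightarrow> 'o \<Rightarrow> int \<Rightarrow> 'm \<Rightarrow> 'p"

text \<open>The families $(g_i)_{i \in I}$ that can be substituted along \<open>\<pi> : J \<rightarrow> I\<close>.\<close>

definition op_families ::
    "('o, 'm, 'p) pseudo_tensor \<Rightarrow> nat set \<Rightarrow> nat set \<Rightarrow> (nat \<Rightarrow> nat) \<Rightarrow>
     (nat \<Rightarrow> 'o) \<Rightarrow> (nat \<Rightarrow> 'o) \<Rightarrow> (nat \<Rightarrow> int) \<Rightarrow> (nat \<Rightarrow> 'p) set" where
  "op_families P J I \<pi> X Y n =
     (\<Pi>\<^sub>E i\<in>I. TOp P (fiber J \<pi> i) (restrict X (fiber J \<pi> i)) (Y i) (n i))"

locale pseudo_tensor_structure = dg_category C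
  for C :: "('o, 'm::ab_group_add) dg_cat" +
  fixes P :: "('o, 'm, 'p::ab_group_add) pseudo_tensor"
  assumes op_complex:
      "\<lbrakk>index_set I; X \<in> I \<rightarrow>\<^sub>E DOb C; B \<in> DOb C\<rbrakk>
        \<Longrightarrow> cochain_complex (TOp P I X B) (TDif P I X B)"
    and one_bij:
      "\<lbrakk>A \<in> DOb C; B \<in> DOb C\<rbrakk>
        \<Longrightarrow> bij_betw (TOne P i A B q) (DHom C A B q) (TOp P {i} (\<lambda>_\<in>{i}. A) B q)"
    and one_add:
      "\<lbrakk>A \<in> DOb C; B \<in> DOb C; u \<in> DHom C A B q; v \<in> DHom C A B q\<rbrakk>
        \<Longrightarrow> TOne P i A B q (u + v) = TOne P i A B q u + TOne P i A B q v"
    and one_dif: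
      "\<lbrakk>A \<in> DOb C; B \<in> DOb C; u \<in> DHom C A B q\<rbrakk>
        \<Longrightarrow> TOne P i A B (q + 1) (DDif C A B q u)
          = TDif P {i} (\<lambda>_\<in>{i}. A) B q (TOne P i A B q u)"
    and one_cmp:
      "\<lbrakk>A \<in> DOb C; B \<in> DOb C; D \<in> DOb C; u \<in> DHom C B D m; v \<in> DHom C A B q\<rbrakk>
        \<Longrightarrow> TOne P j A D (m + q) (DCmp C A B D m q u v)
          = TCmp P {j} {i} (\<lambda>_\<in>{j}. i) (\<lambda>_\<in>{j}. A) (\<lambda>_\<in>{i}. B) D m (\<lambda>_\<in>{i}. q)
              (TOne P i B D m u) (\<lambda>_\<in>{i}. TOne P j A B q v)"
    and tcmp_closed:
      "\<lbrakk>surjection J I \<pi>; X \<in> J \<rightarrow>\<^sub>E DOb C; Y \<in> I \<rightarrow>\<^sub>E DOb C; Z \<in> DOb C; n \<in> extensional I;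
        f \<in> TOp P I Y Z m; g \<in> op_families P J I \<pi> X Y n\<rbrakk>
        \<Longrightarrow> TCmp P J I \<pi> X Y Z m n f g \<in> TOp P J X Z (m + (\<Sum>i\<in>I. n i))"
    and tcmp_add_left:
      "\<lbrakk>surjection J I \<pi>; X \<in> J \<rightarrow>\<^sub>E DOb C; Y \<in> I \<rightarrow>\<^sub>E DOb C; Z \<in> DOb C; n \<in> extensional I;
        f \<in> TOp P I Y Z m; f' \<in> TOp P I Y Z m; g \<in> op_families P J I \<pi> X Y n\<rbrakk>
        \<Longrightarrow> TCmp P J I \<pi> X Y Z m n (f + f') g
          = TCmp P J I \<pi> X Y Z m n f g + TCmp P J I \<pi> X Y Z m n f' g"
    and tcmp_add_right:
      "\<lbrakk>surjection J I \<pi>; X \<in> J \<rightarrow>\<^sub>E DOb C; Y \<in> I \<rightarrow>\<^sub>E DOb C; Z \<in> DOb C; n \<in> extensional I;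
        f \<in> TOp P I Y Z m; g \<in> op_families P J I \<pi> X Y n; i \<in> I;
        x \<in> TOp P (fiber J \<pi> i) (restrict X (fiber J \<pi> i)) (Y i) (n i);
        y \<in> TOp P (fiber J \<pi> i) (restrict X (fiber J \<pi> i)) (Y i) (n i)\<rbrakk>
        \<Longrightarrow> TCmp P J I \<pi> X Y Z m n f (g(i := x + y))
          = TCmp P J I \<pi> X Y Z m n f (g(i := x)) + TCmp P J I \<pi> X Y Z m n f (g(i := y))"
    and tcmp_dif:
      "\<lbrakk>surjection J I \<pi>; X \<in> J \<rightarrow>\<^sub>E DOb C; Y \<in> I \<rightarrow>\<^sub>E DOb C; Z \<in> DOb C; n \<in> extensional I;
        f \<in> TOp P I Y Z m; g \<in> op_families P J I \<pi> X Y n\<rbrakk>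
        \<Longrightarrow> TDif P J X Z (m + (\<Sum>i\<in>I. n i)) (TCmp P J I \<pi> X Y Z m n f g)
          = TCmp P J I \<pi> X Y Z (m + 1) n (TDif P I Y Z m f) g
            + (\<Sum>k\<in>I. ksign (m + (\<Sum>i\<in>{i \<in> I. i < k}. n i))
                (TCmp P J I \<pi> X Y Z m (n(k := n k + 1)) f
                  (g(k := TDif P (fiber J \<pi> k) (restrict X (fiber J \<pi> k)) (Y k) (n k) (g k)))))"
    and tcmp_assoc:
      "\<lbrakk>surjection K J \<rho>; surjection J I \<pi>;
        W \<in> K \<rightarrow>\<^sub>E DOb C; X \<in> J \<rightarrow>\<^sub>E DOb C; Y \<in> I \<rightarrow>\<^sub>E DOb C; Z \<in> DOb C;
        n \<in> extensional I; p \<in> extensional J;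
        f \<in> TOp P I Y Z m; g \<in> op_families P J I \<pi> X Y n; h \<in> op_families P K J \<rho> W X p\<rbrakk>
        \<Longrightarrow> TCmp P K I (compose K \<pi> \<rho>) W Y Z m (\<lambda>i\<in>I. n i + (\<Sum>j\<in>fiber J \<pi> i. p j)) f
              (\<lambda>i\<in>I.
                let Ji = fiber J \<pi> i; Ki = fiber K (compose K \<pi> \<rho>) i
                in TCmp P Ki Ji (restrict \<rho> Ki) (restrict W Ki) (restrict X Ji) (Y i)
                     (n i) (restrict p Ji) (g i) (restrict h Ji))
          = ksign (assoc_exp J I \<pi> n p)
              (TCmp P K J \<rho> W X Z (m + (\<Sum>i\<in>I. n i)) p (TCmp P J I \<pi> X Y Z m n f g) h)"
    and tcmp_id_left:
      "\<lbrakk>index_set I; X \<in> I \<rightarrow>\<^sub>E DOb C; B \<in> DOb C; f \<in> TOp P I X B q\<rbrakk>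
        \<Longrightarrow> TCmp P I {i} (\<lambda>_\<in>I. i) X (\<lambda>_\<in>{i}. B) B 0 (\<lambda>_\<in>{i}. q)
              (TOne P i B B 0 (DId C B)) (\<lambda>_\<in>{i}. f) = f"
    and tcmp_id_right:
      "\<lbrakk>index_set I; X \<in> I \<rightarrow>\<^sub>E DOb C; B \<in> DOb C; f \<in> TOp P I X B q\<rbrakk>
        \<Longrightarrow> TCmp P I I (\<lambda>i\<in>I. i) X X B q (\<lambda>_\<in>I. 0)
              f (\<lambda>i\<in>I. TOne P i (X i) (X i) 0 (DId C (X i))) = f"


section \<open>The DG category Pre-Tr\<close>

text \<open>
  Matrices are total functions that vanish outside their index range; \<open>tw_mor E i j\<close> is
  $e_{ij} : E_j \to E_i$, and the entry \<open>\<phi> i j\<close> of a morphism is $\phi_{ij} : E_j \to F_i$.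
\<close>

record ('o, 'm) twisted =
  tw_lo  :: int
  tw_hi  :: int
  tw_ob  :: "int \<Rightarrow> 'o"
  tw_mor :: "int \<Rightarrow> int \<Rightarrow> 'm"

abbreviation tw_range :: "('o, 'm) twisted \<Rightarrow> int set" where
  "tw_range E \<equiv> {tw_lo E..tw_hi E}"

definition pretr_objects :: "('o, 'm::ab_group_add) dg_cat \<Rightarrow> ('o, 'm) twisted set" where
  "pretr_objects C = {E.
     tw_ob E \<in> tw_range E \<rightarrow>\<^sub>E DOb C \<and>
     (\<forall>i\<in>tw_range E. \<forall>j\<in>tw_range E.
        tw_mor E i j \<in> DHom C (tw_ob E j) (tw_ob E i) (j - i + 1)) \<and>
     (\<forall>i j. i \<notin> tw_range E \<or> j \<notin> tw_range E \<longrightarrow> tw_mor E i j = 0) \<and>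
     (\<forall>i\<in>tw_range E. \<forall>j\<in>tw_range E.
        ksign i (DDif C (tw_ob E j) (tw_ob E i) (j - i + 1) (tw_mor E i j))
        + (\<Sum>k\<in>tw_range E.
             DCmp C (tw_ob E j) (tw_ob E k) (tw_ob E i) (k - i + 1) (j - k + 1)
               (tw_mor E i k) (tw_mor E k j)) = 0)}"

definition pretr_hom ::
    "('o, 'm::ab_group_add) dg_cat \<Rightarrow> ('o, 'm) twisted \<Rightarrow> ('o, 'm) twisted \<Rightarrow> int \<Rightarrow>
     (int \<Rightarrow> int \<Rightarrow> 'm) set" where
  "pretr_hom C E F n = {\<phi>.
     (\<forall>i\<in>tw_range F. \<forall>j\<in>tw_range E. \<phi> i j \<in> DHom C (tw_ob E j) (tw_ob F i) (n + j - i)) \<and>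
     (\<forall>i j. i \<notin> tw_range F \<or> j \<notin> tw_range E \<longrightarrow> \<phi> i j = 0)}"

definition pretr_dif ::
    "('o, 'm::ab_group_add) dg_cat \<Rightarrow> ('o, 'm) twisted \<Rightarrow> ('o, 'm) twisted \<Rightarrow> int \<Rightarrow>
     (int \<Rightarrow> int \<Rightarrow> 'm) \<Rightarrow> int \<Rightarrow> int \<Rightarrow> 'm" where
  "pretr_dif C E F n \<phi> = (\<lambda>i j.
     if i \<in> tw_range F \<and> j \<in> tw_range E then
       ksign i (DDif C (tw_ob E j) (tw_ob F i) (n + j - i) (\<phi> i j))
       + (\<Sum>k\<in>tw_range F.
            DCmp C (tw_ob E j) (tw_ob F k) (tw_ob F i) (k - i + 1) (n + j - k)
              (tw_mor F i k) (\<phi> k j))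
       - ksign n (\<Sum>k\<in>tw_range E.
            DCmp C (tw_ob E j) (tw_ob E k) (tw_ob F i) (n + k - i) (j - k + 1)
              (\<phi> i k) (tw_mor E k j))
     else 0)"

definition pretr_cmp ::
    "('o, 'm::ab_group_add) dg_cat \<Rightarrow>
     ('o, 'm) twisted \<Rightarrow> ('o, 'm) twisted \<Rightarrow> ('o, 'm) twisted \<Rightarrow> int \<Rightarrow> int \<Rightarrow>
     (int \<Rightarrow> int \<Rightarrow> 'm) \<Rightarrow> (int \<Rightarrow> int \<Rightarrow> 'm) \<Rightarrow> int \<Rightarrow> int \<Rightarrow> 'm" where
  "pretr_cmp C E F G m n \<psi> \<phi> = (\<lambda>i j.
     if i \<in> tw_range G \<and> j \<in> tw_range E then
       (\<Sum>k\<in>tw_range F.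
          DCmp C (tw_ob E j) (tw_ob F k) (tw_ob G i) (m + k - i) (n + j - k) (\<psi> i k) (\<phi> k j))
     else 0)"

definition pretr_id ::
    "('o, 'm::ab_group_add) dg_cat \<Rightarrow> ('o, 'm) twisted \<Rightarrow> int \<Rightarrow> int \<Rightarrow> 'm" where
  "pretr_id C E = (\<lambda>i j. if i = j \<and> i \<in> tw_range E then DId C (tw_ob E i) else 0)"

definition pretr ::
    "('o, 'm::ab_group_add) dg_cat \<Rightarrow> (('o, 'm) twisted, int \<Rightarrow> int \<Rightarrow> 'm) dg_cat" where
  "pretr C = \<lparr>
     DOb = pretr_objects C,
     DHom = pretr_hom C,
     DDif = pretr_dif C,
     DCmp = pretr_cmp C,
     DId = pretr_id C\<rparr>"


section \<open>The pseudo-tensor structure on Pre-Tr\<close>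

text \<open>
  The component $\phi_{k,\{j_i\}}$ of an operation is \<open>\<phi> k j\<close>, with \<open>j\<close> in
  \<open>multi_range I E\<close>; components outside the index range vanish.
\<close>

definition multi_range :: "nat set \<Rightarrow> (nat \<Rightarrow> ('o, 'm) twisted) \<Rightarrow> (nat \<Rightarrow> int) set" where
  "multi_range I E = (\<Pi>\<^sub>E i\<in>I. tw_range (E i))"

definition obs_at ::
    "nat set \<Rightarrow> (nat \<Rightarrow> ('o, 'm) twisted) \<Rightarrow> (nat \<Rightarrow> int) \<Rightarrow> nat \<Rightarrow> 'o" where
  "obs_at I E j = (\<lambda>i\<in>I. tw_ob (E i) (j i))"

definition pretr_op ::
    "('o, 'm, 'p::ab_group_add) pseudo_tensor \<Rightarrow>
     nat set \<Rightarrow> (nat \<Rightarrow> ('o, 'm) twisted) \<Rightarrow> ('o, 'm) twisted \<Rightarrow> int \<Rightarrow>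
     (int \<Rightarrow> (nat \<Rightarrow> int) \<Rightarrow> 'p) set" where
  "pretr_op P I E F n = {\<phi>.
     (\<forall>k\<in>tw_range F. \<forall>j\<in>multi_range I E.
        \<phi> k j \<in> TOp P I (obs_at I E j) (tw_ob F k) (n - k + (\<Sum>i\<in>I. j i))) \<and>
     (\<forall>k j. k \<notin> tw_range F \<or> j \<notin> multi_range I E \<longrightarrow> \<phi> k j = 0)}"

text \<open>
  \<open>post_hom P I X Y Z m n f x\<close> is $f(x)$ for \<open>f\<close> in $Hom(Y,Z)^m$ and \<open>x\<close> in $P_I(\{X_i\},Y)^n$.
  \<open>pre_hom C P I i A X Y m n x f\<close> is $x(id,\dots,id,f,id,\dots,id)$ for \<open>x\<close> in
  $P_I(\{X_a\},Y)^m$ and \<open>f\<close> in $Hom(A,X_i)^n$ placed at position \<open>i\<close>.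
\<close>

definition post_hom ::
    "('o, 'm, 'p) pseudo_tensor \<Rightarrow> nat set \<Rightarrow> (nat \<Rightarrow> 'o) \<Rightarrow> 'o \<Rightarrow> 'o \<Rightarrow>
     int \<Rightarrow> int \<Rightarrow> 'm \<Rightarrow> 'p \<Rightarrow> 'p" where
  "post_hom P I X Y Z m n f x =
     TCmp P I {1} (\<lambda>_\<in>I. 1) X (\<lambda>_\<in>{1}. Y) Z m (\<lambda>_\<in>{1}. n) (TOne P 1 Y Z m f) (\<lambda>_\<in>{1}. x)"

definition pre_hom ::
    "('o, 'm) dg_cat \<Rightarrow> ('o, 'm, 'p) pseudo_tensor \<Rightarrow> nat set \<Rightarrow> nat \<Rightarrow> 'o \<Rightarrow> (nat \<Rightarrow> 'o) \<Rightarrow> 'o \<Rightarrow>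
     int \<Rightarrow> int \<Rightarrow> 'p \<Rightarrow> 'm \<Rightarrow> 'p" where
  "pre_hom C P I i A X Y m n x f =
     TCmp P I I (\<lambda>a\<in>I. a) (X(i := A)) X Y m (\<lambda>a\<in>I. if a = i then n else 0) x
       (\<lambda>a\<in>I. if a = i then TOne P i A (X i) n f
              else TOne P a (X a) (X a) 0 (DId C (X a)))"

definition insert_exp :: "nat set \<Rightarrow> (nat \<Rightarrow> int) \<Rightarrow> nat \<Rightarrow> int \<Rightarrow> int" where
  "insert_exp I j i l =
     (\<Sum>a\<in>{a \<in> I. a < i}. j a) + (j i - l + 1) * (\<Sum>a\<in>{a \<in> I. i < a}. j a)"

definition pretr_op_dif ::
    "('o, 'm) dg_cat \<Rightarrow> ('o, 'm, 'p::ab_group_add) pseudo_tensor \<Rightarrow>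
     nat set \<Rightarrow> (nat \<Rightarrow> ('o, 'm) twisted) \<Rightarrow> ('o, 'm) twisted \<Rightarrow> int \<Rightarrow>
     (int \<Rightarrow> (nat \<Rightarrow> int) \<Rightarrow> 'p) \<Rightarrow> int \<Rightarrow> (nat \<Rightarrow> int) \<Rightarrow> 'p" where
  "pretr_op_dif C P I E F n \<phi> = (\<lambda>k j.
     if k \<in> tw_range F \<and> j \<in> multi_range I E then
       ksign k (TDif P I (obs_at I E j) (tw_ob F k) (n - k + (\<Sum>i\<in>I. j i)) (\<phi> k j))
       + (\<Sum>l\<in>tw_range F.
            post_hom P I (obs_at I E j) (tw_ob F l) (tw_ob F k)
              (l - k + 1) (n - l + (\<Sum>i\<in>I. j i)) (tw_mor F k l) (\<phi> l j))
       - ksign n (\<Sum>i\<in>I. \<Sum>l\<in>tw_range (E i).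
            ksign (insert_exp I j i l)
              (pre_hom C P I i (tw_ob (E i) (j i)) (obs_at I E (j(i := l))) (tw_ob F k)
                 (n - k + (\<Sum>a\<in>I. (j(i := l)) a)) (j i - l + 1)
                 (\<phi> k (j(i := l))) (tw_mor (E i) l (j i))))
     else 0)"

text \<open>
  The exponent $S$, extended to surjections that are not order-preserving by the Koszul sign for
  listing the \<open>\<kappa> j\<close>, \<open>j \<in> J\<close>, fiber by fiber.
\<close>

definition pretr_exp ::
    "nat set \<Rightarrow> nat set \<Rightarrow> (nat \<Rightarrow> nat) \<Rightarrow> (nat \<Rightarrow> int) \<Rightarrow> (nat \<Rightarrow> int) \<Rightarrow> (nat \<Rightarrow> int) \<Rightarrow> int" where
  "pretr_exp J I \<pi> j \<kappa> n =
     (\<Sum>p\<in>I. \<Sum>i\<in>{i \<in> I. i < p}.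
        j p * (n i - j i + (\<Sum>a\<in>fiber J \<pi> i. \<kappa> a)) + (\<Sum>a\<in>fiber J \<pi> i. \<kappa> a) * n p)
     + shuffle_exp J \<pi> \<kappa>"

definition pretr_op_cmp ::
    "('o, 'm, 'p::ab_group_add) pseudo_tensor \<Rightarrow> nat set \<Rightarrow> nat set \<Rightarrow> (nat \<Rightarrow> nat) \<Rightarrow>
     (nat \<Rightarrow> ('o, 'm) twisted) \<Rightarrow> (nat \<Rightarrow> ('o, 'm) twisted) \<Rightarrow> ('o, 'm) twisted \<Rightarrow>
     int \<Rightarrow> (nat \<Rightarrow> int) \<Rightarrow> (int \<Rightarrow> (nat \<Rightarrow> int) \<Rightarrow> 'p) \<Rightarrow> (nat \<Rightarrow> int \<Rightarrow> (nat \<Rightarrow> int) \<Rightarrow> 'p) \<Rightarrow>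
     int \<Rightarrow> (nat \<Rightarrow> int) \<Rightarrow> 'p" where
  "pretr_op_cmp P J I \<pi> H E F r n \<phi> \<psi> = (\<lambda>k \<kappa>.
     if k \<in> tw_range F \<and> \<kappa> \<in> multi_range J H then
       (\<Sum>j\<in>multi_range I E.
          ksign (pretr_exp J I \<pi> j \<kappa> n)
            (TCmp P J I \<pi> (obs_at J H \<kappa>) (obs_at I E j) (tw_ob F k)
               (r - k + (\<Sum>i\<in>I. j i))
               (\<lambda>i\<in>I. n i - j i + (\<Sum>a\<in>fiber J \<pi> i. \<kappa> a))
               (\<phi> k j) (\<lambda>i\<in>I. \<psi> i (j i) (restrict \<kappa> (fiber J \<pi> i)))))
     else 0)"

definition pretr_one ::
    "('o, 'm, 'p::ab_group_add) pseudo_tensor \<Rightarrow> nat \<Rightarrow>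
     ('o, 'm) twisted \<Rightarrow> ('o, 'm) twisted \<Rightarrow> int \<Rightarrow>
     (int \<Rightarrow> int \<Rightarrow> 'm) \<Rightarrow> int \<Rightarrow> (nat \<Rightarrow> int) \<Rightarrow> 'p" where
  "pretr_one P i E F n \<phi> = (\<lambda>k j.
     if k \<in> tw_range F \<and> j \<in> multi_range {i} (\<lambda>_\<in>{i}. E) then
       TOne P i (tw_ob E (j i)) (tw_ob F k) (n + j i - k) (\<phi> k (j i))
     else 0)"

definition pretr_pseudo_tensor ::
    "('o, 'm::ab_group_add) dg_cat \<Rightarrow> ('o, 'm, 'p::ab_group_add) pseudo_tensor \<Rightarrow>
     (('o, 'm) twisted, int \<Rightarrow> int \<Rightarrow> 'm, int \<Rightarrow> (nat \<Rightarrow> int) \<Rightarrow> 'p) pseudo_tensor" where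
  "pretr_pseudo_tensor C P = \<lparr>
     TOp = pretr_op P,
     TDif = pretr_op_dif C P,
     TCmp = pretr_op_cmp P,
     TOne = pretr_one P\<rparr>"

end

theory Submission
  imports Defs
begin

text \<open>
  A twisted object $\{E_i, e_{ij}\}$ consists of a graded family $(E_i)$ and a matrix
  $e = (e_{ij})$. With $(D\phi)_{ij} = (-1)^i d\phi_{ij}$, this matrix is an endomorphism of degree
  \<open>1\<close> of the family, and the condition on it is the Maurer-Cartan equation $De + ee = 0$. The proof
  treats the two constituents one after the other.

  Graded families, with matrices of morphisms of \<open>C\<close> and the differential \<open>D\<close>, form a DG category
  \<open>graded_cat C\<close>. Matrices of operations between them compose by matrix multiplication; the exponent
  $S$ is the Koszul sign obtained when an entry $\phi_{k,\{j_i\}}$ is regarded as an operation between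
  copies of the $E^i_{j_i}$ shifted by $j_i$. Entry by entry, the axioms of a pseudo-tensor structure
  for these matrices are those of \<open>P\<close> (\<open>graded_pseudo_tensor\<close>), as soon as the signs match. For
  associativity this is \<open>pretr_exp_assoc\<close>, a comparison of sums over pairs of indices modulo \<open>2\<close>; for
  the Leibniz rule it follows from \<open>pretr_exp_add_1\<close>.

  Twisting is a construction for an arbitrary pseudo-tensor structure in which a Maurer-Cartan element
  $e_X$ has been chosen for each object. The differential of an operation \<open>x\<close> of degree \<open>n\<close> from
  $\{X_i\}$ to \<open>B\<close> is replaced by
  $$\partial x = Dx + e_B(x) - (-1)^n \sum_i x(id,\dots,e_{X_i},\dots,id),$$
  while compositions and units stay as they are. The result is again a pseudo-tensor structure
  (\<open>twist_pseudo_tensor\<close>). In $\partial\partial x$ the terms with two substitutions into different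
  slots cancel because elements of degree \<open>1\<close> anticommute (\<open>pre_hom_swap\<close>); the remaining ones
  cancel in pairs or combine to substitutions of $De + ee$. In the Leibniz rule for $f(g_i)$ the terms
  with an element \<open>e\<close> between \<open>f\<close> and some $g_i$ come once from $\partial f$ and once from
  $\partial g_i$, with opposite signs (\<open>tcmp_of_pre_hom\<close>), and the terms with an element \<open>e\<close> on the outside are those of
  $\partial(f(g_i))$ (\<open>post_hom_tcmp\<close>, \<open>pre_hom_of_tcmp\<close>).

  Twisting graded families by their matrices gives Pre-Tr with its operations. For morphisms this is
  read off from the formulas (\<open>pretr_twist\<close>). For operations, substituting $e^i$ into slot \<open>i\<close> is a
  matrix product in which the identity matrices, being diagonal, leave only the multi-indices
  $J(i,j_i,l)$; there the exponent $S$ has the parity of $s(i,j_i,l)$ (\<open>graded_pre_hom\<close>).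
\<close>

(* The one-element index set in post_hom is to stay in the form {1}. *)
declare One_nat_def [simp del]

section \<open>Signs and additive maps\<close>

lemma ksign_ksign [simp]: "ksign m (ksign n x) = ksign (m + n) x"
  by (simp add: ksign_def)

lemma ksign_add: "ksign n (x + y) = ksign n x + ksign n y"
  by (simp add: ksign_def)

lemma ksign_diff: "ksign n (x - y) = ksign n x - ksign n y"
  by (simp add: ksign_def)

lemma ksign_0_right [simp]: "ksign n 0 = 0"
  by (simp add: ksign_def)

lemma ksign_0_left [simp]: "ksign 0 x = x"
  by (simp add: ksign_def)

lemma ksign_plus_1 [simp]: "ksign (n + 1) x = - ksign n x"
  by (simp add: ksign_def)

lemma ksign_sum: "ksign n (sum f A) = (\<Sum>a\<in>A. ksign n (f a))"
  by (simp add: ksign_def sum_negf)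

lemma ksign_cong: "even (m + n) \<Longrightarrow> ksign m x = ksign n x"
  by (auto simp: ksign_def)

lemma ksign_apply: "ksign n f x = ksign n (f x)"
  by (simp add: ksign_def)

lemma sum_apply: "sum F A x = (\<Sum>a\<in>A. F a x)"
  by (induction A rule: infinite_finite_induct) auto

text \<open>The operations of a DG category or a pseudo-tensor structure are additive on the given
  subgroups of the ambient group only, so the domain of additivity is kept as an argument.\<close>

definition additive_on :: "'a::ab_group_add set \<Rightarrow> ('a \<Rightarrow> 'b::ab_group_add) \<Rightarrow> bool" where
  "additive_on A f \<longleftrightarrow> additive_subgroup A \<and> (\<forall>x\<in>A. \<forall>y\<in>A. f (x + y) = f x + f y)"

lemma subgroup_zero: "additive_subgroup A \<Longrightarrow> 0 \<in> A"
  and subgroup_add: "additive_subgroup A \<Longrightarrow> x \<in> A \<Longrightarrow> y \<in> A \<Longrightarrow> x + y \<in> A"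
  and subgroup_minus: "additive_subgroup A \<Longrightarrow> x \<in> A \<Longrightarrow> - x \<in> A"
  by (auto simp: additive_subgroup_def)

lemma subgroup_diff: "additive_subgroup A \<Longrightarrow> x \<in> A \<Longrightarrow> y \<in> A \<Longrightarrow> x - y \<in> A"
  using subgroup_add[of A x "- y"] subgroup_minus[of A y] by simp

lemma subgroup_ksign: "additive_subgroup A \<Longrightarrow> x \<in> A \<Longrightarrow> ksign n x \<in> A"
  by (simp add: ksign_def subgroup_minus)

lemma subgroup_sum:
  "additive_subgroup A \<Longrightarrow> (\<And>b. b \<in> B \<Longrightarrow> f b \<in> A) \<Longrightarrow> sum f B \<in> A"
  by (induction B rule: infinite_finite_induct) (auto intro: subgroup_zero subgroup_add)

lemma additive_on_subgroup: "additive_on A f \<Longrightarrow> additive_subgroup A"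
  by (simp add: additive_on_def)

lemma additive_on_add: "additive_on A f \<Longrightarrow> x \<in> A \<Longrightarrow> y \<in> A \<Longrightarrow> f (x + y) = f x + f y"
  by (simp add: additive_on_def)

lemma additive_on_zero: "additive_on A f \<Longrightarrow> f 0 = 0"
  using additive_on_add[of A f 0 0] subgroup_zero[OF additive_on_subgroup] by fastforce

lemma additive_on_minus: "additive_on A f \<Longrightarrow> x \<in> A \<Longrightarrow> f (- x) = - f x"
  using additive_on_add[of A f x "- x"] subgroup_minus[OF additive_on_subgroup, of A f x]
    additive_on_zero[of A f] by (simp add: eq_neg_iff_add_eq_0 add.commute)

lemma additive_on_diff: "additive_on A f \<Longrightarrow> x \<in> A \<Longrightarrow> y \<in> A \<Longrightarrow> f (x - y) = f x - f y"
  using additive_on_add[of A f x "- y"] subgroup_minus[OF additive_on_subgroup, of A f y]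
  by (simp add: additive_on_minus)

lemma additive_on_ksign: "additive_on A f \<Longrightarrow> x \<in> A \<Longrightarrow> f (ksign n x) = ksign n (f x)"
  by (simp add: ksign_def additive_on_minus)

lemma additive_on_sum:
  assumes "additive_on A f" and "\<And>b. b \<in> B \<Longrightarrow> u b \<in> A"
  shows "f (sum u B) = (\<Sum>b\<in>B. f (u b))"
  using assms(2)
proof (induction B rule: infinite_finite_induct)
  case (insert b B)
  then have "f (u b + sum u B) = f (u b) + f (sum u B)"
    by (intro additive_on_add[OF assms(1)] subgroup_sum[OF additive_on_subgroup[OF assms(1)]]) auto
  with insert show ?case by simp
qed (simp_all add: additive_on_zero[OF assms(1)])

lemma sum_PiE_insert:
  fixes F :: "('a \<Rightarrow> 'b) \<Rightarrow> 'c::comm_monoid_add"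
  assumes "x \<notin> S"
  shows "(\<Sum>b\<in>PiE (insert x S) B. F b) = (\<Sum>y\<in>B x. \<Sum>b\<in>PiE S B. F (b(x := y)))"
proof -
  have "(\<Sum>b\<in>PiE (insert x S) B. F b) = (\<Sum>(y, b)\<in>B x \<times> PiE S B. F (b(x := y)))"
    unfolding PiE_insert_eq
    by (subst sum.reindex[OF inj_combinator[OF assms]]) (simp add: case_prod_unfold)
  then show ?thesis by (simp add: sum.cartesian_product)
qed

text \<open>Full distributivity: the slots are expanded one at a time, by induction over the set of slots
  that have been expanded already.\<close>

lemma multiadditive_sum:
  fixes \<Phi> :: "('i \<Rightarrow> 'a::ab_group_add) \<Rightarrow> 'b::ab_group_add"
  assumes fin: "finite I" and sub: "\<And>i. i \<in> I \<Longrightarrow> additive_subgroup (A i)"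
    and add: "\<And>g i x y. g \<in> PiE I A \<Longrightarrow> i \<in> I \<Longrightarrow> x \<in> A i \<Longrightarrow> y \<in> A i \<Longrightarrow>
                \<Phi> (g(i := x + y)) = \<Phi> (g(i := x)) + \<Phi> (g(i := y))"
    and h: "\<And>i b. i \<in> I \<Longrightarrow> b \<in> B i \<Longrightarrow> h i b \<in> A i"
  shows "\<Phi> (\<lambda>i\<in>I. \<Sum>b\<in>B i. h i b) = (\<Sum>b\<in>PiE I B. \<Phi> (\<lambda>i\<in>I. h i (b i)))"
proof -
  have "S \<subseteq> I \<Longrightarrow> g \<in> PiE I A \<Longrightarrow>
      \<Phi> (\<lambda>i\<in>I. if i \<in> S then \<Sum>b\<in>B i. h i b else g i)
      = (\<Sum>b\<in>PiE S B. \<Phi> (\<lambda>i\<in>I. if i \<in> S then h i (b i) else g i))" if "finite S" for S g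
    using that
  proof (induction S arbitrary: g rule: finite_induct)
    case empty
    then show ?case by simp
  next
    case (insert x S)
    have x: "x \<in> I" and S: "S \<subseteq> I" using insert.prems by auto
    define H where "H = (\<Sum>b\<in>B x. h x b)"
    have HA: "H \<in> A x" unfolding H_def using h x by (intro subgroup_sum[OF sub]) auto
    have upd: "g(x := y) \<in> PiE I A" if "y \<in> A x" for y
      using insert.prems(2) that x by (auto simp: PiE_def extensional_def)
    have slot: "additive_on (A x) (\<lambda>y. \<Phi> (g'(x := y)))" if "g' \<in> PiE I A" for g'
      unfolding additive_on_def using that sub[OF x] add[OF that x] by auto
    have one: "\<Phi> (\<lambda>i\<in>I. if i \<in> S then h i (b i) else (g(x := H)) i)
        = (\<Sum>y\<in>B x. \<Phi> (\<lambda>i\<in>I. if i \<in> insert x S then h i ((b(x := y)) i) else g i))"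
      if b: "b \<in> PiE S B" for b
    proof -
      define g' where "g' = (\<lambda>i\<in>I. if i \<in> S then h i (b i) else g i)"
      have g': "g' \<in> PiE I A"
        unfolding g'_def using b S h insert.prems(2) by (auto simp: PiE_def Pi_def)
      have "(\<lambda>i\<in>I. if i \<in> S then h i (b i) else (g(x := H)) i) = g'(x := H)"
        unfolding g'_def using x insert.hyps by (auto simp: fun_eq_iff)
      moreover have "\<Phi> (g'(x := H)) = (\<Sum>y\<in>B x. \<Phi> (g'(x := h x y)))"
        unfolding H_def using h x by (intro additive_on_sum[OF slot[OF g']]) auto
      moreover have "(\<lambda>i\<in>I. if i \<in> insert x S then h i ((b(x := y)) i) else g i) = g'(x := h x y)"
        for y unfolding g'_def using x insert.hyps by (auto simp: fun_eq_iff)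
      ultimately show ?thesis by simp
    qed
    have eq: "(\<lambda>i\<in>I. if i \<in> insert x S then \<Sum>b\<in>B i. h i b else g i)
        = (\<lambda>i\<in>I. if i \<in> S then \<Sum>b\<in>B i. h i b else (g(x := H)) i)"
      using insert.hyps by (auto simp: fun_eq_iff H_def)
    have "\<Phi> (\<lambda>i\<in>I. if i \<in> insert x S then \<Sum>b\<in>B i. h i b else g i)
        = (\<Sum>b\<in>PiE S B. \<Phi> (\<lambda>i\<in>I. if i \<in> S then h i (b i) else (g(x := H)) i))"
      unfolding eq by (rule insert.IH[OF S upd[OF HA]])
    also have "\<dots> = (\<Sum>b\<in>PiE S B. \<Sum>y\<in>B x.
        \<Phi> (\<lambda>i\<in>I. if i \<in> insert x S then h i ((b(x := y)) i) else g i))"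
      using one by (rule sum.cong[OF refl])
    also have "\<dots> = (\<Sum>b\<in>PiE (insert x S) B.
        \<Phi> (\<lambda>i\<in>I. if i \<in> insert x S then h i (b i) else g i))"
      using insert.hyps by (subst sum.swap) (simp add: sum_PiE_insert)
    finally show ?case .
  qed
  from this[OF fin, of "\<lambda>i\<in>I. 0"] have
    "\<Phi> (\<lambda>i\<in>I. if i \<in> I then \<Sum>b\<in>B i. h i b else (\<lambda>i\<in>I. 0) i)
      = (\<Sum>b\<in>PiE I B. \<Phi> (\<lambda>i\<in>I. if i \<in> I then h i (b i) else (\<lambda>i\<in>I. 0) i))"
    using sub by (auto intro: subgroup_zero)
  then show ?thesis by (simp cong: restrict_cong)
qed

section \<open>Sums over pairs and over fibers\<close>

text \<open>Every pair of distinct indices is counted in the order in which the smaller one comes first, so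
  that terms which cancel or have the same parity after an exchange stand next to each other.\<close>

lemma sum_pairs_split:
  fixes F :: "'a::linorder \<Rightarrow> 'a \<Rightarrow> 'b::comm_monoid_add"
  assumes "finite J"
  shows "(\<Sum>x\<in>J. \<Sum>y\<in>J. F x y)
       = (\<Sum>x\<in>J. F x x) + (\<Sum>x\<in>J. \<Sum>y\<in>J. if x < y then F x y + F y x else 0)"
proof -
  have "(\<Sum>x\<in>J. \<Sum>y\<in>J. F x y) = (\<Sum>x\<in>J. \<Sum>y\<in>J. (if x = y then F x y else 0)
      + (if x < y then F x y else 0) + (if y < x then F x y else 0))"
    by (intro sum.cong refl) auto
  also have "\<dots> = (\<Sum>x\<in>J. \<Sum>y\<in>J. if x = y then F x y else 0)
      + (\<Sum>x\<in>J. \<Sum>y\<in>J. if x < y then F x y else 0)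
      + (\<Sum>x\<in>J. \<Sum>y\<in>J. if y < x then F x y else 0)"
    by (simp add: sum.distrib)
  also have "(\<Sum>x\<in>J. \<Sum>y\<in>J. if x = y then F x y else 0) = (\<Sum>x\<in>J. F x x)"
    using assms by (simp add: sum.delta')
  also have "(\<Sum>x\<in>J. \<Sum>y\<in>J. if y < x then F x y else 0)
      = (\<Sum>x\<in>J. \<Sum>y\<in>J. if x < y then F y x else 0)"
    by (rule sum.swap)
  also have "(\<Sum>x\<in>J. F x x) + (\<Sum>x\<in>J. \<Sum>y\<in>J. if x < y then F x y else 0)
      + (\<Sum>x\<in>J. \<Sum>y\<in>J. if x < y then F y x else 0)
      = (\<Sum>x\<in>J. F x x) + (\<Sum>x\<in>J. \<Sum>y\<in>J. if x < y then F x y + F y x else 0)"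
    by (simp add: add.assoc flip: sum.distrib) (intro arg_cong2[where f="(+)"] refl sum.cong, auto)
  finally show ?thesis .
qed

lemma index_set_singleton [simp]: "index_set {i}"
  by (simp add: index_set_def)

lemma surjectionD:
  assumes "surjection J I \<pi>"
  shows "index_set J" "index_set I" "finite J" "finite I" "\<pi> \<in> extensional J" "\<pi> ` J = I"
    "\<And>j. j \<in> J \<Longrightarrow> \<pi> j \<in> I"
  using assms by (auto simp: surjection_def index_set_def)

lemma surjection_fiber: "surjection J I \<pi> \<Longrightarrow> i \<in> I \<Longrightarrow> index_set (fiber J \<pi> i)"
  by (auto simp: surjection_def index_set_def fiber_def)

lemma surjection_identity: "index_set I \<Longrightarrow> surjection I I (\<lambda>i\<in>I. i)"
  by (auto simp: surjection_def)

lemma surjection_const: "index_set I \<Longrightarrow> surjection I {i} (\<lambda>_\<in>I. i)"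
  by (auto simp: surjection_def index_set_def)

lemma surjection_compose:
  assumes "surjection K J \<rho>" and "surjection J I \<pi>"
  shows "surjection K I (compose K \<pi> \<rho>)"
proof -
  have "compose K \<pi> \<rho> ` K = \<pi> ` (\<rho> ` K)" by (simp add: compose_def image_image)
  then show ?thesis using assms unfolding surjection_def by (metis compose_extensional)
qed

lemma fiber_const [simp]: "fiber I (\<lambda>_\<in>I. i) i = I"
  by (auto simp: fiber_def)

lemma fiber_subset: "fiber J \<pi> i \<subseteq> J"
  by (auto simp: fiber_def)

lemma fiber_identity [simp]: "i \<in> I \<Longrightarrow> fiber I (\<lambda>i\<in>I. i) i = {i}"
  by (auto simp: fiber_def)

lemma sum_fibers:
  fixes F :: "nat \<Rightarrow> 'a::comm_monoid_add"
  assumes "surjection J I \<pi>"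
  shows "(\<Sum>i\<in>I. \<Sum>j\<in>fiber J \<pi> i. F j) = (\<Sum>j\<in>J. F j)"
  unfolding fiber_def using surjectionD[OF assms] by (intro sum.group) auto

lemma shuffle_exp_const [simp]: "shuffle_exp J (\<lambda>_\<in>J. i) p = 0"
  by (rule shuffle_exp_mono) (auto simp: mono_on_def)

lemma shuffle_exp_identity [simp]: "shuffle_exp J (\<lambda>j\<in>J. j) p = 0"
  by (rule shuffle_exp_mono) (auto simp: mono_on_def)

lemma assoc_exp_const [simp]: "assoc_exp I {i} (\<lambda>_\<in>I. i) n p = 0"
proof -
  have "{l \<in> {i}. l < i} = {}" by auto
  then show ?thesis by (simp add: assoc_exp_def)
qed

section \<open>Consequences of the axioms\<close>

lemma const_upd [simp]: "(\<lambda>_\<in>{i}. a)(i := z) = (\<lambda>_\<in>{i}. z)"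
  by auto

context dg_category
begin

lemma hom_subgroup: "X \<in> DOb C \<Longrightarrow> Y \<in> DOb C \<Longrightarrow> additive_subgroup (DHom C X Y n)"
  using hom_complex[of X Y] by (simp add: cochain_complex_def)

lemma dif_closed:
  "X \<in> DOb C \<Longrightarrow> Y \<in> DOb C \<Longrightarrow> f \<in> DHom C X Y n \<Longrightarrow> DDif C X Y n f \<in> DHom C X Y (n + 1)"
  using hom_complex[of X Y] by (auto simp: cochain_complex_def)

lemma dif_dif:
  "X \<in> DOb C \<Longrightarrow> Y \<in> DOb C \<Longrightarrow> f \<in> DHom C X Y n
    \<Longrightarrow> DDif C X Y (n + 1) (DDif C X Y n f) = 0"
  using hom_complex[of X Y] by (auto simp: cochain_complex_def)

lemma dif_additive:
  "X \<in> DOb C \<Longrightarrow> Y \<in> DOb C \<Longrightarrow> additive_on (DHom C X Y n) (DDif C X Y n)"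
  using hom_complex[of X Y] by (simp add: cochain_complex_def additive_on_def)

lemma cmp_additive_left:
  "\<lbrakk>X \<in> DOb C; Y \<in> DOb C; Z \<in> DOb C; g \<in> DHom C X Y n\<rbrakk>
    \<Longrightarrow> additive_on (DHom C Y Z m) (\<lambda>f. DCmp C X Y Z m n f g)"
  by (simp add: additive_on_def hom_subgroup cmp_add_left)

lemma cmp_additive_right:
  "\<lbrakk>X \<in> DOb C; Y \<in> DOb C; Z \<in> DOb C; f \<in> DHom C Y Z m\<rbrakk>
    \<Longrightarrow> additive_on (DHom C X Y n) (\<lambda>g. DCmp C X Y Z m n f g)"
  by (simp add: additive_on_def hom_subgroup cmp_add_right)

end

lemma op_families_iff:
  "g \<in> op_families P J I \<pi> X Y n \<longleftrightarrow> g \<in> extensional I \<and>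
     (\<forall>i\<in>I. g i \<in> TOp P (fiber J \<pi> i) (restrict X (fiber J \<pi> i)) (Y i) (n i))"
  by (auto simp: op_families_def PiE_iff)

lemma op_familiesI:
  "g \<in> extensional I
    \<Longrightarrow> (\<And>i. i \<in> I \<Longrightarrow> g i \<in> TOp P (fiber J \<pi> i) (restrict X (fiber J \<pi> i)) (Y i) (n i))
    \<Longrightarrow> g \<in> op_families P J I \<pi> X Y n"
  by (simp add: op_families_iff)

lemma op_families_upd:
  assumes "g \<in> op_families P J I \<pi> X Y n" and "i \<in> I"
    and "x \<in> TOp P (fiber J \<pi> i) (restrict X (fiber J \<pi> i)) (Y i) q"
  shows "g(i := x) \<in> op_families P J I \<pi> X Y (n(i := q))"
  using assms by (auto simp: op_families_iff extensional_def)

lemma op_families_upd':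
  assumes "g \<in> op_families P J I \<pi> X Y n" and "i \<in> I"
    and "x \<in> TOp P (fiber J \<pi> i) (restrict X (fiber J \<pi> i)) (Y i) (n i)"
  shows "g(i := x) \<in> op_families P J I \<pi> X Y n"
  using assms by (auto simp: op_families_iff extensional_def)

context pseudo_tensor_structure
begin

lemma op_subgroup:
  "\<lbrakk>index_set I; X \<in> I \<rightarrow>\<^sub>E DOb C; B \<in> DOb C\<rbrakk> \<Longrightarrow> additive_subgroup (TOp P I X B n)"
  using op_complex[of I X B] by (simp add: cochain_complex_def)

lemma tdif_closed:
  "\<lbrakk>index_set I; X \<in> I \<rightarrow>\<^sub>E DOb C; B \<in> DOb C; x \<in> TOp P I X B n\<rbrakk>
    \<Longrightarrow> TDif P I X B n x \<in> TOp P I X B (n + 1)"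
  using op_complex[of I X B] by (auto simp: cochain_complex_def)

lemma tdif_tdif:
  "\<lbrakk>index_set I; X \<in> I \<rightarrow>\<^sub>E DOb C; B \<in> DOb C; x \<in> TOp P I X B n\<rbrakk>
    \<Longrightarrow> TDif P I X B (n + 1) (TDif P I X B n x) = 0"
  using op_complex[of I X B] by (auto simp: cochain_complex_def)

lemma tdif_additive:
  "\<lbrakk>index_set I; X \<in> I \<rightarrow>\<^sub>E DOb C; B \<in> DOb C\<rbrakk>
    \<Longrightarrow> additive_on (TOp P I X B n) (TDif P I X B n)"
  using op_complex[of I X B] by (simp add: cochain_complex_def additive_on_def)

lemma one_closed:
  "\<lbrakk>A \<in> DOb C; B \<in> DOb C; u \<in> DHom C A B q\<rbrakk> \<Longrightarrow> TOne P i A B q u \<in> TOp P {i} (\<lambda>_\<in>{i}. A) B q"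
  using one_bij[of A B i q] by (auto simp: bij_betw_def)

lemma one_additive:
  "\<lbrakk>A \<in> DOb C; B \<in> DOb C\<rbrakk> \<Longrightarrow> additive_on (DHom C A B q) (TOne P i A B q)"
  by (simp add: additive_on_def hom_subgroup one_add)

lemma fiber_objects:
  assumes "surjection J I \<pi>" "X \<in> J \<rightarrow>\<^sub>E DOb C" "i \<in> I"
  shows "restrict X (fiber J \<pi> i) \<in> fiber J \<pi> i \<rightarrow>\<^sub>E DOb C"
  using assms fiber_subset[of J \<pi> i] by (auto simp: PiE_iff)

lemma fiber_op_subgroup:
  assumes "surjection J I \<pi>" "X \<in> J \<rightarrow>\<^sub>E DOb C" "Y \<in> I \<rightarrow>\<^sub>E DOb C" "i \<in> I"
  shows "additive_subgroup (TOp P (fiber J \<pi> i) (restrict X (fiber J \<pi> i)) (Y i) q)"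
  using assms by (intro op_subgroup surjection_fiber fiber_objects) auto

lemma tcmp_additive_left:
  assumes "surjection J I \<pi>" "X \<in> J \<rightarrow>\<^sub>E DOb C" "Y \<in> I \<rightarrow>\<^sub>E DOb C" "Z \<in> DOb C" "n \<in> extensional I"
    and "g \<in> op_families P J I \<pi> X Y n"
  shows "additive_on (TOp P I Y Z m) (\<lambda>f. TCmp P J I \<pi> X Y Z m n f g)"
  using assms surjectionD(2)[OF assms(1)] by (simp add: additive_on_def op_subgroup tcmp_add_left)

lemma tcmp_additive_slot:
  assumes "surjection J I \<pi>" "X \<in> J \<rightarrow>\<^sub>E DOb C" "Y \<in> I \<rightarrow>\<^sub>E DOb C" "Z \<in> DOb C" "n \<in> extensional I"
    and "f \<in> TOp P I Y Z m" "g \<in> op_families P J I \<pi> X Y n" "i \<in> I"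
  shows "additive_on (TOp P (fiber J \<pi> i) (restrict X (fiber J \<pi> i)) (Y i) (n i))
     (\<lambda>x. TCmp P J I \<pi> X Y Z m n f (g(i := x)))"
  using assms by (simp add: additive_on_def fiber_op_subgroup tcmp_add_right)

lemma tcmp_zero_slot:
  assumes "surjection J I \<pi>" "X \<in> J \<rightarrow>\<^sub>E DOb C" "Y \<in> I \<rightarrow>\<^sub>E DOb C" "Z \<in> DOb C" "n \<in> extensional I"
    and "f \<in> TOp P I Y Z m" "g \<in> op_families P J I \<pi> X Y n" "i \<in> I" "g i = 0"
  shows "TCmp P J I \<pi> X Y Z m n f g = 0"
  using additive_on_zero[OF tcmp_additive_slot[OF assms(1-8)]] assms(9)
  by (metis fun_upd_triv)

text \<open>This is what makes composites of matrices of operations computable: every inner operation is a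
  sum over the intermediate indices of its slot.\<close>

lemma tcmp_sum_slots:
  assumes "surjection J I \<pi>" "X \<in> J \<rightarrow>\<^sub>E DOb C" "Y \<in> I \<rightarrow>\<^sub>E DOb C" "Z \<in> DOb C" "n \<in> extensional I"
    and "f \<in> TOp P I Y Z m"
    and h: "\<And>i b. i \<in> I \<Longrightarrow> b \<in> B i
        \<Longrightarrow> h i b \<in> TOp P (fiber J \<pi> i) (restrict X (fiber J \<pi> i)) (Y i) (n i)"
  shows "TCmp P J I \<pi> X Y Z m n f (\<lambda>i\<in>I. \<Sum>b\<in>B i. h i b)
       = (\<Sum>b\<in>PiE I B. TCmp P J I \<pi> X Y Z m n f (\<lambda>i\<in>I. h i (b i)))"
  using assms
  by (intro multiadditive_sum[where
        A = "\<lambda>i. TOp P (fiber J \<pi> i) (restrict X (fiber J \<pi> i)) (Y i) (n i)"]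
      surjectionD(4)[OF assms(1)] fiber_op_subgroup tcmp_add_right)
    (auto simp: op_families_def)

section \<open>Substitution of morphisms into operations\<close>

lemma const_family:
  assumes "x \<in> TOp P I X Y n" "X \<in> extensional I"
  shows "(\<lambda>_\<in>{i}. x) \<in> op_families P I {i} (\<lambda>_\<in>I. i) X (\<lambda>_\<in>{i}. Y) (\<lambda>_\<in>{i}. n)"
  using assms by (intro op_familiesI) (auto simp: extensional_restrict)

text \<open>The one-element index set in the definition of \<^const>\<open>post_hom\<close> may be replaced by any other:
  written as the composite of \<open>f\<close> over \<open>{1}\<close> with the identity over \<open>{i}\<close>, the operation over \<open>{i}\<close>
  is reduced to the one over \<open>{1}\<close> by associativity.\<close>

lemma post_hom_index:
  assumes I: "index_set I" and X: "X \<in> I \<rightarrow>\<^sub>E DOb C" and YZ: "Y \<in> DOb C" "Z \<in> DOb C"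
    and f: "f \<in> DHom C Y Z m" and x: "x \<in> TOp P I X Y n"
  shows "TCmp P I {i} (\<lambda>_\<in>I. i) X (\<lambda>_\<in>{i}. Y) Z m (\<lambda>_\<in>{i}. n) (TOne P i Y Z m f) (\<lambda>_\<in>{i}. x)
       = post_hom P I X Y Z m n f x"
proof -
  have Xe: "X \<in> extensional I" using X by (auto simp: PiE_def)
  define c where "c = (\<lambda>_\<in>{i}. (1::nat))"
  have s1: "surjection I {i} (\<lambda>_\<in>I. i)" and s2: "surjection {i} {1} c"
    using surjection_const[OF I] surjection_const[of "{i}" 1] by (auto simp: c_def)
  have cc: "compose I c (\<lambda>_\<in>I. i) = (\<lambda>_\<in>I. 1)" by (auto simp: compose_def c_def)
  have fc: "fiber {i} c 1 = {i}" by (simp add: c_def)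
  have hid: "TOne P i Y Y 0 (DId C Y) \<in> TOp P {i} (\<lambda>_\<in>{i}. Y) Y 0"
    using YZ by (intro one_closed id_closed)
  have g: "(\<lambda>_\<in>{1}. TOne P i Y Y 0 (DId C Y))
      \<in> op_families P {i} {1} c (\<lambda>_\<in>{i}. Y) (\<lambda>_\<in>{1}. Y) (\<lambda>_\<in>{1}. 0)"
    unfolding c_def using hid by (intro const_family) auto
  have ae: "assoc_exp {i} {1} c (\<lambda>_\<in>{1}. 0) (\<lambda>_\<in>{i}. n) = 0"
    by (simp add: c_def)
  have one: "TOne P i Y Z m f = TCmp P {i} {1} c (\<lambda>_\<in>{i}. Y) (\<lambda>_\<in>{1}. Y) Z m (\<lambda>_\<in>{1}. 0)
      (TOne P 1 Y Z m f) (\<lambda>_\<in>{1}. TOne P i Y Y 0 (DId C Y))"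
    using one_cmp[of Y Y Z f m "DId C Y" 0 i 1] YZ f by (simp add: id_right id_closed c_def)
  note a = tcmp_assoc[OF s1 s2 X, where X = "\<lambda>_\<in>{i}. Y" and Y = "\<lambda>_\<in>{1}. Y" and Z = Z and
      n = "\<lambda>_\<in>{1}. 0" and p = "\<lambda>_\<in>{i}. n" and f = "TOne P 1 Y Z m f" and m = m
      and g = "\<lambda>_\<in>{1}. TOne P i Y Y 0 (DId C Y)" and h = "\<lambda>_\<in>{i}. x",
      OF _ _ YZ(2) _ _ one_closed[OF YZ f] g const_family[OF x Xe]]
  have inner: "(\<lambda>k\<in>{1}. let Ji = fiber {i} c k; Ki = fiber I (compose I c (\<lambda>_\<in>I. i)) k
      in TCmp P Ki Ji (restrict (\<lambda>_\<in>I. i) Ki) (restrict X Ki) (restrict (\<lambda>_\<in>{i}. Y) Ji)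
        ((\<lambda>_\<in>{1}. Y) k) ((\<lambda>_\<in>{1}. 0) k) (restrict (\<lambda>_\<in>{i}. n) Ji)
        ((\<lambda>_\<in>{1}. TOne P i Y Y 0 (DId C Y)) k) (restrict (\<lambda>_\<in>{i}. x) Ji)) = (\<lambda>_\<in>{1}. x)"
    using tcmp_id_left[OF I X YZ(1) x, of i]
    by (auto simp: fun_eq_iff cc fc extensional_restrict[OF Xe] Let_def)
  have deg: "(\<lambda>k\<in>{1}. (\<lambda>_\<in>{1}. 0) k + (\<Sum>j\<in>fiber {i} c k. (\<lambda>_\<in>{i}. n) j)) = (\<lambda>_\<in>{1}. n)"
    by (auto simp: fc)
  show ?thesis
    using a YZ unfolding ae inner deg unfolding cc post_hom_def one by (simp add: one)
qed

lemma post_hom_closed: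
  assumes "index_set I" "X \<in> I \<rightarrow>\<^sub>E DOb C" "Y \<in> DOb C" "Z \<in> DOb C"
    and "f \<in> DHom C Y Z m" "x \<in> TOp P I X Y n"
  shows "post_hom P I X Y Z m n f x \<in> TOp P I X Z (m + n)"
proof -
  have "X \<in> extensional I" using assms by (auto simp: PiE_def)
  then show ?thesis
    using assms tcmp_closed[OF surjection_const[OF assms(1), of 1] assms(2) _ assms(4) _
        one_closed[OF assms(3-5)] const_family[OF assms(6)]]
    by (simp add: post_hom_def)
qed

lemma post_hom_additive_left:
  assumes "index_set I" "X \<in> I \<rightarrow>\<^sub>E DOb C" "Y \<in> DOb C" "Z \<in> DOb C" "x \<in> TOp P I X Y n"
  shows "additive_on (DHom C Y Z m) (\<lambda>f. post_hom P I X Y Z m n f x)"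
proof -
  have Xe: "X \<in> extensional I" using assms by (auto simp: PiE_def)
  show ?thesis
    using assms additive_on_add[OF tcmp_additive_left[OF surjection_const[OF assms(1), of 1] assms(2) _
        assms(4) _ const_family[OF assms(5) Xe]] one_closed[of Y Z _ m 1] one_closed[of Y Z _ m 1]]
    by (simp add: additive_on_def hom_subgroup post_hom_def one_add)
qed

lemma post_hom_additive_right:
  assumes "index_set I" "X \<in> I \<rightarrow>\<^sub>E DOb C" "Y \<in> DOb C" "Z \<in> DOb C" "f \<in> DHom C Y Z m"
  shows "additive_on (TOp P I X Y n) (post_hom P I X Y Z m n f)"
  unfolding additive_on_def
proof (intro conjI ballI op_subgroup assms)
  fix x y assume x: "x \<in> TOp P I X Y n" and y: "y \<in> TOp P I X Y n"
  have Xe: "X \<in> extensional I" using assms by (auto simp: PiE_def)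
  show "post_hom P I X Y Z m n f (x + y) = post_hom P I X Y Z m n f x + post_hom P I X Y Z m n f y"
    using additive_on_add[OF tcmp_additive_slot[OF surjection_const[OF assms(1), of 1] assms(2) _
        assms(4) _ one_closed[OF assms(3-5)] const_family[OF x Xe], of 1]] assms x y
    by (simp add: post_hom_def extensional_restrict[OF Xe])
qed

lemma post_hom_dif:
  assumes "index_set I" "X \<in> I \<rightarrow>\<^sub>E DOb C" "Y \<in> DOb C" "Z \<in> DOb C"
    and "f \<in> DHom C Y Z m" "x \<in> TOp P I X Y n"
  shows "TDif P I X Z (m + n) (post_hom P I X Y Z m n f x)
       = post_hom P I X Y Z (m + 1) n (DDif C Y Z m f) x
         + ksign m (post_hom P I X Y Z m (n + 1) f (TDif P I X Y n x))"
proof -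
  have Xe: "X \<in> extensional I" using assms by (auto simp: PiE_def)
  have e: "{i::nat. i = 1 \<and> i = 0} = {}" by auto
  show ?thesis
    using tcmp_dif[OF surjection_const[OF assms(1), of 1] assms(2) _
        assms(4) _ one_closed[OF assms(3-5)] const_family[OF assms(6) Xe]] assms
    by (simp add: e post_hom_def extensional_restrict[OF Xe] one_dif)
qed

lemma post_hom_cmp:
  assumes I: "index_set I" "X \<in> I \<rightarrow>\<^sub>E DOb C" and "A \<in> DOb C" "Y \<in> DOb C" "Z \<in> DOb C"
    and f: "f \<in> DHom C Y Z m" and g: "g \<in> DHom C A Y q" and x: "x \<in> TOp P I X A n"
  shows "post_hom P I X A Z (m + q) n (DCmp C A Y Z m q f g) x
       = post_hom P I X Y Z m (q + n) f (post_hom P I X A Y q n g x)"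
proof -
  have Xe: "X \<in> extensional I" using assms by (auto simp: PiE_def)
  define c where "c = (\<lambda>_\<in>{1::nat}. (1::nat))"
  have s1: "surjection I {1} (\<lambda>_\<in>I. 1)" and s2: "surjection {1} {1} c"
    using surjection_const[OF I(1)] surjection_const[of "{1}" 1] by (auto simp: c_def)
  have cc: "compose I c (\<lambda>_\<in>I. 1) = (\<lambda>_\<in>I. 1)" by (auto simp: compose_def c_def)
  have fc: "fiber {1} c 1 = {1}" by (simp add: c_def)
  have g': "(\<lambda>_\<in>{1}. TOne P 1 A Y q g)
      \<in> op_families P {1} {1} c (\<lambda>_\<in>{1}. A) (\<lambda>_\<in>{1}. Y) (\<lambda>_\<in>{1}. q)"
    unfolding c_def using assms by (intro const_family one_closed) auto
  have ae: "assoc_exp {1} {1} c (\<lambda>_\<in>{1}. q) (\<lambda>_\<in>{1}. n) = 0"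
    by (simp add: c_def)
  note a = tcmp_assoc[OF s1 s2 I(2), where X = "\<lambda>_\<in>{1}. A" and Y = "\<lambda>_\<in>{1}. Y" and Z = Z and
      n = "\<lambda>_\<in>{1}. q" and p = "\<lambda>_\<in>{1}. n" and f = "TOne P 1 Y Z m f" and m = m
      and g = "\<lambda>_\<in>{1}. TOne P 1 A Y q g" and h = "\<lambda>_\<in>{1}. x",
      OF _ _ _ _ _ one_closed[OF _ _ f] g' const_family[OF x Xe]]
  have inner: "(\<lambda>k\<in>{1}. let Ji = fiber {1} c k; Ki = fiber I (compose I c (\<lambda>_\<in>I. 1)) k
      in TCmp P Ki Ji (restrict (\<lambda>_\<in>I. 1) Ki) (restrict X Ki) (restrict (\<lambda>_\<in>{1}. A) Ji)
        ((\<lambda>_\<in>{1}. Y) k) ((\<lambda>_\<in>{1}. q) k) (restrict (\<lambda>_\<in>{1}. n) Ji)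
        ((\<lambda>_\<in>{1}. TOne P 1 A Y q g) k) (restrict (\<lambda>_\<in>{1}. x) Ji))
      = (\<lambda>_\<in>{1}. post_hom P I X A Y q n g x)"
    by (auto simp: fun_eq_iff cc fc extensional_restrict[OF Xe] Let_def post_hom_def)
  have deg: "(\<lambda>k\<in>{1}. (\<lambda>_\<in>{1}. q) k + (\<Sum>j\<in>fiber {1} c k. (\<lambda>_\<in>{1}. n) j)) = (\<lambda>_\<in>{1}. q + n)"
    by (auto simp: fc)
  show ?thesis
    using a assms unfolding ae inner deg unfolding cc
    by (simp add: post_hom_def one_cmp[of A Y Z f m g q 1 1] c_def)
qed

text \<open>Associativity for a map onto a one-element set, in which there is nothing to commute and hence
  no sign.\<close>

lemma post_hom_tcmp:
  assumes s: "surjection J I \<pi>" and X: "X \<in> J \<rightarrow>\<^sub>E DOb C" and Y: "Y \<in> I \<rightarrow>\<^sub>E DOb C"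
    and Z: "Z \<in> DOb C" "Z' \<in> DOb C"
    and n: "n \<in> extensional I" and f: "f \<in> TOp P I Y Z m" and g: "g \<in> op_families P J I \<pi> X Y n"
    and u: "u \<in> DHom C Z Z' q"
  shows "post_hom P J X Z Z' q (m + (\<Sum>i\<in>I. n i)) u (TCmp P J I \<pi> X Y Z m n f g)
       = TCmp P J I \<pi> X Y Z' (q + m) n (post_hom P I Y Z Z' q m u f) g"
proof -
  have I: "index_set I" and J: "index_set J" using surjectionD[OF s] by auto
  have pe: "\<pi> \<in> extensional J" and pI: "\<And>j. j \<in> J \<Longrightarrow> \<pi> j \<in> I" using surjectionD[OF s] by auto
  have ext: "X \<in> extensional J" "Y \<in> extensional I" "g \<in> extensional I"
    using X Y g by (auto simp: PiE_def op_families_def)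
  define c where "c = (\<lambda>_\<in>I. (1::nat))"
  have s2: "surjection I {1} c" using surjection_const[OF I] by (simp add: c_def)
  have cc: "compose J c \<pi> = (\<lambda>_\<in>J. 1)" using pI by (auto simp: compose_def c_def)
  have fc: "fiber I c 1 = I" by (simp add: c_def)
  have f': "(\<lambda>_\<in>{1}. f) \<in> op_families P I {1} c Y (\<lambda>_\<in>{1}. Z) (\<lambda>_\<in>{1}. m)"
    unfolding c_def using ext f by (intro const_family) auto
  have ae: "assoc_exp I {1} c (\<lambda>_\<in>{1}. m) n = 0"
    by (simp add: c_def)
  note a = tcmp_assoc[OF s s2 X Y, where Y = "\<lambda>_\<in>{1}. Z" and Z = Z' and
      n = "\<lambda>_\<in>{1}. m" and p = n and f = "TOne P 1 Z Z' q u" and m = q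
      and g = "\<lambda>_\<in>{1}. f" and h = g,
      OF _ Z(2) _ n one_closed[OF Z u] f' g]
  have inner: "(\<lambda>k\<in>{1}. let Ji = fiber I c k; Ki = fiber J (compose J c \<pi>) k
      in TCmp P Ki Ji (restrict \<pi> Ki) (restrict X Ki) (restrict Y Ji)
        ((\<lambda>_\<in>{1}. Z) k) ((\<lambda>_\<in>{1}. m) k) (restrict n Ji)
        ((\<lambda>_\<in>{1}. f) k) (restrict g Ji))
      = (\<lambda>_\<in>{1}. TCmp P J I \<pi> X Y Z m n f g)"
    by (auto simp: fun_eq_iff cc fc extensional_restrict ext pe n Let_def)
  have deg: "(\<lambda>k\<in>{1}. (\<lambda>_\<in>{1}. m) k + (\<Sum>j\<in>fiber I c k. n j)) = (\<lambda>_\<in>{1}. m + (\<Sum>i\<in>I. n i))"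
    by (auto simp: fc)
  show ?thesis
    using a assms unfolding ae inner deg unfolding cc
    by (simp add: post_hom_def c_def)
qed

end

section \<open>Twisting a DG category by Maurer-Cartan elements\<close>

lemma ksign_double [simp]: "ksign (n + n) x = x" "ksign (2 * n) x = x"
  by (simp_all add: ksign_def)

lemma ksign_one [simp]: "ksign 1 x = - x"
  by (simp add: ksign_def)

lemma ksign_1_plus [simp]: "ksign (1 + n) x = - ksign n x"
  by (simp add: ksign_def)

lemma additive_on_twist:
  assumes "additive_on A \<phi>" "a \<in> A" "b \<in> A" "c \<in> A"
  shows "\<phi> (a + b - ksign n c) = \<phi> a + \<phi> b - ksign n (\<phi> c)"
  using assms additive_on_subgroup[OF assms(1)]
  by (simp add: additive_on_diff[OF assms(1)] additive_on_add[OF assms(1)]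
      additive_on_ksign[OF assms(1)] subgroup_add subgroup_ksign)

definition mc_element :: "('o, 'm::ab_group_add) dg_cat \<Rightarrow> 'o \<Rightarrow> 'm \<Rightarrow> bool" where
  "mc_element C E a \<longleftrightarrow> a \<in> DHom C E E 1 \<and> DDif C E E 1 a + DCmp C E E E 1 1 a a = 0"

definition twist_dif ::
    "('o, 'm::ab_group_add) dg_cat \<Rightarrow> ('o \<Rightarrow> 'm) \<Rightarrow> 'o \<Rightarrow> 'o \<Rightarrow> int \<Rightarrow> 'm \<Rightarrow> 'm" where
  "twist_dif C e X Y n f = DDif C X Y n f + DCmp C X Y Y 1 n (e Y) f
     - ksign n (DCmp C X X Y n 1 f (e X))"

definition twist_cat ::
    "('o, 'm::ab_group_add) dg_cat \<Rightarrow> 'o set \<Rightarrow> ('o \<Rightarrow> 'm) \<Rightarrow> ('o, 'm) dg_cat" where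
  "twist_cat C T e = C\<lparr>DOb := T, DDif := twist_dif C e\<rparr>"

lemma twist_cat_simps [simp]:
  "DOb (twist_cat C T e) = T" "DHom (twist_cat C T e) = DHom C"
  "DDif (twist_cat C T e) = twist_dif C e" "DCmp (twist_cat C T e) = DCmp C"
  "DId (twist_cat C T e) = DId C"
  by (simp_all add: twist_cat_def)

text \<open>
  The last assumption says that every Maurer-Cartan element of an object \<open>S\<close> of \<open>C\<close> is the chosen
  element of some object of \<open>T\<close> that \<open>C\<close> cannot tell apart from \<open>S\<close>. It provides direct sums in the
  twisted category.
\<close>

locale mc_family = dg_category C for C :: "('o, 'm::ab_group_add) dg_cat" +
  fixes T :: "'o set" and e :: "'o \<Rightarrow> 'm"
  assumes T_sub: "E \<in> T \<Longrightarrow> E \<in> DOb C"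
    and mc: "E \<in> T \<Longrightarrow> mc_element C E (e E)"
    and mc_realized: "S \<in> DOb C \<Longrightarrow> mc_element C S x \<Longrightarrow>
      \<exists>S'\<in>T. e S' = x \<and> DId C S' = DId C S \<and>
        (\<forall>A. DHom C A S' = DHom C A S \<and> DHom C S' A = DHom C S A \<and>
             DDif C A S' = DDif C A S \<and> DDif C S' A = DDif C S A) \<and>
        (\<forall>A B. DCmp C A B S' = DCmp C A B S \<and> DCmp C A S' B = DCmp C A S B \<and>
               DCmp C S' A B = DCmp C S A B)"
begin

lemma e_closed: "E \<in> T \<Longrightarrow> e E \<in> DHom C E E 1"
  using mc by (simp add: mc_element_def)

lemma mc_equation: "E \<in> T \<Longrightarrow> DDif C E E 1 (e E) + DCmp C E E E 1 1 (e E) (e E) = 0"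
  using mc by (simp add: mc_element_def)

lemma twist_dif_terms:
  assumes "X \<in> T" "Y \<in> T" "f \<in> DHom C X Y n"
  shows "DDif C X Y n f \<in> DHom C X Y (n + 1)" "DCmp C X Y Y 1 n (e Y) f \<in> DHom C X Y (n + 1)"
    "DCmp C X X Y n 1 f (e X) \<in> DHom C X Y (n + 1)"
  using assms dif_closed[of X Y f n] cmp_closed[of X Y Y "e Y" 1 f n] cmp_closed[of X X Y f n "e X" 1]
  by (simp_all add: T_sub e_closed add.commute)

lemma twist_dif_closed:
  assumes "X \<in> T" "Y \<in> T" "f \<in> DHom C X Y n"
  shows "twist_dif C e X Y n f \<in> DHom C X Y (n + 1)"
  unfolding twist_dif_def using twist_dif_terms[OF assms] assms
  by (intro subgroup_diff subgroup_add subgroup_ksign hom_subgroup) (auto simp: T_sub)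

lemma twist_dif_add:
  assumes "X \<in> T" "Y \<in> T" "f \<in> DHom C X Y n" "g \<in> DHom C X Y n"
  shows "twist_dif C e X Y n (f + g) = twist_dif C e X Y n f + twist_dif C e X Y n g"
  using assms additive_on_add[OF dif_additive, of X Y f n g]
  by (simp add: twist_dif_def T_sub e_closed cmp_add_left cmp_add_right ksign_add)

text \<open>The mixed terms cancel, as $D(af) = (Da)f - a(Df)$ and likewise for \<open>fb\<close>; there remains
  $(Da + aa)f - f(Db + bb)$.\<close>

lemma twist_dif_square:
  assumes X: "X \<in> T" and Y: "Y \<in> T" and f: "f \<in> DHom C X Y n"
  shows "twist_dif C e X Y (n + 1) (twist_dif C e X Y n f) = 0"
proof -
  define a b where "a = e Y" and "b = e X"
  note O = T_sub[OF X] T_sub[OF Y]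
  have ab: "a \<in> DHom C Y Y 1" "b \<in> DHom C X X 1"
    using X Y by (simp_all add: a_def b_def e_closed)
  define af fb df where "af = DCmp C X Y Y 1 n a f" and "fb = DCmp C X X Y n 1 f b"
    and "df = DDif C X Y n f"
  have t: "df \<in> DHom C X Y (n + 1)" "af \<in> DHom C X Y (n + 1)" "fb \<in> DHom C X Y (n + 1)"
    using twist_dif_terms[OF X Y f] by (simp_all add: af_def fb_def df_def a_def b_def)
  have lin: "\<phi> (df + af - ksign n fb) = \<phi> df + \<phi> af - ksign n (\<phi> fb)"
    if "additive_on (DHom C X Y (n + 1)) \<phi>" for \<phi> :: "'m \<Rightarrow> 'm"
    by (rule additive_on_twist[OF that t])
  have d1: "DDif C X Y (n + 1) df = 0" unfolding df_def using O f by (intro dif_dif)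
  have d2: "DDif C X Y (n + 1) af = DCmp C X Y Y 2 n (DDif C Y Y 1 a) f - DCmp C X Y Y 1 (n + 1) a df"
    using dif_cmp[OF O(1,2,2) ab(1) f] by (simp add: af_def df_def add.commute)
  have d3: "DDif C X Y (n + 1) fb = DCmp C X X Y (n + 1) 1 df b
      + ksign n (DCmp C X X Y n 2 f (DDif C X X 1 b))"
    using dif_cmp[OF O(1,1,2) f ab(2)] by (simp add: fb_def df_def add.commute)
  have a2: "DCmp C X Y Y 1 (n + 1) a af = DCmp C X Y Y 2 n (DCmp C Y Y Y 1 1 a a) f"
    using cmp_assoc[OF O(1,2,2,2) ab(1,1) f] by (simp add: af_def add.commute)
  have a3: "DCmp C X Y Y 1 (n + 1) a fb = DCmp C X X Y (n + 1) 1 af b"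
    using cmp_assoc[OF O(1,1,2,2) ab(1) f ab(2)] by (simp add: af_def fb_def add.commute)
  have b3: "DCmp C X X Y (n + 1) 1 fb b = DCmp C X X Y n 2 f (DCmp C X X X 1 1 b b)"
    using cmp_assoc[OF O(1,1,1,2) f ab(2,2)] by (simp add: fb_def)
  have ma: "DDif C Y Y 1 a \<in> DHom C Y Y 2" "DCmp C Y Y Y 1 1 a a \<in> DHom C Y Y 2"
      "DDif C X X 1 b \<in> DHom C X X 2" "DCmp C X X X 1 1 b b \<in> DHom C X X 2"
    using dif_closed[OF O(2,2) ab(1)] dif_closed[OF O(1,1) ab(2)]
      cmp_closed[OF O(2,2,2) ab(1,1)] cmp_closed[OF O(1,1,1) ab(2,2)] by simp_all
  have mcY: "DCmp C X Y Y 2 n (DDif C Y Y 1 a) f + DCmp C X Y Y 2 n (DCmp C Y Y Y 1 1 a a) f = 0"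
    using additive_on_zero[OF cmp_additive_left[OF O(1,2,2) f, of 2]] mc_equation[OF Y] ma f O
    by (simp add: cmp_add_left[symmetric] a_def)
  have mcX: "DCmp C X X Y n 2 f (DDif C X X 1 b) + DCmp C X X Y n 2 f (DCmp C X X X 1 1 b b) = 0"
    using additive_on_zero[OF cmp_additive_right[OF O(1,1,2) f, of 2]] mc_equation[OF X] ma f O
    by (simp add: cmp_add_right[symmetric] b_def)
  have "twist_dif C e X Y (n + 1) (df + af - ksign n fb)
     = (DDif C X Y (n + 1) df + DDif C X Y (n + 1) af - ksign n (DDif C X Y (n + 1) fb))
       + (DCmp C X Y Y 1 (n + 1) a df + DCmp C X Y Y 1 (n + 1) a af
          - ksign n (DCmp C X Y Y 1 (n + 1) a fb))
       + ksign n (DCmp C X X Y (n + 1) 1 df b + DCmp C X X Y (n + 1) 1 af b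
          - ksign n (DCmp C X X Y (n + 1) 1 fb b))"
    unfolding twist_dif_def a_def[symmetric] b_def[symmetric]
    by (simp add: lin[OF dif_additive] lin[OF cmp_additive_right] lin[OF cmp_additive_left] O ab)
  also have "\<dots> = (DCmp C X Y Y 2 n (DDif C Y Y 1 a) f + DCmp C X Y Y 2 n (DCmp C Y Y Y 1 1 a a) f)
     - (DCmp C X X Y n 2 f (DDif C X X 1 b) + DCmp C X X Y n 2 f (DCmp C X X X 1 1 b b))"
    unfolding d1 d2 d3 a2 a3 b3 by (simp add: ksign_add ksign_diff)
  finally show ?thesis
    unfolding mcX mcY
    by (simp add: twist_dif_def df_def af_def fb_def a_def b_def)
qed

lemma twist_dif_cmp:
  assumes T: "X \<in> T" "Y \<in> T" "Z \<in> T" and f: "f \<in> DHom C Y Z m" and g: "g \<in> DHom C X Y n"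
  shows "twist_dif C e X Z (m + n) (DCmp C X Y Z m n f g)
    = DCmp C X Y Z (m + 1) n (twist_dif C e Y Z m f) g
      + ksign m (DCmp C X Y Z m (n + 1) f (twist_dif C e X Y n g))"
proof -
  note O = T_sub[OF T(1)] T_sub[OF T(2)] T_sub[OF T(3)]
  note tf = twist_dif_terms[OF T(2,3) f] and tg = twist_dif_terms[OF T(1,2) g]
  have 1: "DCmp C X Y Z (m + 1) n (twist_dif C e Y Z m f) g
      = DCmp C X Y Z (m + 1) n (DDif C Y Z m f) g
       + DCmp C X Y Z (m + 1) n (DCmp C Y Z Z 1 m (e Z) f) g
       - ksign m (DCmp C X Y Z (m + 1) n (DCmp C Y Y Z m 1 f (e Y)) g)"
    unfolding twist_dif_def
    by (rule additive_on_twist[OF cmp_additive_left[OF O g] tf])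
  have 2: "DCmp C X Y Z m (n + 1) f (twist_dif C e X Y n g)
      = DCmp C X Y Z m (n + 1) f (DDif C X Y n g)
       + DCmp C X Y Z m (n + 1) f (DCmp C X Y Y 1 n (e Y) g)
       - ksign n (DCmp C X Y Z m (n + 1) f (DCmp C X X Y n 1 g (e X)))"
    unfolding twist_dif_def
    by (rule additive_on_twist[OF cmp_additive_right[OF O f] tg])
  have a1: "DCmp C X Y Z (m + 1) n (DCmp C Y Z Z 1 m (e Z) f) g
      = DCmp C X Z Z 1 (m + n) (e Z) (DCmp C X Y Z m n f g)"
    using cmp_assoc[OF O(1,2,3,3) e_closed[OF T(3)] f g] by (simp add: add.commute)
  have a2: "DCmp C X Y Z (m + 1) n (DCmp C Y Y Z m 1 f (e Y)) g
      = DCmp C X Y Z m (n + 1) f (DCmp C X Y Y 1 n (e Y) g)"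
    using cmp_assoc[OF O(1,2,2,3) f e_closed[OF T(2)] g] by (simp add: add.commute)
  have a3: "DCmp C X X Z (m + n) 1 (DCmp C X Y Z m n f g) (e X)
      = DCmp C X Y Z m (n + 1) f (DCmp C X X Y n 1 g (e X))"
    using cmp_assoc[OF O(1,1,2,3) f g e_closed[OF T(1)]] by simp
  show ?thesis
    unfolding 1 2 a1 a2 unfolding twist_dif_def a3 dif_cmp[OF O f g]
    by (simp add: ksign_add ksign_diff)
qed

text \<open>The direct sum of twisted objects is the direct sum \<open>S\<close> of the underlying ones, twisted by
  the diagonal element $\sum_k inc_k e_k proj_k$.\<close>

lemma twist_direct_sums:
  fixes r :: nat
  assumes A: "\<And>k. k < r \<Longrightarrow> A k \<in> T"
  shows "\<exists>S\<in>T. \<exists>inc proj.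
      (\<forall>k<r. inc k \<in> DHom C (A k) S 0 \<and> twist_dif C e (A k) S 0 (inc k) = 0) \<and>
      (\<forall>k<r. proj k \<in> DHom C S (A k) 0 \<and> twist_dif C e S (A k) 0 (proj k) = 0) \<and>
      (\<forall>k<r. \<forall>l<r. DCmp C (A k) S (A l) 0 0 (proj l) (inc k)
                       = (if k = l then DId C (A k) else 0)) \<and>
      (\<Sum>k<r. DCmp C S (A k) S 0 0 (inc k) (proj k)) = DId C S"
proof -
  have AO: "A k \<in> DOb C" if "k < r" for k using T_sub A that by simp
  have ek: "e (A k) \<in> DHom C (A k) (A k) 1" if "k < r" for k using e_closed A that by simp
  obtain S inc proj where S: "S \<in> DOb C"
    and all: "\<forall>k<r. inc k \<in> DHom C (A k) S 0 \<and> DDif C (A k) S 0 (inc k) = 0"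
      "\<forall>k<r. proj k \<in> DHom C S (A k) 0 \<and> DDif C S (A k) 0 (proj k) = 0"
      "\<forall>k<r. \<forall>l<r. DCmp C (A k) S (A l) 0 0 (proj l) (inc k)
                           = (if k = l then DId C (A k) else 0)"
    and ip: "(\<Sum>k<r. DCmp C S (A k) S 0 0 (inc k) (proj k)) = DId C S"
    using finite_direct_sums[of r A, OF AO] by simp (elim bexE exE conjE, rule that)
  have inc: "\<And>k. k < r \<Longrightarrow> inc k \<in> DHom C (A k) S 0"
    and dinc: "\<And>k. k < r \<Longrightarrow> DDif C (A k) S 0 (inc k) = 0"
    and proj: "\<And>k. k < r \<Longrightarrow> proj k \<in> DHom C S (A k) 0"
    and dproj: "\<And>k. k < r \<Longrightarrow> DDif C S (A k) 0 (proj k) = 0"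
    and pi: "\<And>k l. k < r \<Longrightarrow> l < r \<Longrightarrow> DCmp C (A k) S (A l) 0 0 (proj l) (inc k)
                           = (if k = l then DId C (A k) else 0)"
    using all by auto
  define u where "u k = DCmp C S (A k) (A k) 1 0 (e (A k)) (proj k)" for k
  define x where "x = (\<Sum>k<r. DCmp C S (A k) S 0 1 (inc k) (u k))"
  have u: "u k \<in> DHom C S (A k) 1" if "k < r" for k
    using cmp_closed[OF S AO AO ek proj] that by (simp add: u_def)
  have iu: "DCmp C S (A k) S 0 1 (inc k) (u k) \<in> DHom C S S 1" if "k < r" for k
    using cmp_closed[OF S AO S inc u] that by simp
  have x: "x \<in> DHom C S S 1" unfolding x_def
    using S iu by (intro subgroup_sum hom_subgroup) auto
  have u_inc: "DCmp C (A k) S (A l) 1 0 (u l) (inc k) = (if k = l then e (A k) else 0)"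
    if k: "k < r" and l: "l < r" for k l
    using cmp_assoc[OF AO[OF k] S AO[OF l] AO[OF l] ek[OF l] proj[OF l] inc[OF k]] pi[OF k l]
      additive_on_zero[OF cmp_additive_right[OF AO[OF k] AO[OF l] AO[OF l] ek[OF l]], of 0]
    by (auto simp: u_def id_right[OF AO[OF l] AO[OF l] ek[OF l]])
  have x_inc: "DCmp C (A k) S S 1 0 x (inc k) = DCmp C (A k) (A k) S 0 1 (inc k) (e (A k))"
    if k: "k < r" for k
  proof -
    have "DCmp C (A k) S S 1 0 x (inc k)
        = (\<Sum>l<r. DCmp C (A k) S S 1 0 (DCmp C S (A l) S 0 1 (inc l) (u l)) (inc k))"
      unfolding x_def using iu
      by (intro additive_on_sum[OF cmp_additive_left[OF AO[OF k] S S inc[OF k]]]) auto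
    also have "\<dots> = (\<Sum>l<r. if l = k then DCmp C (A k) (A k) S 0 1 (inc k) (e (A k)) else 0)"
    proof (intro sum.cong refl)
      fix l assume "l \<in> {..<r}"
      then have l: "l < r" by simp
      show "DCmp C (A k) S S 1 0 (DCmp C S (A l) S 0 1 (inc l) (u l)) (inc k)
          = (if l = k then DCmp C (A k) (A k) S 0 1 (inc k) (e (A k)) else 0)"
        using cmp_assoc[OF AO[OF k] S AO[OF l] S inc[OF l] u[OF l] inc[OF k]] u_inc[OF k l]
          additive_on_zero[OF cmp_additive_right[OF AO[OF k] AO[OF l] S inc[OF l]], of 1] by simp
    qed
    finally show ?thesis using k by (simp add: sum.delta')
  qed
  have proj_x: "DCmp C S S (A k) 0 1 (proj k) x = u k" if k: "k < r" for k
  proof -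
    have "DCmp C S S (A k) 0 1 (proj k) x
        = (\<Sum>l<r. DCmp C S S (A k) 0 1 (proj k) (DCmp C S (A l) S 0 1 (inc l) (u l)))"
      unfolding x_def using iu
      by (intro additive_on_sum[OF cmp_additive_right[OF S S AO[OF k] proj[OF k]]]) auto
    also have "\<dots> = (\<Sum>l<r. if l = k then u k else 0)"
    proof (intro sum.cong refl)
      fix l assume "l \<in> {..<r}"
      then have l: "l < r" by simp
      have "DCmp C S S (A k) 0 1 (proj k) (DCmp C S (A l) S 0 1 (inc l) (u l))
          = DCmp C S (A l) (A k) 0 1 (if l = k then DId C (A l) else 0) (u l)"
        using cmp_assoc[OF S AO[OF l] S AO[OF k] proj[OF k] inc[OF l] u[OF l]] pi[OF l k] by simp
      then show "DCmp C S S (A k) 0 1 (proj k) (DCmp C S (A l) S 0 1 (inc l) (u l))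
          = (if l = k then u k else 0)"
        using additive_on_zero[OF cmp_additive_left[OF S AO[OF l] AO[OF k] u[OF l]], of 0]
          id_left[OF S AO[OF k] u[OF k]] by simp
    qed
    finally show ?thesis using k by (simp add: sum.delta')
  qed
  let ?conj = "\<lambda>y k. DCmp C S (A k) S 0 2 (inc k) (DCmp C S (A k) (A k) 2 0 (y k) (proj k))"
  have dx: "DDif C S S 1 x = (\<Sum>k<r. ?conj (\<lambda>k. DDif C (A k) (A k) 1 (e (A k))) k)"
  proof -
    have "DDif C S S 1 x = (\<Sum>k<r. DDif C S S 1 (DCmp C S (A k) S 0 1 (inc k) (u k)))"
      unfolding x_def using iu by (intro additive_on_sum[OF dif_additive[OF S S]]) auto
    also have "\<dots> = (\<Sum>k<r. ?conj (\<lambda>k. DDif C (A k) (A k) 1 (e (A k))) k)"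
    proof (intro sum.cong refl)
      fix k assume "k \<in> {..<r}"
      then have k: "k < r" by simp
      note Ak = AO[OF k]
      have "DDif C S S 1 (DCmp C S (A k) S 0 1 (inc k) (u k))
         = DCmp C S (A k) S 0 2 (inc k) (DDif C S (A k) 1 (u k))"
        using dif_cmp[OF S Ak S inc[OF k] u[OF k]] dinc[OF k]
          additive_on_zero[OF cmp_additive_left[OF S Ak S u[OF k]]] by simp
      moreover have "DDif C S (A k) 1 (u k)
          = DCmp C S (A k) (A k) 2 0 (DDif C (A k) (A k) 1 (e (A k))) (proj k)"
        using dif_cmp[OF S Ak Ak ek[OF k] proj[OF k]] dproj[OF k]
          additive_on_zero[OF cmp_additive_right[OF S Ak Ak ek[OF k]], of 1]
        by (simp add: u_def)
      ultimately show "DDif C S S 1 (DCmp C S (A k) S 0 1 (inc k) (u k))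
        = ?conj (\<lambda>k. DDif C (A k) (A k) 1 (e (A k))) k" by simp
    qed
    finally show ?thesis .
  qed
  have xx: "DCmp C S S S 1 1 x x
    = (\<Sum>k<r. ?conj (\<lambda>k. DCmp C (A k) (A k) (A k) 1 1 (e (A k)) (e (A k))) k)"
  proof -
    have "DCmp C S S S 1 1 x x
        = (\<Sum>k<r. DCmp C S S S 1 1 x (DCmp C S (A k) S 0 1 (inc k) (u k)))"
      using iu additive_on_sum[OF cmp_additive_right[OF S S S x],
          of "{..<r}" "\<lambda>k. DCmp C S (A k) S 0 1 (inc k) (u k)" 1]
      by (simp flip: x_def)
    also have "\<dots> = (\<Sum>k<r. ?conj (\<lambda>k. DCmp C (A k) (A k) (A k) 1 1 (e (A k)) (e (A k))) k)"
    proof (intro sum.cong refl)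
      fix k assume "k \<in> {..<r}"
      then have k: "k < r" by simp
      note Ak = AO[OF k]
      show "DCmp C S S S 1 1 x (DCmp C S (A k) S 0 1 (inc k) (u k))
        = ?conj (\<lambda>k. DCmp C (A k) (A k) (A k) 1 1 (e (A k)) (e (A k))) k"
        using cmp_assoc[OF S Ak S S x inc[OF k] u[OF k]] x_inc[OF k]
          cmp_assoc[OF S Ak Ak S inc[OF k] ek[OF k] u[OF k]]
          cmp_assoc[OF S Ak Ak Ak ek[OF k] ek[OF k] proj[OF k]]
        by (simp add: u_def)
    qed
    finally show ?thesis .
  qed
  have "DDif C S S 1 x + DCmp C S S S 1 1 x x = 0"
    unfolding dx xx sum.distrib[symmetric]
  proof (intro sum.neutral ballI)
    fix k assume "k \<in> {..<r}"
    then have k: "k < r" by simp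
    note Ak = AO[OF k]
    have 1: "DDif C (A k) (A k) 1 (e (A k)) \<in> DHom C (A k) (A k) 2"
      "DCmp C (A k) (A k) (A k) 1 1 (e (A k)) (e (A k)) \<in> DHom C (A k) (A k) 2"
      using dif_closed[OF Ak Ak ek[OF k]] cmp_closed[OF Ak Ak Ak ek[OF k] ek[OF k]] by simp_all
    have 2: "DCmp C S (A k) (A k) 2 0 y (proj k) \<in> DHom C S (A k) 2"
      if "y \<in> DHom C (A k) (A k) 2" for y
      using cmp_closed[OF S Ak Ak that proj[OF k]] by simp
    show "?conj (\<lambda>k. DDif C (A k) (A k) 1 (e (A k))) k
      + ?conj (\<lambda>k. DCmp C (A k) (A k) (A k) 1 1 (e (A k)) (e (A k))) k = 0"
      using additive_on_zero[OF cmp_additive_right[OF S Ak S inc[OF k]], of 2]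
        additive_on_zero[OF cmp_additive_left[OF S Ak Ak proj[OF k]], of 2]
        mc_equation[OF A[OF k]]
      by (simp add: cmp_add_right[OF S Ak S inc[OF k], symmetric] 1 2
          cmp_add_left[OF S Ak Ak _ _ proj[OF k], symmetric])
  qed
  with x have "mc_element C S x" by (simp add: mc_element_def)
  from mc_realized[OF S this] obtain S' where S': "S' \<in> T" and eS': "e S' = x" "DId C S' = DId C S"
    and same: "\<And>A. DHom C A S' = DHom C A S" "\<And>A. DHom C S' A = DHom C S A"
      "\<And>A. DDif C A S' = DDif C A S" "\<And>A. DDif C S' A = DDif C S A"
      "\<And>A B. DCmp C A B S' = DCmp C A B S" "\<And>A B. DCmp C A S' B = DCmp C A S B"
      "\<And>A B. DCmp C S' A B = DCmp C S A B" by blast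
  have "twist_dif C e (A k) S' 0 (inc k) = 0" if "k < r" for k
    using x_inc[OF that] dinc[OF that] by (simp add: twist_dif_def same eS')
  moreover have "twist_dif C e S' (A k) 0 (proj k) = 0" if "k < r" for k
    using proj_x[OF that] dproj[OF that] by (simp add: twist_dif_def same eS' u_def)
  ultimately show ?thesis
    using S' inc proj pi ip
    by (intro bexI[of _ S'] exI[of _ inc] exI[of _ proj]) (simp_all add: same eS')
qed

theorem twist_dg_category: "dg_category (twist_cat C T e)"
proof
  fix X Y assume "X \<in> DOb (twist_cat C T e)" "Y \<in> DOb (twist_cat C T e)"
  then show "cochain_complex (DHom (twist_cat C T e) X Y) (DDif (twist_cat C T e) X Y)"
    unfolding cochain_complex_def
    by (auto simp: T_sub hom_subgroup twist_dif_closed twist_dif_add twist_dif_square)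
next
  fix X assume "X \<in> DOb (twist_cat C T e)"
  then show "DDif (twist_cat C T e) X X 0 (DId (twist_cat C T e) X) = 0"
    by (simp add: twist_dif_def id_dif id_left id_right T_sub e_closed)
next
  fix r :: nat and A
  assume "\<And>k. k < r \<Longrightarrow> A k \<in> DOb (twist_cat C T e)"
  then show "\<exists>S\<in>DOb (twist_cat C T e). \<exists>inc proj.
      (\<forall>k<r. inc k \<in> DHom (twist_cat C T e) (A k) S 0
        \<and> DDif (twist_cat C T e) (A k) S 0 (inc k) = 0) \<and>
      (\<forall>k<r. proj k \<in> DHom (twist_cat C T e) S (A k) 0
        \<and> DDif (twist_cat C T e) S (A k) 0 (proj k) = 0) \<and>
      (\<forall>k<r. \<forall>l<r. DCmp (twist_cat C T e) (A k) S (A l) 0 0 (proj l) (inc k)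
                       = (if k = l then DId (twist_cat C T e) (A k) else 0)) \<and>
      (\<Sum>k<r. DCmp (twist_cat C T e) S (A k) S 0 0 (inc k) (proj k)) = DId (twist_cat C T e) S"
    unfolding twist_cat_simps by (rule twist_direct_sums)
qed (simp_all add: T_sub cmp_closed cmp_add_left cmp_add_right cmp_assoc id_closed id_left id_right
    twist_dif_cmp)

end

section \<open>Substituting endomorphisms into the slots of an operation\<close>

lemma assoc_exp_identity:
  "assoc_exp I I (\<lambda>i\<in>I. i) n p = (\<Sum>i\<in>I. (\<Sum>l\<in>{l \<in> I. l < i}. p l) * n i)"
  by (auto simp: assoc_exp_def intro!: sum.cong)

lemma compose_identity_right: "\<pi> \<in> extensional J \<Longrightarrow> compose J \<pi> (\<lambda>j\<in>J. j) = \<pi>"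
  by (auto simp: compose_def extensional_def)

lemma compose_identity_left:
  "\<pi> \<in> extensional J \<Longrightarrow> (\<And>j. j \<in> J \<Longrightarrow> \<pi> j \<in> I) \<Longrightarrow> compose J (\<lambda>i\<in>I. i) \<pi> = \<pi>"
  by (auto simp: compose_def extensional_def)

abbreviation delta :: "nat \<Rightarrow> int \<Rightarrow> nat \<Rightarrow> int" where
  "delta i q \<equiv> \<lambda>a. if a = i then q else 0"

context pseudo_tensor_structure
begin

text \<open>Substitution of a single endomorphism is a substitution of a whole family, with identities in the
  other slots. Families compose slot by slot, which makes the sign rule easy to state.\<close>

definition slots :: "nat set \<Rightarrow> (nat \<Rightarrow> 'o) \<Rightarrow> (nat \<Rightarrow> int) \<Rightarrow> (nat \<Rightarrow> 'm) \<Rightarrow> nat \<Rightarrow> 'p" where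
  "slots I X d U = (\<lambda>a\<in>I. TOne P a (X a) (X a) (d a) (U a))"

definition substitute ::
  "nat set \<Rightarrow> (nat \<Rightarrow> 'o) \<Rightarrow> 'o \<Rightarrow> int \<Rightarrow> (nat \<Rightarrow> int) \<Rightarrow> 'p \<Rightarrow> (nat \<Rightarrow> 'm) \<Rightarrow> 'p" where
  "substitute I X B m d x U = TCmp P I I (\<lambda>a\<in>I. a) X X B m (restrict d I) x (slots I X d U)"

lemma slots_family:
  assumes "X \<in> I \<rightarrow>\<^sub>E DOb C" and "\<And>a. a \<in> I \<Longrightarrow> U a \<in> DHom C (X a) (X a) (d a)"
  shows "slots I X d U \<in> op_families P I I (\<lambda>a\<in>I. a) X X (restrict d I)"
proof (rule op_familiesI)
  fix i assume i: "i \<in> I"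
  have "restrict X {i} = (\<lambda>_\<in>{i}. X i)" by auto
  then show "slots I X d U i \<in> TOp P (fiber I (\<lambda>a\<in>I. a) i)
      (restrict X (fiber I (\<lambda>a\<in>I. a) i)) (X i) (restrict d I i)"
    using i assms one_closed[of "X i" "X i" "U i" "d i" i] by (auto simp: slots_def)
qed (simp add: slots_def)

lemma substitute_closed:
  assumes "index_set I" "X \<in> I \<rightarrow>\<^sub>E DOb C" "B \<in> DOb C" "x \<in> TOp P I X B m"
    and "\<And>a. a \<in> I \<Longrightarrow> U a \<in> DHom C (X a) (X a) (d a)"
  shows "substitute I X B m d x U \<in> TOp P I X B (m + (\<Sum>a\<in>I. d a))"
  using tcmp_closed[OF surjection_identity[OF assms(1)] assms(2,2,3) _ assms(4)
      slots_family[OF assms(2,5)]] by (simp add: substitute_def)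

text \<open>The sign comes from moving \<open>V l\<close> past \<open>U i\<close> for all \<open>l < i\<close>.\<close>

lemma substitute_substitute:
  assumes I: "index_set I" "X \<in> I \<rightarrow>\<^sub>E DOb C" "B \<in> DOb C" and x: "x \<in> TOp P I X B m"
    and U: "\<And>a. a \<in> I \<Longrightarrow> U a \<in> DHom C (X a) (X a) (d a)"
    and V: "\<And>a. a \<in> I \<Longrightarrow> V a \<in> DHom C (X a) (X a) (d' a)"
  shows "substitute I X B (m + (\<Sum>a\<in>I. d a)) d' (substitute I X B m d x U) V
    = ksign (\<Sum>i\<in>I. (\<Sum>l\<in>{l \<in> I. l < i}. d' l) * d i)
        (substitute I X B m (\<lambda>a. d a + d' a) x
          (\<lambda>a. DCmp C (X a) (X a) (X a) (d a) (d' a) (U a) (V a)))"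
proof -
  define c where "c = (\<lambda>a\<in>I. a)"
  have s: "surjection I I c" using surjection_identity[OF I(1)] by (simp add: c_def)
  have ce: "c \<in> extensional I" by (simp add: c_def)
  have cc: "compose I c c = c" unfolding c_def by (rule compose_identity_right) auto
  note a = tcmp_assoc[OF s s I(2,2,2,3) _ _ x, where n = "restrict d I" and p = "restrict d' I"
      and g = "slots I X d U" and h = "slots I X d' V", unfolded cc]
  have fc: "fiber I c i = {i}" if "i \<in> I" for i using that by (simp add: c_def)
  have inner: "(\<lambda>i\<in>I. let Ji = fiber I c i; Ki = fiber I c i
      in TCmp P Ki Ji (restrict c Ki) (restrict X Ki) (restrict X Ji) (X i)
        (restrict d I i) (restrict (restrict d' I) Ji) (slots I X d U i)
        (restrict (slots I X d' V) Ji))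
    = slots I X (\<lambda>a. d a + d' a) (\<lambda>a. DCmp C (X a) (X a) (X a) (d a) (d' a) (U a) (V a))"
  proof (intro ext)
    fix i
    show "(\<lambda>i\<in>I. let Ji = fiber I c i; Ki = fiber I c i
      in TCmp P Ki Ji (restrict c Ki) (restrict X Ki) (restrict X Ji) (X i)
        (restrict d I i) (restrict (restrict d' I) Ji) (slots I X d U i)
        (restrict (slots I X d' V) Ji)) i
    = slots I X (\<lambda>a. d a + d' a) (\<lambda>a. DCmp C (X a) (X a) (X a) (d a) (d' a) (U a) (V a)) i"
    proof (cases "i \<in> I")
      case i: True
      have r: "restrict c {i} = (\<lambda>_\<in>{i}. i)" "restrict X {i} = (\<lambda>_\<in>{i}. X i)"
        "restrict d' {i} = (\<lambda>_\<in>{i}. d' i)"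
        "restrict (slots I X d' V) {i} = (\<lambda>_\<in>{i}. TOne P i (X i) (X i) (d' i) (V i))"
        using i by (auto simp: c_def slots_def)
      have "X i \<in> DOb C" using i I by auto
      then show ?thesis
        using i one_cmp[of "X i" "X i" "X i" "U i" "d i" "V i" "d' i" i i] I U V
        by (auto simp: fc[OF i] r Let_def) (auto simp: slots_def)
    qed (simp add: slots_def)
  qed
  have deg: "(\<lambda>i\<in>I. restrict d I i + (\<Sum>j\<in>fiber I c i. restrict d' I j))
      = restrict (\<lambda>a. d a + d' a) I"
    by (auto simp: fc)
  have ae: "assoc_exp I I c (restrict d I) (restrict d' I)
      = (\<Sum>i\<in>I. (\<Sum>l\<in>{l \<in> I. l < i}. d' l) * d i)"
    unfolding c_def assoc_exp_identity by (intro sum.cong refl) auto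
  show ?thesis
    using a slots_family[OF I(2) U] slots_family[OF I(2) V]
    unfolding inner deg ae by (simp add: substitute_def c_def)
qed

lemma pre_hom_substitute:
  "pre_hom C P I i (X i) X B m q x u
    = substitute I X B m (delta i q) x (\<lambda>a. if a = i then u else DId C (X a))"
proof -
  have "(\<lambda>a\<in>I. if a = i then TOne P i (X i) (X i) q u else TOne P a (X a) (X a) 0 (DId C (X a)))
      = slots I X (delta i q) (\<lambda>a. if a = i then u else DId C (X a))"
    unfolding slots_def by (rule restrict_ext) auto
  then show ?thesis by (simp add: pre_hom_def substitute_def)
qed

lemma unit_slots:
  assumes "X \<in> I \<rightarrow>\<^sub>E DOb C" "u \<in> DHom C (X i) (X i) q" "a \<in> I"
  shows "(if a = i then u else DId C (X a)) \<in> DHom C (X a) (X a) (delta i q a)"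
  using assms by (auto intro!: id_closed)

lemma pre_hom_closed:
  assumes "index_set I" "X \<in> I \<rightarrow>\<^sub>E DOb C" "B \<in> DOb C" "x \<in> TOp P I X B m"
    and "i \<in> I" "u \<in> DHom C (X i) (X i) q"
  shows "pre_hom C P I i (X i) X B m q x u \<in> TOp P I X B (m + q)"
  using assms substitute_closed[OF assms(1-4) unit_slots[OF assms(2,6)]]
  by (simp add: pre_hom_substitute index_set_def)

lemma pre_hom_additive_left:
  assumes "index_set I" "X \<in> I \<rightarrow>\<^sub>E DOb C" "B \<in> DOb C" "i \<in> I" "u \<in> DHom C (X i) (X i) q"
  shows "additive_on (TOp P I X B m) (\<lambda>x. pre_hom C P I i (X i) X B m q x u)"
  unfolding pre_hom_substitute substitute_def
  by (rule tcmp_additive_left[OF surjection_identity[OF assms(1)] assms(2,2,3) _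
        slots_family[OF assms(2) unit_slots[OF assms(2,5)]]]) simp

lemma pre_hom_additive_right:
  assumes I: "index_set I" "X \<in> I \<rightarrow>\<^sub>E DOb C" "B \<in> DOb C" "x \<in> TOp P I X B m" "i \<in> I"
  shows "additive_on (DHom C (X i) (X i) q) (pre_hom C P I i (X i) X B m q x)"
  unfolding additive_on_def
proof (intro conjI ballI hom_subgroup)
  show "X i \<in> DOb C" "X i \<in> DOb C" using I by auto
  then have Xi: "X i \<in> DOb C" by simp
  fix u v assume u: "u \<in> DHom C (X i) (X i) q" and v: "v \<in> DHom C (X i) (X i) q"
  define G where "G w = slots I X (delta i q) (\<lambda>a. if a = i then w else DId C (X a))" for w
  have Gu: "G w = (G u)(i := TOne P i (X i) (X i) q w)" for w
    using I(5) by (auto simp: G_def slots_def fun_eq_iff)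
  have r: "restrict X {i} = (\<lambda>_\<in>{i}. X i)" by auto
  have "G u \<in> op_families P I I (\<lambda>a\<in>I. a) X X (restrict (delta i q) I)"
    unfolding G_def by (rule slots_family[OF I(2) unit_slots[OF I(2) u]])
  from additive_on_add[OF tcmp_additive_slot[OF surjection_identity[OF I(1)] I(2,2,3) _ I(4) this I(5)],
      of "TOne P i (X i) (X i) q u" "TOne P i (X i) (X i) q v"]
  have "TCmp P I I (\<lambda>a\<in>I. a) X X B m (restrict (delta i q) I) x (G (u + v))
    = TCmp P I I (\<lambda>a\<in>I. a) X X B m (restrict (delta i q) I) x (G u)
    + TCmp P I I (\<lambda>a\<in>I. a) X X B m (restrict (delta i q) I) x (G v)"
    using one_closed[OF Xi Xi u, of i] one_closed[OF Xi Xi v, of i] I(5)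
    unfolding Gu[of "u + v"] Gu[of v] one_add[OF Xi Xi u v]
    by (simp add: r) (metis Gu)
  then show "pre_hom C P I i (X i) X B m q x (u + v)
    = pre_hom C P I i (X i) X B m q x u + pre_hom C P I i (X i) X B m q x v"
    by (simp add: pre_hom_substitute substitute_def G_def)
qed

lemma pre_hom_dif:
  assumes I: "index_set I" "X \<in> I \<rightarrow>\<^sub>E DOb C" "B \<in> DOb C" and x: "x \<in> TOp P I X B m"
    and i: "i \<in> I" and u: "u \<in> DHom C (X i) (X i) q"
  shows "TDif P I X B (m + q) (pre_hom C P I i (X i) X B m q x u)
    = pre_hom C P I i (X i) X B (m + 1) q (TDif P I X B m x) u
      + ksign m (pre_hom C P I i (X i) X B m (q + 1) x (DDif C (X i) (X i) q u))"
proof -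
  have fI: "finite I" using I by (simp add: index_set_def)
  have XO: "X a \<in> DOb C" if "a \<in> I" for a using I that by auto
  define G where "G = slots I X (delta i q) (\<lambda>a. if a = i then u else DId C (X a))"
  define n where "n = restrict (delta i q) I"
  have G: "G \<in> op_families P I I (\<lambda>a\<in>I. a) X X n"
    unfolding G_def n_def by (rule slots_family[OF I(2) unit_slots[OF I(2) u]])
  have r: "restrict X {a} = (\<lambda>_\<in>{a}. X a)" for a by auto
  have dG: "TDif P {a} (\<lambda>_\<in>{a}. X a) (X a) (n a) (G a)
      = (if a = i then TOne P i (X i) (X i) (q + 1) (DDif C (X i) (X i) q u) else 0)"
    if "a \<in> I" for a
    using one_dif[OF XO[OF that] XO[OF that] id_closed[OF XO[OF that]], of a]
      one_dif[OF XO[OF i] XO[OF i] u, of i] that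
      additive_on_zero[OF one_additive[OF XO[OF that] XO[OF that]], of a 1]
    by (auto simp: G_def n_def slots_def id_dif XO)
  have others: "TCmp P I I (\<lambda>a\<in>I. a) X X B m (n(a := n a + 1)) x (G(a := 0)) = 0"
    if "a \<in> I" for a
    using that subgroup_zero[OF fiber_op_subgroup[OF surjection_identity[OF I(1)] I(2,2) that]] i
    by (intro tcmp_zero_slot[where i = a] surjection_identity I x op_families_upd[OF G])
      (auto simp: n_def extensional_def)
  have Gi: "G(i := TOne P i (X i) (X i) (q + 1) (DDif C (X i) (X i) q u))
      = slots I X (delta i (q + 1)) (\<lambda>a. if a = i then DDif C (X i) (X i) q u else DId C (X a))"
    using i by (auto simp: G_def slots_def fun_eq_iff)
  have ni: "n(i := n i + 1) = restrict (delta i (q + 1)) I"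
    using i by (auto simp: n_def fun_eq_iff)
  have sg: "(\<Sum>a\<in>{a \<in> I. a < i}. n a) = 0" by (intro sum.neutral) (auto simp: n_def)
  have sn: "(\<Sum>a\<in>I. n a) = q" using i fI by (simp add: n_def)
  have "TDif P I X B (m + (\<Sum>a\<in>I. n a)) (TCmp P I I (\<lambda>a\<in>I. a) X X B m n x G)
      = TCmp P I I (\<lambda>a\<in>I. a) X X B (m + 1) n (TDif P I X B m x) G
       + (\<Sum>k\<in>I. ksign (m + (\<Sum>a\<in>{a \<in> I. a < k}. n a))
          (TCmp P I I (\<lambda>a\<in>I. a) X X B m (n(k := n k + 1)) x
            (G(k := TDif P (fiber I (\<lambda>a\<in>I. a) k) (restrict X (fiber I (\<lambda>a\<in>I. a) k)) (X k) (n k) (G k)))))"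
    by (rule tcmp_dif[OF surjection_identity[OF I(1)] I(2,2,3) _ x G]) (simp add: n_def)
  also have "(\<Sum>k\<in>I. ksign (m + (\<Sum>a\<in>{a \<in> I. a < k}. n a))
          (TCmp P I I (\<lambda>a\<in>I. a) X X B m (n(k := n k + 1)) x
            (G(k := TDif P (fiber I (\<lambda>a\<in>I. a) k) (restrict X (fiber I (\<lambda>a\<in>I. a) k)) (X k) (n k) (G k)))))
    = (\<Sum>k\<in>I. if k = i then ksign m (TCmp P I I (\<lambda>a\<in>I. a) X X B m (n(i := n i + 1)) x
          (G(i := TOne P i (X i) (X i) (q + 1) (DDif C (X i) (X i) q u)))) else 0)"
    by (intro sum.cong refl) (auto simp: r dG others sg)
  finally show ?thesis
    using i fI unfolding sn Gi ni unfolding pre_hom_substitute substitute_def G_def n_def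
    by (simp del: restrict_apply)
qed

lemma pre_hom_cmp:
  assumes I: "index_set I" "X \<in> I \<rightarrow>\<^sub>E DOb C" "B \<in> DOb C" and x: "x \<in> TOp P I X B m"
    and i: "i \<in> I" and u: "u \<in> DHom C (X i) (X i) q" and v: "v \<in> DHom C (X i) (X i) q'"
  shows "pre_hom C P I i (X i) X B (m + q) q' (pre_hom C P I i (X i) X B m q x u) v
    = pre_hom C P I i (X i) X B m (q + q') x (DCmp C (X i) (X i) (X i) q q' u v)"
proof -
  have fI: "finite I" using I by (simp add: index_set_def)
  let ?U = "\<lambda>w a. if a = i then w else DId C (X a)"
  have sgn: "(\<Sum>k\<in>I. (\<Sum>l\<in>{l \<in> I. l < k}. delta i q' l) * delta i q k) = 0"
    by (intro sum.neutral) (auto intro!: sum.neutral)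
  have sum: "(\<Sum>a\<in>I. delta i q a) = q" using i fI by simp
  have "substitute I X B (m + (\<Sum>a\<in>I. delta i q a)) (delta i q')
      (substitute I X B m (delta i q) x (?U u)) (?U v)
    = ksign (\<Sum>k\<in>I. (\<Sum>l\<in>{l \<in> I. l < k}. delta i q' l) * delta i q k)
        (substitute I X B m (\<lambda>a. delta i q a + delta i q' a) x
          (\<lambda>a. DCmp C (X a) (X a) (X a) (delta i q a) (delta i q' a) (?U u a) (?U v a)))"
    by (intro substitute_substitute I x unit_slots[OF I(2)] u v)
  also have "substitute I X B m (\<lambda>a. delta i q a + delta i q' a) x
          (\<lambda>a. DCmp C (X a) (X a) (X a) (delta i q a) (delta i q' a) (?U u a) (?U v a))
      = substitute I X B m (delta i (q + q')) x (?U (DCmp C (X i) (X i) (X i) q q' u v))"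
  proof -
    have "slots I X (\<lambda>a. delta i q a + delta i q' a)
          (\<lambda>a. DCmp C (X a) (X a) (X a) (delta i q a) (delta i q' a) (?U u a) (?U v a))
        = slots I X (delta i (q + q')) (?U (DCmp C (X i) (X i) (X i) q q' u v))"
      unfolding slots_def using I(2) by (intro restrict_ext) (auto simp: id_left id_closed PiE_iff)
    moreover have "(\<lambda>a. delta i q a + delta i q' a) = delta i (q + q')" by auto
    ultimately show ?thesis by (simp add: substitute_def)
  qed
  finally show ?thesis unfolding sum sgn by (simp add: pre_hom_substitute)
qed

text \<open>Only in one of the two orders does a morphism move past the other one.\<close>

lemma pre_hom_swap:
  assumes I: "index_set I" "X \<in> I \<rightarrow>\<^sub>E DOb C" "B \<in> DOb C" and x: "x \<in> TOp P I X B m"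
    and ij: "i \<in> I" "j \<in> I" "i < j"
    and u: "u \<in> DHom C (X i) (X i) 1" and v: "v \<in> DHom C (X j) (X j) 1"
  shows "pre_hom C P I i (X i) X B (m + 1) 1 (pre_hom C P I j (X j) X B m 1 x v) u
    = - pre_hom C P I j (X j) X B (m + 1) 1 (pre_hom C P I i (X i) X B m 1 x u) v"
proof -
  have fI: "finite I" using I by (simp add: index_set_def)
  let ?U = "\<lambda>i w a. if a = i then w else DId C (X a)"
  let ?W = "\<lambda>a. if a = i then u else if a = j then v else DId C (X a)"
  let ?d = "\<lambda>a. if a = i then 1 else if a = j then 1 else 0 :: int"
  have sum: "(\<Sum>a\<in>I. delta k 1 a) = 1" if "k \<in> I" for k using that fI by simp
  have sgn1: "(\<Sum>k\<in>I. (\<Sum>l\<in>{l \<in> I. l < k}. delta i 1 l) * delta j 1 k) = 1"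
  proof -
    have "(\<Sum>k\<in>I. (\<Sum>l\<in>{l \<in> I. l < k}. delta i 1 l) * delta j 1 k)
        = (\<Sum>k\<in>I. if k = j then (\<Sum>l\<in>{l \<in> I. l < j}. delta i 1 l) else 0)"
      by (intro sum.cong) auto
    then show ?thesis using ij fI by simp
  qed
  have sgn2: "(\<Sum>k\<in>I. (\<Sum>l\<in>{l \<in> I. l < k}. delta j 1 l) * delta i 1 k) = 0"
    using ij by (intro sum.neutral) (auto intro!: sum.neutral)
  have XO: "X a \<in> DOb C" if "a \<in> I" for a using I that by auto
  have W: "substitute I X B m (\<lambda>a. delta k 1 a + delta l 1 a) x
          (\<lambda>a. DCmp C (X a) (X a) (X a) (delta k 1 a) (delta l 1 a) (?U k s a) (?U l t a))
      = substitute I X B m ?d x ?W"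
    if "k = i \<and> s = u \<and> l = j \<and> t = v \<or> k = j \<and> s = v \<and> l = i \<and> t = u" for k l s t
  proof -
    have "slots I X (\<lambda>a. delta k 1 a + delta l 1 a)
          (\<lambda>a. DCmp C (X a) (X a) (X a) (delta k 1 a) (delta l 1 a) (?U k s a) (?U l t a))
        = slots I X ?d ?W"
      unfolding slots_def using ij that u v
      by (intro restrict_ext) (auto simp: id_left id_right id_closed XO)
    moreover have "(\<lambda>a. delta k 1 a + delta l 1 a) = ?d" using that ij by auto
    ultimately show ?thesis by (simp add: substitute_def)
  qed
  have 1: "pre_hom C P I i (X i) X B (m + 1) 1 (pre_hom C P I j (X j) X B m 1 x v) u
      = - substitute I X B m ?d x ?W"
    using substitute_substitute[OF I x unit_slots[OF I(2) v] unit_slots[OF I(2) u]]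
    unfolding sum[OF ij(2)] sgn1 W[of j v i u, simplified] by (simp add: pre_hom_substitute)
  have 2: "pre_hom C P I j (X j) X B (m + 1) 1 (pre_hom C P I i (X i) X B m 1 x u) v
      = substitute I X B m ?d x ?W"
    using substitute_substitute[OF I x unit_slots[OF I(2) u] unit_slots[OF I(2) v]]
    unfolding sum[OF ij(1)] sgn2 W[of i u j v, simplified] by (simp add: pre_hom_substitute)
  show ?thesis unfolding 1 2 ..
qed

lemma post_hom_pre_hom:
  assumes I: "index_set I" "X \<in> I \<rightarrow>\<^sub>E DOb C" and B: "B \<in> DOb C" "B' \<in> DOb C"
    and x: "x \<in> TOp P I X B m"
    and i: "i \<in> I" and u: "u \<in> DHom C (X i) (X i) q" and w: "w \<in> DHom C B B' r"
  shows "post_hom P I X B B' r (m + q) w (pre_hom C P I i (X i) X B m q x u)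
    = pre_hom C P I i (X i) X B' (r + m) q (post_hom P I X B B' r m w x) u"
proof -
  have "(\<Sum>a\<in>I. restrict (delta i q) I a) = q" using i I by (simp add: index_set_def)
  then show ?thesis
    using post_hom_tcmp[OF surjection_identity[OF I(1)] I(2,2) B _ x
        slots_family[OF I(2) unit_slots[OF I(2) u]] w]
    by (simp add: pre_hom_substitute substitute_def)
qed

text \<open>A degree \<open>1\<close> endomorphism that sits in slot \<open>i\<close> of \<open>f\<close> can be absorbed into \<open>g i\<close>; it has to
  move past the operations \<open>g l\<close> with \<open>l < i\<close>.\<close>

lemma tcmp_of_pre_hom:
  assumes s: "surjection J I \<pi>" and X: "X \<in> J \<rightarrow>\<^sub>E DOb C" and Y: "Y \<in> I \<rightarrow>\<^sub>E DOb C"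
    and Z: "Z \<in> DOb C"
    and n: "n \<in> extensional I" and f: "f \<in> TOp P I Y Z m" and g: "g \<in> op_families P J I \<pi> X Y n"
    and i: "i \<in> I" and u: "u \<in> DHom C (Y i) (Y i) 1"
  shows "TCmp P J I \<pi> X Y Z (m + 1) n (pre_hom C P I i (Y i) Y Z m 1 f u) g
    = ksign (\<Sum>l\<in>{l \<in> I. l < i}. n l)
        (TCmp P J I \<pi> X Y Z m (n(i := n i + 1)) f
          (g(i := post_hom P (fiber J \<pi> i) (restrict X (fiber J \<pi> i)) (Y i) (Y i) 1 (n i) u (g i))))"
proof -
  note sD = surjectionD[OF s]
  have gx: "g \<in> extensional I" using g by (simp add: op_families_iff)
  define c where "c = (\<lambda>i\<in>I. i)"
  have sc: "surjection I I c" using surjection_identity[OF sD(2)] by (simp add: c_def)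
  have cc: "compose J c \<pi> = \<pi>" unfolding c_def by (rule compose_identity_left) (use sD in auto)
  have fc: "fiber I c k = {k}" if "k \<in> I" for k using that by (simp add: c_def)
  let ?d = "restrict (delta i 1) I" and ?U = "\<lambda>a. if a = i then u else DId C (Y a)"
  let ?S = "slots I Y (delta i 1) ?U"
  let ?g = "g(i := post_hom P (fiber J \<pi> i) (restrict X (fiber J \<pi> i)) (Y i) (Y i) 1 (n i) u (g i))"
  have S: "?S \<in> op_families P I I c Y Y ?d"
    unfolding c_def by (rule slots_family[OF Y unit_slots[OF Y u]])
  note a = tcmp_assoc[OF s sc X Y Y Z _ n f S g, unfolded cc]
  have inner: "(\<lambda>k\<in>I. let Ji = fiber I c k; Ki = fiber J \<pi> k
      in TCmp P Ki Ji (restrict \<pi> Ki) (restrict X Ki) (restrict Y Ji) (Y k)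
        (?d k) (restrict n Ji) (?S k) (restrict g Ji)) = ?g"
  proof (intro ext)
    fix k
    show "(\<lambda>k\<in>I. let Ji = fiber I c k; Ki = fiber J \<pi> k
      in TCmp P Ki Ji (restrict \<pi> Ki) (restrict X Ki) (restrict Y Ji) (Y k)
        (?d k) (restrict n Ji) (?S k) (restrict g Ji)) k = ?g k"
    proof (cases "k \<in> I")
      case k: True
      have r: "restrict \<pi> (fiber J \<pi> k) = (\<lambda>_\<in>fiber J \<pi> k. k)" "restrict Y {k} = (\<lambda>_\<in>{k}. Y k)"
        "restrict n {k} = (\<lambda>_\<in>{k}. n k)" "restrict g {k} = (\<lambda>_\<in>{k}. g k)"
        by (auto simp: fiber_def)
      have gk: "g k \<in> TOp P (fiber J \<pi> k) (restrict X (fiber J \<pi> k)) (Y k) (n k)"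
        using g k by (simp add: op_families_iff)
      have Yk: "Y k \<in> DOb C" using Y k by auto
      show ?thesis
        using k post_hom_index[OF surjection_fiber[OF s k] fiber_objects[OF s X k] Yk Yk _ gk, of _ _ k]
          tcmp_id_left[OF surjection_fiber[OF s k] fiber_objects[OF s X k] Yk gk, of k] u
        by (auto simp: fc[OF k] r slots_def Let_def)
    next
      case False
      then show ?thesis using i gx by (auto simp: extensional_def)
    qed
  qed
  have deg: "(\<lambda>k\<in>I. ?d k + (\<Sum>j\<in>fiber I c k. n j)) = n(i := n i + 1)"
    using i n by (auto simp: fun_eq_iff fc extensional_def)
  have ae: "assoc_exp I I c ?d n = (\<Sum>l\<in>{l \<in> I. l < i}. n l)"
  proof -
    have "assoc_exp I I c ?d n = (\<Sum>k\<in>I. if k = i then (\<Sum>l\<in>{l \<in> I. l < i}. n l) else 0)"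
      unfolding c_def assoc_exp_identity by (intro sum.cong) auto
    then show ?thesis using i sD by simp
  qed
  have "(\<Sum>k\<in>I. ?d k) = 1" using i sD by simp
  then show ?thesis
    using a unfolding inner deg ae by (simp add: pre_hom_substitute substitute_def c_def)
qed

text \<open>A degree \<open>1\<close> endomorphism substituted into slot \<open>j\<close> of a composite can be absorbed into the
  inner operation containing that slot; it has to move past the inner operations behind it.\<close>

lemma pre_hom_of_tcmp:
  assumes s: "surjection J I \<pi>" and X: "X \<in> J \<rightarrow>\<^sub>E DOb C" and Y: "Y \<in> I \<rightarrow>\<^sub>E DOb C"
    and Z: "Z \<in> DOb C"
    and n: "n \<in> extensional I" and f: "f \<in> TOp P I Y Z m" and g: "g \<in> op_families P J I \<pi> X Y n"
    and j: "j \<in> J" and i: "\<pi> j = i" and u: "u \<in> DHom C (X j) (X j) 1"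
  shows "pre_hom C P J j (X j) X Z (m + (\<Sum>i\<in>I. n i)) 1 (TCmp P J I \<pi> X Y Z m n f g) u
    = ksign (\<Sum>l\<in>{l \<in> I. i < l}. n l)
        (TCmp P J I \<pi> X Y Z m (n(i := n i + 1)) f
          (g(i := pre_hom C P (fiber J \<pi> i) j (X j) (restrict X (fiber J \<pi> i)) (Y i) (n i) 1 (g i) u)))"
proof -
  note sD = surjectionD[OF s]
  have gx: "g \<in> extensional I" using g by (simp add: op_families_iff)
  have iI: "i \<in> I" using sD(7)[OF j] i by simp
  have ji: "j \<in> fiber J \<pi> i" using j i by (simp add: fiber_def)
  define c where "c = (\<lambda>j\<in>J. j)"
  have sc: "surjection J J c" using surjection_identity[OF sD(1)] by (simp add: c_def)
  have cc: "compose J \<pi> c = \<pi>" unfolding c_def by (rule compose_identity_right) (use sD in auto)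
  let ?d = "restrict (delta j 1) J" and ?U = "\<lambda>a. if a = j then u else DId C (X a)"
  let ?S = "slots J X (delta j 1) ?U"
  let ?g = "g(i := pre_hom C P (fiber J \<pi> i) j (X j) (restrict X (fiber J \<pi> i)) (Y i) (n i) 1 (g i) u)"
  have S: "?S \<in> op_families P J J c X X ?d"
    unfolding c_def by (rule slots_family[OF X unit_slots[OF X u]])
  note a = tcmp_assoc[OF sc s X X Y Z n _ f g S, unfolded cc]
  have inner: "(\<lambda>k\<in>I. let Ji = fiber J \<pi> k; Ki = fiber J \<pi> k
      in TCmp P Ki Ji (restrict c Ki) (restrict X Ki) (restrict X Ji) (Y k)
        (n k) (restrict ?d Ji) (g k) (restrict ?S Ji)) = ?g"
  proof (intro ext)
    fix k
    show "(\<lambda>k\<in>I. let Ji = fiber J \<pi> k; Ki = fiber J \<pi> k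
      in TCmp P Ki Ji (restrict c Ki) (restrict X Ki) (restrict X Ji) (Y k)
        (n k) (restrict ?d Ji) (g k) (restrict ?S Ji)) k = ?g k"
    proof (cases "k \<in> I")
      case k: True
      let ?F = "fiber J \<pi> k"
      let ?V = "\<lambda>a. if a = j then u else DId C (restrict X ?F a)"
      have r: "restrict c ?F = (\<lambda>j\<in>?F. j)" "restrict ?d ?F = restrict (delta j 1) ?F"
        "restrict ?S ?F = slots ?F (restrict X ?F) (delta j 1) ?V"
        using fiber_subset[of J \<pi> k] by (auto simp: c_def slots_def fun_eq_iff)
      have gk: "g k \<in> TOp P ?F (restrict X ?F) (Y k) (n k)"
        using g k by (simp add: op_families_iff)
      have Yk: "Y k \<in> DOb C" using Y k by auto
      show ?thesis
      proof (cases "k = i")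
        case True
        then show ?thesis
          using k ji pre_hom_substitute[of "fiber J \<pi> i" j "restrict X (fiber J \<pi> i)" "Y i" "n i" 1 "g i" u]
          by (simp add: r[unfolded True] True substitute_def Let_def Int_absorb1[OF fiber_subset])
      next
        case False
        then have nj: "j \<notin> ?F" using i by (auto simp: fiber_def)
        have "restrict (delta j 1) ?F = (\<lambda>_\<in>?F. 0)"
          "slots ?F (restrict X ?F) (delta j 1) ?V
            = (\<lambda>i\<in>?F. TOne P i (restrict X ?F i) (restrict X ?F i) 0 (DId C (restrict X ?F i)))"
          using nj by (auto simp: slots_def fun_eq_iff)
        then show ?thesis
          using False k tcmp_id_right[OF surjection_fiber[OF s k] fiber_objects[OF s X k] Yk gk]
          by (simp add: r Let_def Int_absorb1[OF fiber_subset])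
      qed
    next
      case False
      then show ?thesis using iI gx by (auto simp: extensional_def)
    qed
  qed
  have fd: "(\<Sum>j\<in>fiber J \<pi> k. ?d j) = (if k = i then 1 else 0)" if "k \<in> I" for k
  proof -
    have "(\<Sum>j\<in>fiber J \<pi> k. ?d j) = (\<Sum>j'\<in>fiber J \<pi> k. delta j 1 j')"
      by (intro sum.cong) (auto simp: fiber_def)
    then show ?thesis using i j finite_subset[OF fiber_subset sD(3)] by (auto simp: fiber_def)
  qed
  have deg: "(\<lambda>k\<in>I. n k + (\<Sum>j\<in>fiber J \<pi> k. ?d j)) = n(i := n i + 1)"
  proof -
    have "(\<lambda>k\<in>I. n k + (\<Sum>j\<in>fiber J \<pi> k. ?d j)) = (\<lambda>k\<in>I. n k + (if k = i then 1 else 0))"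
      by (rule restrict_ext) (simp only: fd)
    also have "\<dots> = n(i := n i + 1)" using iI n by (auto simp: fun_eq_iff extensional_def)
    finally show ?thesis .
  qed
  have ae: "assoc_exp J I \<pi> n ?d = (\<Sum>l\<in>{l \<in> I. i < l}. n l)"
  proof -
    have "shuffle_exp J \<pi> ?d = 0"
      unfolding shuffle_exp_def by (intro sum.neutral) auto
    moreover have "(\<Sum>l\<in>{l \<in> I. l < k}. \<Sum>j\<in>fiber J \<pi> l. ?d j) = (if i < k then 1 else 0)"
      if "k \<in> I" for k
    proof -
      have "(\<Sum>l\<in>{l \<in> I. l < k}. \<Sum>j\<in>fiber J \<pi> l. ?d j) = (\<Sum>l\<in>{l \<in> I. l < k}. delta i 1 l)"
        by (intro sum.cong) (auto simp: fd simp del: restrict_apply)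
      then show ?thesis using iI sD by simp
    qed
    ultimately have "assoc_exp J I \<pi> n ?d = (\<Sum>k\<in>I. if i < k then n k else 0)"
      unfolding assoc_exp_def by (auto intro!: sum.cong)
    then show ?thesis using sD by (simp add: sum.If_cases Int_def)
  qed
  show ?thesis
    using a unfolding inner deg ae by (simp add: pre_hom_substitute substitute_def c_def)
qed

end

section \<open>Twisting a pseudo-tensor structure\<close>

definition twist_tdif ::
    "('o, 'm) dg_cat \<Rightarrow> ('o, 'm, 'p::ab_group_add) pseudo_tensor \<Rightarrow> ('o \<Rightarrow> 'm) \<Rightarrow>
     nat set \<Rightarrow> (nat \<Rightarrow> 'o) \<Rightarrow> 'o \<Rightarrow> int \<Rightarrow> 'p \<Rightarrow> 'p" where
  "twist_tdif C P e I X B n x = TDif P I X B n x + post_hom P I X B B 1 n (e B) x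
     - ksign n (\<Sum>i\<in>I. pre_hom C P I i (X i) X B n 1 x (e (X i)))"

definition twist_tensor ::
    "('o, 'm) dg_cat \<Rightarrow> ('o, 'm, 'p::ab_group_add) pseudo_tensor \<Rightarrow> ('o \<Rightarrow> 'm) \<Rightarrow>
     ('o, 'm, 'p) pseudo_tensor" where
  "twist_tensor C P e = P\<lparr>TDif := twist_tdif C P e\<rparr>"

lemma twist_tensor_simps [simp]:
  "TOp (twist_tensor C P e) = TOp P" "TDif (twist_tensor C P e) = twist_tdif C P e"
  "TCmp (twist_tensor C P e) = TCmp P" "TOne (twist_tensor C P e) = TOne P"
  "op_families (twist_tensor C P e) = op_families P"
  by (simp_all add: twist_tensor_def op_families_def fun_eq_iff)

lemma sum_additive_on:
  "(\<And>i. i \<in> I \<Longrightarrow> additive_on A (f i)) \<Longrightarrow> additive_subgroup A \<Longrightarrow> additive_on A (\<lambda>x. \<Sum>i\<in>I. f i x)"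
  by (auto simp: additive_on_def simp flip: sum.distrib intro!: sum.cong)

locale mc_tensor = mc_family C T e + pseudo_tensor_structure C P
  for C :: "('o, 'm::ab_group_add) dg_cat" and T e
    and P :: "('o, 'm, 'p::ab_group_add) pseudo_tensor"
begin

lemma T_family: "X \<in> I \<rightarrow>\<^sub>E T \<Longrightarrow> X \<in> I \<rightarrow>\<^sub>E DOb C"
  using T_sub by (auto simp: PiE_iff)

definition pre_all :: "nat set \<Rightarrow> (nat \<Rightarrow> 'o) \<Rightarrow> 'o \<Rightarrow> int \<Rightarrow> 'p \<Rightarrow> 'p" where
  "pre_all I X B n x = (\<Sum>i\<in>I. pre_hom C P I i (X i) X B n 1 x (e (X i)))"

lemma twist_tdif_eq:
  "twist_tdif C P e I X B n x = TDif P I X B n x + post_hom P I X B B 1 n (e B) x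
     - ksign n (pre_all I X B n x)"
  by (simp add: twist_tdif_def pre_all_def)

context
  fixes I X B
  assumes I: "index_set I" and X: "X \<in> I \<rightarrow>\<^sub>E T" and B: "B \<in> T"
begin

private lemma O: "X \<in> I \<rightarrow>\<^sub>E DOb C" "B \<in> DOb C"
  using X B by (auto simp: T_sub T_family)

private lemma eX: "i \<in> I \<Longrightarrow> e (X i) \<in> DHom C (X i) (X i) 1"
  using X by (auto intro: e_closed)

lemma pre_all_additive: "additive_on (TOp P I X B n) (pre_all I X B n)"
  unfolding pre_all_def using O I eX
  by (intro sum_additive_on pre_hom_additive_left op_subgroup) auto

lemma twist_tdif_terms:
  assumes "x \<in> TOp P I X B n"
  shows "TDif P I X B n x \<in> TOp P I X B (n + 1)"
    "post_hom P I X B B 1 n (e B) x \<in> TOp P I X B (n + 1)"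
    "pre_all I X B n x \<in> TOp P I X B (n + 1)"
proof -
  show "TDif P I X B n x \<in> TOp P I X B (n + 1)" using I O assms by (intro tdif_closed)
  show "post_hom P I X B B 1 n (e B) x \<in> TOp P I X B (n + 1)"
    using post_hom_closed[OF I O O(2) e_closed[OF B] assms] by (simp add: add.commute)
  show "pre_all I X B n x \<in> TOp P I X B (n + 1)"
    unfolding pre_all_def using I O assms eX
    by (intro subgroup_sum op_subgroup pre_hom_closed) auto
qed

lemma twist_tdif_closed:
  "x \<in> TOp P I X B n \<Longrightarrow> twist_tdif C P e I X B n x \<in> TOp P I X B (n + 1)"
  unfolding twist_tdif_eq using twist_tdif_terms I O
  by (intro subgroup_diff subgroup_add subgroup_ksign op_subgroup) auto

lemma twist_tdif_add:
  assumes x: "x \<in> TOp P I X B n" and y: "y \<in> TOp P I X B n"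
  shows "twist_tdif C P e I X B n (x + y) = twist_tdif C P e I X B n x + twist_tdif C P e I X B n y"
  unfolding twist_tdif_eq
  using additive_on_add[OF tdif_additive[OF I O] x y]
    additive_on_add[OF post_hom_additive_right[OF I O O(2) e_closed[OF B]] x y]
    additive_on_add[OF pre_all_additive x y]
  by (simp add: ksign_add)

text \<open>The cross terms cancel in pairs by \<open>pre_hom_swap\<close>.\<close>

lemma pre_all_square:
  assumes x: "x \<in> TOp P I X B n"
  shows "pre_all I X B (n + 1) (pre_all I X B n x)
    = (\<Sum>i\<in>I. pre_hom C P I i (X i) X B n 2 x (DCmp C (X i) (X i) (X i) 1 1 (e (X i)) (e (X i))))"
proof -
  let ?p = "\<lambda>i n x. pre_hom C P I i (X i) X B n 1 x (e (X i))"
  have fI: "finite I" using I by (simp add: index_set_def)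
  have "pre_all I X B (n + 1) (pre_all I X B n x) = (\<Sum>i\<in>I. \<Sum>j\<in>I. ?p i (n + 1) (?p j n x))"
    unfolding pre_all_def using I O eX x pre_hom_closed[OF I O x]
    by (intro sum.cong refl additive_on_sum[OF pre_hom_additive_left]) auto
  also have "\<dots> = (\<Sum>i\<in>I. ?p i (n + 1) (?p i n x))
      + (\<Sum>i\<in>I. \<Sum>j\<in>I. if i < j then ?p i (n + 1) (?p j n x) + ?p j (n + 1) (?p i n x) else 0)"
    by (rule sum_pairs_split[OF fI])
  also have "(\<Sum>i\<in>I. \<Sum>j\<in>I. if i < j then ?p i (n + 1) (?p j n x) + ?p j (n + 1) (?p i n x) else 0) = 0"
    using pre_hom_swap[OF I O x] eX by (intro sum.neutral ballI) auto
  also have "(\<Sum>i\<in>I. ?p i (n + 1) (?p i n x))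
    = (\<Sum>i\<in>I. pre_hom C P I i (X i) X B n 2 x (DCmp C (X i) (X i) (X i) 1 1 (e (X i)) (e (X i))))"
    using pre_hom_cmp[OF I O x _ eX eX] by (intro sum.cong) auto
  finally show ?thesis by simp
qed

text \<open>In addition to the cancellations among morphisms, substitution from the left commutes with
  substitution into the slots, where the two terms have opposite signs since \<open>D x\<close> and \<open>e x\<close> are of
  degree \<open>n + 1\<close>. The Maurer-Cartan equations of \<open>B\<close> and of the \<open>X i\<close> account for the rest.\<close>

lemma twist_tdif_square:
  assumes x: "x \<in> TOp P I X B n"
  shows "twist_tdif C P e I X B (n + 1) (twist_tdif C P e I X B n x) = 0"
proof -
  note eB = e_closed[OF B]
  define D where "D = TDif P I X B"
  define S where "S = pre_all I X B"
  define E where "E n = post_hom P I X B B 1 n (e B)" for n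
  define S2 where "S2 u = (\<Sum>i\<in>I. pre_hom C P I i (X i) X B n 2 x (u (X i)))" for u
  define E2 where "E2 w = post_hom P I X B B 2 n w x" for w
  note t = twist_tdif_terms[OF x, folded D_def S_def E_def]
  have tw: "twist_tdif C P e I X B n x = D n x + E n x - ksign n (S n x)" for n x
    by (simp add: twist_tdif_eq D_def S_def E_def)
  have DD: "D (n + 1) (D n x) = 0" unfolding D_def by (rule tdif_tdif[OF I O x])
  have DE: "D (n + 1) (E n x) = E2 (DDif C B B 1 (e B)) - E (n + 1) (D n x)"
    using post_hom_dif[OF I O(1) O(2) O(2) eB x] by (simp add: D_def E_def E2_def add.commute)
  have EE: "E (n + 1) (E n x) = E2 (DCmp C B B B 1 1 (e B) (e B))"
    using post_hom_cmp[OF I O(1) O(2) O(2) O(2) eB eB x] by (simp add: E_def E2_def add.commute)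
  have DS: "D (n + 1) (S n x) = S (n + 1) (D n x) + ksign n (S2 (\<lambda>A. DDif C A A 1 (e A)))"
  proof -
    have "D (n + 1) (S n x) = (\<Sum>i\<in>I. D (n + 1) (pre_hom C P I i (X i) X B n 1 x (e (X i))))"
      unfolding S_def pre_all_def D_def
      using pre_hom_closed[OF I O x] eX by (intro additive_on_sum[OF tdif_additive[OF I O]]) auto
    also have "\<dots> = (\<Sum>i\<in>I. pre_hom C P I i (X i) X B (n + 1) 1 (D n x) (e (X i))
        + ksign n (pre_hom C P I i (X i) X B n 2 x (DDif C (X i) (X i) 1 (e (X i)))))"
      using pre_hom_dif[OF I O x _ eX] by (intro sum.cong) (auto simp: D_def)
    finally show ?thesis by (simp add: sum.distrib S_def pre_all_def S2_def ksign_sum)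
  qed
  have ES: "E (n + 1) (S n x) = S (n + 1) (E n x)"
  proof -
    have "E (n + 1) (S n x) = (\<Sum>i\<in>I. E (n + 1) (pre_hom C P I i (X i) X B n 1 x (e (X i))))"
      unfolding S_def pre_all_def E_def
      using pre_hom_closed[OF I O x] eX
      by (intro additive_on_sum[OF post_hom_additive_right[OF I O O(2) eB]]) auto
    then show ?thesis
      using post_hom_pre_hom[OF I O(1) O(2) O(2) x _ eX eB]
      by (simp add: S_def pre_all_def E_def add.commute)
  qed
  have SS: "S (n + 1) (S n x) = S2 (\<lambda>A. DCmp C A A A 1 1 (e A) (e A))"
    using pre_all_square[OF x] by (simp add: S_def S2_def)
  have mcB: "E2 (DDif C B B 1 (e B)) + E2 (DCmp C B B B 1 1 (e B) (e B)) = 0"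
  proof -
    have a: "additive_on (DHom C B B 2) E2"
      unfolding E2_def by (rule post_hom_additive_left[OF I O O(2) x])
    have "DDif C B B 1 (e B) \<in> DHom C B B 2" "DCmp C B B B 1 1 (e B) (e B) \<in> DHom C B B 2"
      using dif_closed[OF O(2) O(2) eB] cmp_closed[OF O(2) O(2) O(2) eB eB] by simp_all
    from additive_on_add[OF a this] show ?thesis
      using mc_equation[OF B] additive_on_zero[OF a] by simp
  qed
  have mcX: "S2 (\<lambda>A. DDif C A A 1 (e A)) + S2 (\<lambda>A. DCmp C A A A 1 1 (e A) (e A)) = 0"
    unfolding S2_def sum.distrib[symmetric]
  proof (intro sum.neutral ballI)
    fix i assume i: "i \<in> I"
    have Xi: "X i \<in> T" "X i \<in> DOb C" using i X O by auto
    note a = pre_hom_additive_right[OF I O x i, of 2]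
    have "DDif C (X i) (X i) 1 (e (X i)) \<in> DHom C (X i) (X i) 2"
      "DCmp C (X i) (X i) (X i) 1 1 (e (X i)) (e (X i)) \<in> DHom C (X i) (X i) 2"
      using dif_closed[OF Xi(2) Xi(2) eX[OF i]] cmp_closed[OF Xi(2) Xi(2) Xi(2) eX[OF i] eX[OF i]]
      by simp_all
    from additive_on_add[OF a this]
    show "pre_hom C P I i (X i) X B n 2 x (DDif C (X i) (X i) 1 (e (X i)))
      + pre_hom C P I i (X i) X B n 2 x (DCmp C (X i) (X i) (X i) 1 1 (e (X i)) (e (X i))) = 0"
      using mc_equation[OF Xi(1)] additive_on_zero[OF a] by simp
  qed
  have lin: "\<phi> (D n x + E n x - ksign n (S n x)) = \<phi> (D n x) + \<phi> (E n x) - ksign n (\<phi> (S n x))"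
    if "additive_on (TOp P I X B (n + 1)) \<phi>" for \<phi> :: "'p \<Rightarrow> 'p"
    by (rule additive_on_twist[OF that t])
  have "twist_tdif C P e I X B (n + 1) (twist_tdif C P e I X B n x)
    = (D (n + 1) (D n x) + D (n + 1) (E n x) - ksign n (D (n + 1) (S n x)))
      + (E (n + 1) (D n x) + E (n + 1) (E n x) - ksign n (E (n + 1) (S n x)))
      + ksign n (S (n + 1) (D n x) + S (n + 1) (E n x) - ksign n (S (n + 1) (S n x)))"
    unfolding tw
    using lin[OF tdif_additive[OF I O]] lin[OF post_hom_additive_right[OF I O O(2) eB]]
      lin[OF pre_all_additive] by (simp add: D_def E_def S_def)
  also have "\<dots> = (E2 (DDif C B B 1 (e B)) + E2 (DCmp C B B B 1 1 (e B) (e B)))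
      - (S2 (\<lambda>A. DDif C A A 1 (e A)) + S2 (\<lambda>A. DCmp C A A A 1 1 (e A) (e A)))"
    unfolding DD DE DS EE ES SS by (simp add: ksign_add ksign_diff)
  finally show ?thesis by (simp add: mcB mcX)
qed

end

lemma twist_one_dif:
  assumes A: "A \<in> T" and B: "B \<in> T" and u: "u \<in> DHom C A B q"
  shows "TOne P i A B (q + 1) (twist_dif C e A B q u)
    = twist_tdif C P e {i} (\<lambda>_\<in>{i}. A) B q (TOne P i A B q u)"
proof -
  note O = T_sub[OF A] T_sub[OF B]
  have "TOne P i A B (q + 1) (twist_dif C e A B q u)
    = TOne P i A B (q + 1) (DDif C A B q u) + TOne P i A B (q + 1) (DCmp C A B B 1 q (e B) u)
      - ksign q (TOne P i A B (q + 1) (DCmp C A A B q 1 u (e A)))"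
    unfolding twist_dif_def by (rule additive_on_twist[OF one_additive[OF O] twist_dif_terms[OF A B u]])
  moreover have "TOne P i A B (q + 1) (DCmp C A B B 1 q (e B) u)
      = post_hom P {i} (\<lambda>_\<in>{i}. A) B B 1 q (e B) (TOne P i A B q u)"
    using one_cmp[OF O(1,2,2) e_closed[OF B] u, of i 1] by (simp add: post_hom_def add.commute)
  moreover have "TOne P i A B (q + 1) (DCmp C A A B q 1 u (e A))
      = pre_hom C P {i} i A (\<lambda>_\<in>{i}. A) B q 1 (TOne P i A B q u) (e A)"
  proof -
    have "(\<lambda>a\<in>{i}. if a = i then 1 else 0) = (\<lambda>_\<in>{i}. 1::int)"
      "(\<lambda>a\<in>{i}. a) = (\<lambda>_\<in>{i}. i)"
      "(\<lambda>a\<in>{i}. if a = i then TOne P i A ((\<lambda>_\<in>{i}. A) i) 1 (e A) else TOne P a ((\<lambda>_\<in>{i}. A) a) ((\<lambda>_\<in>{i}. A) a) 0 (DId C ((\<lambda>_\<in>{i}. A) a)))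
        = (\<lambda>_\<in>{i}. TOne P i A A 1 (e A))" by auto
    then show ?thesis
      using one_cmp[OF O(1,1,2) u e_closed[OF A], of i i] by (simp add: pre_hom_def del: restrict_apply)
  qed
  ultimately show ?thesis by (simp add: twist_tdif_def one_dif O u)
qed

text \<open>The terms that put an element \<open>e\<close> between
  \<open>f\<close> and some \<open>g i\<close> occur twice, from \<open>f\<close> and from \<open>g i\<close>, with opposite signs.\<close>

lemma twist_tcmp_dif:
  assumes s: "surjection J I \<pi>" and X: "X \<in> J \<rightarrow>\<^sub>E T" and Y: "Y \<in> I \<rightarrow>\<^sub>E T" and Z: "Z \<in> T"
    and n: "n \<in> extensional I" and f: "f \<in> TOp P I Y Z m" and g: "g \<in> op_families P J I \<pi> X Y n"
  shows "twist_tdif C P e J X Z (m + (\<Sum>i\<in>I. n i)) (TCmp P J I \<pi> X Y Z m n f g)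
    = TCmp P J I \<pi> X Y Z (m + 1) n (twist_tdif C P e I Y Z m f) g
      + (\<Sum>k\<in>I. ksign (m + (\<Sum>i\<in>{i \<in> I. i < k}. n i))
          (TCmp P J I \<pi> X Y Z m (n(k := n k + 1)) f
            (g(k := twist_tdif C P e (fiber J \<pi> k) (restrict X (fiber J \<pi> k)) (Y k) (n k) (g k)))))"
proof -
  note sD = surjectionD[OF s]
  note XO = T_family[OF X] and YO = T_family[OF Y] and ZO = T_sub[OF Z] and eZ = e_closed[OF Z]
  let ?N = "\<Sum>i\<in>I. n i"
  let ?T = "TCmp P J I \<pi> X Y Z"
  let ?l = "\<lambda>k. \<Sum>i\<in>{i \<in> I. i < k}. n i"
  let ?F = "\<lambda>k. fiber J \<pi> k"
  let ?X = "\<lambda>k. restrict X (?F k)"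
  define Dg where "Dg k = TDif P (?F k) (?X k) (Y k) (n k) (g k)" for k
  define Eg where "Eg k = post_hom P (?F k) (?X k) (Y k) (Y k) 1 (n k) (e (Y k)) (g k)" for k
  define Hg where "Hg k j = pre_hom C P (?F k) j (X j) (?X k) (Y k) (n k) 1 (g k) (e (X j))" for k j
  define slot where "slot k y = ?T m (n(k := n k + 1)) f (g(k := y))" for k y
  have FI: "index_set (?F k)" "?X k \<in> ?F k \<rightarrow>\<^sub>E T" "Y k \<in> T"
      "g k \<in> TOp P (?F k) (?X k) (Y k) (n k)" if "k \<in> I" for k
    using that X Y g surjection_fiber[OF s that] fiber_subset[of J \<pi> k]
    by (auto simp: op_families_iff PiE_iff)
  have Sg: "pre_all (?F k) (?X k) (Y k) (n k) (g k) = (\<Sum>j\<in>?F k. Hg k j)" for k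
    unfolding pre_all_def Hg_def by (intro sum.cong) auto
  have gt: "Dg k \<in> TOp P (?F k) (?X k) (Y k) (n k + 1)" "Eg k \<in> TOp P (?F k) (?X k) (Y k) (n k + 1)"
      "(\<Sum>j\<in>?F k. Hg k j) \<in> TOp P (?F k) (?X k) (Y k) (n k + 1)" if "k \<in> I" for k
    using twist_tdif_terms[OF FI[OF that]] by (simp_all add: Dg_def Eg_def Sg)
  have Hgt: "Hg k j \<in> TOp P (?F k) (?X k) (Y k) (n k + 1)" if "k \<in> I" "j \<in> ?F k" for k j
    using pre_hom_closed[OF FI(1)[OF that(1)] T_family[OF FI(2)[OF that(1)]] T_sub[OF FI(3)[OF that(1)]]
        FI(4)[OF that(1)] that(2), of "e (X j)" 1] that X
    by (auto simp: Hg_def e_closed fiber_def PiE_iff)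
  have slot_add: "additive_on (TOp P (?F k) (?X k) (Y k) (n k + 1)) (slot k)" if k: "k \<in> I" for k
  proof -
    have "g(k := Dg k) \<in> op_families P J I \<pi> X Y (n(k := n k + 1))"
      by (rule op_families_upd[OF g k gt(1)[OF k]])
    moreover have "n(k := n k + 1) \<in> extensional I" using n k by (auto simp: extensional_def)
    ultimately have "additive_on (TOp P (?F k) (?X k) (Y k) ((n(k := n k + 1)) k))
        (\<lambda>x. ?T m (n(k := n k + 1)) f ((g(k := Dg k))(k := x)))"
      by (intro tcmp_additive_slot[OF s XO YO ZO _ f _ k])
    then show ?thesis by (simp add: slot_def[abs_def])
  qed
  have slot_split: "slot k (twist_tdif C P e (?F k) (?X k) (Y k) (n k) (g k))
      = slot k (Dg k) + slot k (Eg k) - ksign (n k) (\<Sum>j\<in>?F k. slot k (Hg k j))" if k: "k \<in> I" for k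
  proof -
    have "slot k (\<Sum>j\<in>?F k. Hg k j) = (\<Sum>j\<in>?F k. slot k (Hg k j))"
      by (rule additive_on_sum[OF slot_add[OF k] Hgt[OF k]])
    then show ?thesis
      unfolding twist_tdif_eq Sg
      using additive_on_twist[OF slot_add[OF k] gt[OF k], of "n k"] by (simp add: Dg_def Eg_def)
  qed
  have eq1: "TDif P J X Z (m + ?N) (?T m n f g) = ?T (m + 1) n (TDif P I Y Z m f) g
      + (\<Sum>k\<in>I. ksign (m + ?l k) (slot k (Dg k)))"
    unfolding slot_def Dg_def by (rule tcmp_dif[OF s XO YO ZO n f g])
  have eq2: "post_hom P J X Z Z 1 (m + ?N) (e Z) (?T m n f g)
      = ?T (m + 1) n (post_hom P I Y Z Z 1 m (e Z) f) g"
    using post_hom_tcmp[OF s XO YO ZO ZO n f g eZ] by (simp add: add.commute)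
  have eq3: "pre_all J X Z (m + ?N) (?T m n f g)
      = (\<Sum>k\<in>I. \<Sum>j\<in>?F k. ksign (\<Sum>l\<in>{l \<in> I. k < l}. n l) (slot k (Hg k j)))"
  proof -
    have "pre_all J X Z (m + ?N) (?T m n f g)
      = (\<Sum>j\<in>J. ksign (\<Sum>l\<in>{l \<in> I. \<pi> j < l}. n l) (slot (\<pi> j) (Hg (\<pi> j) j)))"
      unfolding pre_all_def slot_def Hg_def using X
      by (intro sum.cong refl pre_hom_of_tcmp[OF s XO YO ZO n f g]) (auto intro: e_closed)
    also have "\<dots> = (\<Sum>k\<in>I. \<Sum>j\<in>?F k. ksign (\<Sum>l\<in>{l \<in> I. \<pi> j < l}. n l) (slot (\<pi> j) (Hg (\<pi> j) j)))"
      by (rule sum_fibers[OF s, symmetric])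
    also have "\<dots> = (\<Sum>k\<in>I. \<Sum>j\<in>?F k. ksign (\<Sum>l\<in>{l \<in> I. k < l}. n l) (slot k (Hg k j)))"
      by (intro sum.cong refl) (auto simp: fiber_def)
    finally show ?thesis .
  qed
  have eq4: "?T (m + 1) n (twist_tdif C P e I Y Z m f) g
    = ?T (m + 1) n (TDif P I Y Z m f) g + ?T (m + 1) n (post_hom P I Y Z Z 1 m (e Z) f) g
      - ksign m (\<Sum>k\<in>I. ksign (?l k) (slot k (Eg k)))"
  proof -
    have cl: "pre_hom C P I i (Y i) Y Z m 1 f (e (Y i)) \<in> TOp P I Y Z (m + 1)" if "i \<in> I" for i
      using that Y by (intro pre_hom_closed[OF sD(2) YO ZO f]) (auto intro: e_closed)
    have "?T (m + 1) n (pre_all I Y Z m f) g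
        = (\<Sum>i\<in>I. ?T (m + 1) n (pre_hom C P I i (Y i) Y Z m 1 f (e (Y i))) g)"
      unfolding pre_all_def by (rule additive_on_sum[OF tcmp_additive_left[OF s XO YO ZO n g] cl])
    also have "\<dots> = (\<Sum>k\<in>I. ksign (?l k) (slot k (Eg k)))"
      unfolding slot_def Eg_def using Y
      by (intro sum.cong refl tcmp_of_pre_hom[OF s XO YO ZO n f g]) (auto intro: e_closed)
    finally show ?thesis
      unfolding twist_tdif_eq
      using additive_on_twist[OF tcmp_additive_left[OF s XO YO ZO n g] twist_tdif_terms[OF sD(2) Y Z f], of m]
      by simp
  qed
  have sgn: "ksign (m + ?l k) (ksign (n k) x) = ksign (m + ?N) (ksign (\<Sum>l\<in>{l \<in> I. k < l}. n l) x)"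
    if k: "k \<in> I" for k and x :: 'p
  proof -
    have "I = {i \<in> I. i < k} \<union> ({k} \<union> {i \<in> I. k < i})" using k by auto
    then have "?N = sum n ({i \<in> I. i < k} \<union> ({k} \<union> {i \<in> I. k < i}))" by simp
    also have "\<dots> = ?l k + (n k + (\<Sum>l\<in>{l \<in> I. k < l}. n l))"
      using sD(4) by (subst sum.union_disjoint, auto)+
    finally show ?thesis unfolding ksign_ksign by (intro ksign_cong) simp
  qed
  have eq5: "(\<Sum>k\<in>I. ksign (m + ?l k) (slot k (twist_tdif C P e (?F k) (?X k) (Y k) (n k) (g k))))
    = (\<Sum>k\<in>I. ksign (m + ?l k) (slot k (Dg k))) + ksign m (\<Sum>k\<in>I. ksign (?l k) (slot k (Eg k)))
      - ksign (m + ?N) (\<Sum>k\<in>I. \<Sum>j\<in>?F k. ksign (\<Sum>l\<in>{l \<in> I. k < l}. n l) (slot k (Hg k j)))"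
  proof -
    have "(\<Sum>k\<in>I. ksign (m + ?l k) (slot k (twist_tdif C P e (?F k) (?X k) (Y k) (n k) (g k))))
      = (\<Sum>k\<in>I. ksign (m + ?l k) (slot k (Dg k)) + ksign m (ksign (?l k) (slot k (Eg k)))
        - ksign (m + ?N) (\<Sum>j\<in>?F k. ksign (\<Sum>l\<in>{l \<in> I. k < l}. n l) (slot k (Hg k j))))"
    proof (intro sum.cong refl)
      fix k assume k: "k \<in> I"
      show "ksign (m + ?l k) (slot k (twist_tdif C P e (?F k) (?X k) (Y k) (n k) (g k)))
        = ksign (m + ?l k) (slot k (Dg k)) + ksign m (ksign (?l k) (slot k (Eg k)))
          - ksign (m + ?N) (\<Sum>j\<in>?F k. ksign (\<Sum>l\<in>{l \<in> I. k < l}. n l) (slot k (Hg k j)))"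
        unfolding slot_split[OF k] ksign_diff ksign_add sgn[OF k] by (simp add: ksign_sum)
    qed
    then show ?thesis by (simp add: sum.distrib sum_subtractf ksign_sum)
  qed
  show ?thesis
    using eq4 eq5 unfolding twist_tdif_eq[of J] eq1 eq2 eq3 by (simp add: slot_def)
qed

theorem twist_pseudo_tensor: "pseudo_tensor_structure (twist_cat C T e) (twist_tensor C P e)"
proof (intro pseudo_tensor_structure.intro twist_dg_category pseudo_tensor_structure_axioms.intro,
    unfold twist_cat_simps twist_tensor_simps)
  fix I X B assume a: "index_set I" "X \<in> I \<rightarrow>\<^sub>E T" "B \<in> T"
  then show "cochain_complex (TOp P I X B) (twist_tdif C P e I X B)"
    unfolding cochain_complex_def
    by (auto simp: T_sub T_family op_subgroup twist_tdif_closed twist_tdif_add twist_tdif_square)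
next
  fix J I \<pi> X Y Z m n f and g :: "nat \<Rightarrow> 'p"
  assume "surjection J I \<pi>" "X \<in> J \<rightarrow>\<^sub>E T" "Y \<in> I \<rightarrow>\<^sub>E T" "Z \<in> T" "n \<in> extensional I"
    "f \<in> TOp P I Y Z m" "g \<in> op_families P J I \<pi> X Y n"
  then show "twist_tdif C P e J X Z (m + (\<Sum>i\<in>I. n i)) (TCmp P J I \<pi> X Y Z m n f g)
    = TCmp P J I \<pi> X Y Z (m + 1) n (twist_tdif C P e I Y Z m f) g
      + (\<Sum>k\<in>I. ksign (m + (\<Sum>i\<in>{i \<in> I. i < k}. n i))
          (TCmp P J I \<pi> X Y Z m (n(k := n k + 1)) f
            (g(k := twist_tdif C P e (fiber J \<pi> k) (restrict X (fiber J \<pi> k)) (Y k) (n k) (g k)))))"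
    by (rule twist_tcmp_dif)
qed (simp_all only: T_sub T_family one_bij one_add twist_one_dif one_cmp tcmp_closed tcmp_add_left
    tcmp_add_right tcmp_assoc tcmp_id_left tcmp_id_right)

end

section \<open>The graded completion of a DG category\<close>

text \<open>
  Objects carry an arbitrary matrix \<^const>\<open>tw_mor\<close>, morphisms are those of Pre-Tr, and the differential
  is the part of the one of Pre-Tr that involves the differential of \<open>C\<close> alone. The twisted objects
  are the objects whose matrix is a Maurer-Cartan element here (see \<open>pretr_objects_iff\<close>).
\<close>

definition graded_objects :: "('o, 'm) dg_cat \<Rightarrow> ('o, 'm) twisted set" where
  "graded_objects C = {E. tw_ob E \<in> tw_range E \<rightarrow>\<^sub>E DOb C}"

definition graded_dif ::
    "('o, 'm::ab_group_add) dg_cat \<Rightarrow> ('o, 'm) twisted \<Rightarrow> ('o, 'm) twisted \<Rightarrow> int \<Rightarrow>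
     (int \<Rightarrow> int \<Rightarrow> 'm) \<Rightarrow> int \<Rightarrow> int \<Rightarrow> 'm" where
  "graded_dif C E F n \<phi> = (\<lambda>i j. if i \<in> tw_range F \<and> j \<in> tw_range E
     then ksign i (DDif C (tw_ob E j) (tw_ob F i) (n + j - i) (\<phi> i j)) else 0)"

definition graded_cat ::
    "('o, 'm::ab_group_add) dg_cat \<Rightarrow> (('o, 'm) twisted, int \<Rightarrow> int \<Rightarrow> 'm) dg_cat" where
  "graded_cat C = (pretr C)\<lparr>DOb := graded_objects C, DDif := graded_dif C\<rparr>"

lemma graded_cat_simps [simp]:
  "DOb (graded_cat C) = graded_objects C" "DHom (graded_cat C) = pretr_hom C"
  "DDif (graded_cat C) = graded_dif C" "DCmp (graded_cat C) = pretr_cmp C"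
  "DId (graded_cat C) = pretr_id C"
  by (simp_all add: graded_cat_def pretr_def)

lemma graded_objects_ob: "E \<in> graded_objects C \<Longrightarrow> i \<in> tw_range E \<Longrightarrow> tw_ob E i \<in> DOb C"
  unfolding graded_objects_def by blast

lemma pretr_homI:
  assumes "\<And>i j. i \<in> tw_range F \<Longrightarrow> j \<in> tw_range E
      \<Longrightarrow> \<phi> i j \<in> DHom C (tw_ob E j) (tw_ob F i) (n + j - i)"
    and "\<And>i j. i \<notin> tw_range F \<or> j \<notin> tw_range E \<Longrightarrow> \<phi> i j = 0"
  shows "\<phi> \<in> pretr_hom C E F n"
  unfolding pretr_hom_def using assms by blast

lemma pretr_hom_entry:
  "\<phi> \<in> pretr_hom C E F n \<Longrightarrow> i \<in> tw_range F \<Longrightarrow> j \<in> tw_range E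
    \<Longrightarrow> \<phi> i j \<in> DHom C (tw_ob E j) (tw_ob F i) (n + j - i)"
  unfolding pretr_hom_def by blast

lemma pretr_hom_outside:
  "\<phi> \<in> pretr_hom C E F n \<Longrightarrow> i \<notin> tw_range F \<or> j \<notin> tw_range E \<Longrightarrow> \<phi> i j = 0"
  unfolding pretr_hom_def by blast

context dg_category
begin

text \<open>The axioms with the degrees of composites up to equality of integers: the degrees
  \<open>n + j - i\<close> of matrix entries add up only after rearrangement.\<close>

lemma cmp_closed_deg:
  "\<lbrakk>X \<in> DOb C; Y \<in> DOb C; Z \<in> DOb C; f \<in> DHom C Y Z m; g \<in> DHom C X Y n; d = m + n\<rbrakk>
    \<Longrightarrow> DCmp C X Y Z m n f g \<in> DHom C X Z d"
  by (simp add: cmp_closed)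

lemma cmp_assoc_deg:
  "\<lbrakk>W \<in> DOb C; X \<in> DOb C; Y \<in> DOb C; Z \<in> DOb C;
    f \<in> DHom C Y Z m; g \<in> DHom C X Y n; h \<in> DHom C W X p; a = m + n; b = n + p\<rbrakk>
    \<Longrightarrow> DCmp C W X Z a p (DCmp C X Y Z m n f g) h = DCmp C W Y Z m b f (DCmp C W X Y n p g h)"
  by (simp add: cmp_assoc)

lemma dif_cmp_deg:
  "\<lbrakk>X \<in> DOb C; Y \<in> DOb C; Z \<in> DOb C; f \<in> DHom C Y Z m; g \<in> DHom C X Y n;
    d = m + n; m' = m + 1; n' = n + 1\<rbrakk>
    \<Longrightarrow> DDif C X Z d (DCmp C X Y Z m n f g)
      = DCmp C X Y Z m' n (DDif C Y Z m f) g + ksign m (DCmp C X Y Z m n' f (DDif C X Y n g))"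
  by (simp add: dif_cmp)

lemma dif_closed_deg:
  "X \<in> DOb C \<Longrightarrow> Y \<in> DOb C \<Longrightarrow> f \<in> DHom C X Y n \<Longrightarrow> d = n + 1 \<Longrightarrow> DDif C X Y n f \<in> DHom C X Y d"
  by (simp add: dif_closed)

lemma cmp_zero_left [simp]:
  "\<lbrakk>X \<in> DOb C; Y \<in> DOb C; Z \<in> DOb C; g \<in> DHom C X Y n\<rbrakk> \<Longrightarrow> DCmp C X Y Z m n 0 g = 0"
  by (rule additive_on_zero[OF cmp_additive_left])

lemma cmp_zero_right [simp]:
  "\<lbrakk>X \<in> DOb C; Y \<in> DOb C; Z \<in> DOb C; f \<in> DHom C Y Z m\<rbrakk> \<Longrightarrow> DCmp C X Y Z m n f 0 = 0"
  by (rule additive_on_zero[OF cmp_additive_right])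

lemma dif_zero [simp]: "X \<in> DOb C \<Longrightarrow> Y \<in> DOb C \<Longrightarrow> DDif C X Y n 0 = 0"
  by (rule additive_on_zero[OF dif_additive])

lemma hom_zero [simp]: "X \<in> DOb C \<Longrightarrow> Y \<in> DOb C \<Longrightarrow> 0 \<in> DHom C X Y n"
  by (rule subgroup_zero[OF hom_subgroup])

lemma graded_hom_subgroup:
  assumes "E \<in> graded_objects C" "F \<in> graded_objects C"
  shows "additive_subgroup (pretr_hom C E F n)"
  unfolding additive_subgroup_def pretr_hom_def
  using assms hom_subgroup[OF graded_objects_ob graded_objects_ob, of E _ F]
  by (auto intro: subgroup_zero subgroup_add subgroup_minus)

lemma graded_dif_closed:
  assumes "E \<in> graded_objects C" "F \<in> graded_objects C" "\<phi> \<in> pretr_hom C E F n"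
  shows "graded_dif C E F n \<phi> \<in> pretr_hom C E F (n + 1)"
proof (rule pretr_homI)
  fix i j assume ij: "i \<in> tw_range F" "j \<in> tw_range E"
  note O = graded_objects_ob[OF assms(1) ij(2)] graded_objects_ob[OF assms(2) ij(1)]
  have "ksign i (DDif C (tw_ob E j) (tw_ob F i) (n + j - i) (\<phi> i j))
      \<in> DHom C (tw_ob E j) (tw_ob F i) (n + 1 + j - i)"
    by (intro subgroup_ksign hom_subgroup O dif_closed_deg pretr_hom_entry[OF assms(3)] ij) simp
  then show "graded_dif C E F n \<phi> i j \<in> DHom C (tw_ob E j) (tw_ob F i) (n + 1 + j - i)"
    using ij by (simp add: graded_dif_def)
qed (auto simp: graded_dif_def)

lemma graded_dif_square:
  assumes "E \<in> graded_objects C" "F \<in> graded_objects C" "\<phi> \<in> pretr_hom C E F n"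
  shows "graded_dif C E F (n + 1) (graded_dif C E F n \<phi>) = 0"
proof (intro ext)
  fix i j
  show "graded_dif C E F (n + 1) (graded_dif C E F n \<phi>) i j = 0 i j"
  proof (cases "i \<in> tw_range F \<and> j \<in> tw_range E")
    case True
    note O = graded_objects_ob[OF assms(1), of j] graded_objects_ob[OF assms(2), of i]
    let ?x = "DDif C (tw_ob E j) (tw_ob F i) (n + j - i) (\<phi> i j)"
    have f: "\<phi> i j \<in> DHom C (tw_ob E j) (tw_ob F i) (n + j - i)"
      using True pretr_hom_entry[OF assms(3)] by simp
    have e: "n + 1 + j - i = (n + j - i) + 1" by simp
    have "graded_dif C E F (n + 1) (graded_dif C E F n \<phi>) i j
        = ksign i (DDif C (tw_ob E j) (tw_ob F i) (n + 1 + j - i) (ksign i ?x))"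
      using True by (simp add: graded_dif_def)
    also have "\<dots> = ksign i (ksign i (DDif C (tw_ob E j) (tw_ob F i) (n + 1 + j - i) ?x))"
      unfolding e using True O f by (subst additive_on_ksign[OF dif_additive dif_closed]) auto
    also have "DDif C (tw_ob E j) (tw_ob F i) (n + 1 + j - i) ?x = 0"
      unfolding e using True O f by (intro dif_dif) auto
    finally show ?thesis by simp
  qed (auto simp: graded_dif_def)
qed

lemma pretr_cmp_terms:
  assumes O: "E \<in> graded_objects C" "F \<in> graded_objects C" "G \<in> graded_objects C"
    and \<psi>: "\<psi> \<in> pretr_hom C F G m" and \<phi>: "\<phi> \<in> pretr_hom C E F n"
    and i: "i \<in> tw_range G" "j \<in> tw_range E" "k \<in> tw_range F" and d: "d = m + n + j - i"
  shows "DCmp C (tw_ob E j) (tw_ob F k) (tw_ob G i) (m + k - i) (n + j - k) (\<psi> i k) (\<phi> k j)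
    \<in> DHom C (tw_ob E j) (tw_ob G i) d"
  using i d
  by (intro cmp_closed_deg graded_objects_ob[OF O(1)] graded_objects_ob[OF O(2)]
      graded_objects_ob[OF O(3)] pretr_hom_entry[OF \<psi>] pretr_hom_entry[OF \<phi>]) auto

lemma pretr_cmp_closed:
  assumes O: "E \<in> graded_objects C" "F \<in> graded_objects C" "G \<in> graded_objects C"
    and \<psi>: "\<psi> \<in> pretr_hom C F G m" and \<phi>: "\<phi> \<in> pretr_hom C E F n"
  shows "pretr_cmp C E F G m n \<psi> \<phi> \<in> pretr_hom C E G (m + n)"
proof (rule pretr_homI)
  fix i j assume i: "i \<in> tw_range G" "j \<in> tw_range E"
  then show "pretr_cmp C E F G m n \<psi> \<phi> i j \<in> DHom C (tw_ob E j) (tw_ob G i) (m + n + j - i)"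
    unfolding pretr_cmp_def using O
    by (auto intro!: subgroup_sum hom_subgroup pretr_cmp_terms[OF O \<psi> \<phi>] graded_objects_ob)
qed (auto simp: pretr_cmp_def)

lemma pretr_cmp_assoc:
  assumes O: "D \<in> graded_objects C" "E \<in> graded_objects C" "F \<in> graded_objects C" "G \<in> graded_objects C"
    and f: "f \<in> pretr_hom C F G m" and g: "g \<in> pretr_hom C E F n" and h: "h \<in> pretr_hom C D E p"
  shows "pretr_cmp C D E G (m + n) p (pretr_cmp C E F G m n f g) h
       = pretr_cmp C D F G m (n + p) f (pretr_cmp C D E F n p g h)"
proof (intro ext)
  fix i j
  show "pretr_cmp C D E G (m + n) p (pretr_cmp C E F G m n f g) h i j
       = pretr_cmp C D F G m (n + p) f (pretr_cmp C D E F n p g h) i j"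
  proof (cases "i \<in> tw_range G \<and> j \<in> tw_range D")
    case True
    then have i: "i \<in> tw_range G" and j: "j \<in> tw_range D" by auto
    note DO = graded_objects_ob[OF O(1)] and EO = graded_objects_ob[OF O(2)]
      and FO = graded_objects_ob[OF O(3)] and GO = graded_objects_ob[OF O(4)]
    note fe = pretr_hom_entry[OF f] and ge = pretr_hom_entry[OF g] and he = pretr_hom_entry[OF h]
    let ?c = "\<lambda>k l. DCmp C (tw_ob D j) (tw_ob F l) (tw_ob G i) (m + l - i) (n + p + j - l) (f i l)
          (DCmp C (tw_ob D j) (tw_ob E k) (tw_ob F l) (n + k - l) (p + j - k) (g l k) (h k j))"
    have "pretr_cmp C D E G (m + n) p (pretr_cmp C E F G m n f g) h i j
      = (\<Sum>k\<in>tw_range E. DCmp C (tw_ob D j) (tw_ob E k) (tw_ob G i) (m + n + k - i) (p + j - k)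
          (\<Sum>l\<in>tw_range F. DCmp C (tw_ob E k) (tw_ob F l) (tw_ob G i) (m + l - i) (n + k - l)
             (f i l) (g l k)) (h k j))"
      using True by (auto simp: pretr_cmp_def intro!: sum.cong)
    also have "\<dots> = (\<Sum>k\<in>tw_range E. \<Sum>l\<in>tw_range F. ?c k l)"
    proof (intro sum.cong refl)
      fix k assume k: "k \<in> tw_range E"
      have "DCmp C (tw_ob D j) (tw_ob E k) (tw_ob G i) (m + n + k - i) (p + j - k)
          (\<Sum>l\<in>tw_range F. DCmp C (tw_ob E k) (tw_ob F l) (tw_ob G i) (m + l - i) (n + k - l)
             (f i l) (g l k)) (h k j)
        = (\<Sum>l\<in>tw_range F. DCmp C (tw_ob D j) (tw_ob E k) (tw_ob G i) (m + n + k - i) (p + j - k)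
          (DCmp C (tw_ob E k) (tw_ob F l) (tw_ob G i) (m + l - i) (n + k - l)
             (f i l) (g l k)) (h k j))"
        by (rule additive_on_sum[OF cmp_additive_left[OF DO[OF j] EO[OF k] GO[OF i] he[OF k j]]])
          (rule pretr_cmp_terms[OF O(2-4) f g i k], auto)
      also have "\<dots> = (\<Sum>l\<in>tw_range F. ?c k l)"
        by (intro sum.cong refl cmp_assoc_deg DO[OF j] EO[OF k] FO GO[OF i] fe[OF i] ge[OF _ k] he[OF k j])
          auto
      finally show "DCmp C (tw_ob D j) (tw_ob E k) (tw_ob G i) (m + n + k - i) (p + j - k)
          (\<Sum>l\<in>tw_range F. DCmp C (tw_ob E k) (tw_ob F l) (tw_ob G i) (m + l - i) (n + k - l)
             (f i l) (g l k)) (h k j) = (\<Sum>l\<in>tw_range F. ?c k l)" .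
    qed
    also have "\<dots> = (\<Sum>l\<in>tw_range F. \<Sum>k\<in>tw_range E. ?c k l)" by (rule sum.swap)
    also have "\<dots> = (\<Sum>l\<in>tw_range F. DCmp C (tw_ob D j) (tw_ob F l) (tw_ob G i) (m + l - i)
        (n + p + j - l) (f i l) (\<Sum>k\<in>tw_range E.
          DCmp C (tw_ob D j) (tw_ob E k) (tw_ob F l) (n + k - l) (p + j - k) (g l k) (h k j)))"
    proof (intro sum.cong refl)
      fix l assume l: "l \<in> tw_range F"
      show "(\<Sum>k\<in>tw_range E. ?c k l) = DCmp C (tw_ob D j) (tw_ob F l) (tw_ob G i) (m + l - i)
        (n + p + j - l) (f i l) (\<Sum>k\<in>tw_range E.
          DCmp C (tw_ob D j) (tw_ob E k) (tw_ob F l) (n + k - l) (p + j - k) (g l k) (h k j))"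
        by (rule additive_on_sum[OF cmp_additive_right[OF DO[OF j] FO[OF l] GO[OF i] fe[OF i l]], symmetric])
          (rule pretr_cmp_terms[OF O(1-3) g h l j], auto)
    qed
    also have "\<dots> = pretr_cmp C D F G m (n + p) f (pretr_cmp C D E F n p g h) i j"
      using True by (auto simp: pretr_cmp_def intro!: sum.cong)
    finally show ?thesis .
  qed (auto simp: pretr_cmp_def)
qed

lemma graded_dif_cmp:
  assumes O: "E \<in> graded_objects C" "F \<in> graded_objects C" "G \<in> graded_objects C"
    and \<psi>: "\<psi> \<in> pretr_hom C F G m" and \<phi>: "\<phi> \<in> pretr_hom C E F n"
  shows "graded_dif C E G (m + n) (pretr_cmp C E F G m n \<psi> \<phi>)
    = pretr_cmp C E F G (m + 1) n (graded_dif C F G m \<psi>) \<phi>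
      + ksign m (pretr_cmp C E F G m (n + 1) \<psi> (graded_dif C E F n \<phi>))"
proof (intro ext)
  fix i j
  show "graded_dif C E G (m + n) (pretr_cmp C E F G m n \<psi> \<phi>) i j
    = (pretr_cmp C E F G (m + 1) n (graded_dif C F G m \<psi>) \<phi>
      + ksign m (pretr_cmp C E F G m (n + 1) \<psi> (graded_dif C E F n \<phi>))) i j"
  proof (cases "i \<in> tw_range G \<and> j \<in> tw_range E")
    case True
    then have i: "i \<in> tw_range G" and j: "j \<in> tw_range E" by auto
    note EO = graded_objects_ob[OF O(1) j] and FO = graded_objects_ob[OF O(2)]
      and GO = graded_objects_ob[OF O(3) i]
    let ?c = "\<lambda>k a b x y. DCmp C (tw_ob E j) (tw_ob F k) (tw_ob G i) a b x y"
    have "graded_dif C E G (m + n) (pretr_cmp C E F G m n \<psi> \<phi>) i j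
      = ksign i (DDif C (tw_ob E j) (tw_ob G i) (m + n + j - i)
          (\<Sum>k\<in>tw_range F. ?c k (m + k - i) (n + j - k) (\<psi> i k) (\<phi> k j)))"
      using True by (simp add: graded_dif_def pretr_cmp_def)
    also have "\<dots> = (\<Sum>k\<in>tw_range F. ksign i (DDif C (tw_ob E j) (tw_ob G i) (m + n + j - i)
          (?c k (m + k - i) (n + j - k) (\<psi> i k) (\<phi> k j))))"
      unfolding ksign_sum[symmetric]
      using pretr_cmp_terms[OF O \<psi> \<phi> i j]
      by (subst additive_on_sum[OF dif_additive[OF EO GO]]) auto
    also have "\<dots> = (\<Sum>k\<in>tw_range F.
          ?c k (m + 1 + k - i) (n + j - k) (graded_dif C F G m \<psi> i k) (\<phi> k j)
          + ksign m (?c k (m + k - i) (n + 1 + j - k) (\<psi> i k) (graded_dif C E F n \<phi> k j)))"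
    proof (intro sum.cong refl)
      fix k assume k: "k \<in> tw_range F"
      note a = pretr_hom_entry[OF \<psi> i k] and b = pretr_hom_entry[OF \<phi> k j]
      have da: "DDif C (tw_ob F k) (tw_ob G i) (m + k - i) (\<psi> i k)
          \<in> DHom C (tw_ob F k) (tw_ob G i) (m + 1 + k - i)"
        by (rule dif_closed_deg[OF FO[OF k] GO a]) simp
      have db: "DDif C (tw_ob E j) (tw_ob F k) (n + j - k) (\<phi> k j)
          \<in> DHom C (tw_ob E j) (tw_ob F k) (n + 1 + j - k)"
        by (rule dif_closed_deg[OF EO FO[OF k] b]) simp
      have "DDif C (tw_ob E j) (tw_ob G i) (m + n + j - i)
          (?c k (m + k - i) (n + j - k) (\<psi> i k) (\<phi> k j))
        = ?c k (m + 1 + k - i) (n + j - k) (DDif C (tw_ob F k) (tw_ob G i) (m + k - i) (\<psi> i k)) (\<phi> k j)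
          + ksign (m + k - i) (?c k (m + k - i) (n + 1 + j - k) (\<psi> i k)
              (DDif C (tw_ob E j) (tw_ob F k) (n + j - k) (\<phi> k j)))"
        by (rule dif_cmp_deg[OF EO FO[OF k] GO a b]) simp_all
      then show "ksign i (DDif C (tw_ob E j) (tw_ob G i) (m + n + j - i)
          (?c k (m + k - i) (n + j - k) (\<psi> i k) (\<phi> k j)))
        = ?c k (m + 1 + k - i) (n + j - k) (graded_dif C F G m \<psi> i k) (\<phi> k j)
          + ksign m (?c k (m + k - i) (n + 1 + j - k) (\<psi> i k) (graded_dif C E F n \<phi> k j))"
        using i j k additive_on_ksign[OF cmp_additive_left[OF EO FO[OF k] GO b] da, of i]
          additive_on_ksign[OF cmp_additive_right[OF EO FO[OF k] GO a] db, of k]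
        by (simp add: graded_dif_def ksign_add)
    qed
    finally show ?thesis
      using True by (simp add: pretr_cmp_def sum.distrib ksign_apply ksign_sum)
  qed (auto simp: graded_dif_def pretr_cmp_def ksign_apply)
qed

lemma pretr_id_closed: "E \<in> graded_objects C \<Longrightarrow> pretr_id C E \<in> pretr_hom C E E 0"
  by (rule pretr_homI) (auto simp: pretr_id_def id_closed graded_objects_ob)

lemma pretr_id_left:
  assumes O: "E \<in> graded_objects C" "F \<in> graded_objects C" and \<phi>: "\<phi> \<in> pretr_hom C E F n"
  shows "pretr_cmp C E F F 0 n (pretr_id C F) \<phi> = \<phi>"
proof (intro ext)
  fix i j
  show "pretr_cmp C E F F 0 n (pretr_id C F) \<phi> i j = \<phi> i j"
  proof (cases "i \<in> tw_range F \<and> j \<in> tw_range E")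
    case True
    note o = graded_objects_ob[OF O(1)] graded_objects_ob[OF O(2)]
    have "pretr_cmp C E F F 0 n (pretr_id C F) \<phi> i j = (\<Sum>k\<in>tw_range F.
        DCmp C (tw_ob E j) (tw_ob F k) (tw_ob F i) (k - i) (n + j - k) (pretr_id C F i k) (\<phi> k j))"
      using True by (simp add: pretr_cmp_def)
    also have "\<dots> = (\<Sum>k\<in>tw_range F. if k = i then \<phi> i j else 0)"
    proof (intro sum.cong refl)
      fix k assume k: "k \<in> tw_range F"
      show "DCmp C (tw_ob E j) (tw_ob F k) (tw_ob F i) (k - i) (n + j - k) (pretr_id C F i k) (\<phi> k j)
          = (if k = i then \<phi> i j else 0)"
        using True k pretr_hom_entry[OF \<phi> k, of j] o by (auto simp: pretr_id_def id_left)
    qed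
    finally show ?thesis using True by simp
  qed (use pretr_hom_outside[OF \<phi>] in \<open>auto simp: pretr_cmp_def\<close>)
qed

lemma pretr_id_right:
  assumes O: "E \<in> graded_objects C" "F \<in> graded_objects C" and \<phi>: "\<phi> \<in> pretr_hom C E F n"
  shows "pretr_cmp C E E F n 0 \<phi> (pretr_id C E) = \<phi>"
proof (intro ext)
  fix i j
  show "pretr_cmp C E E F n 0 \<phi> (pretr_id C E) i j = \<phi> i j"
  proof (cases "i \<in> tw_range F \<and> j \<in> tw_range E")
    case True
    note o = graded_objects_ob[OF O(1)] graded_objects_ob[OF O(2)]
    have "pretr_cmp C E E F n 0 \<phi> (pretr_id C E) i j = (\<Sum>k\<in>tw_range E.
        DCmp C (tw_ob E j) (tw_ob E k) (tw_ob F i) (n + k - i) (j - k) (\<phi> i k) (pretr_id C E k j))"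
      using True by (simp add: pretr_cmp_def)
    also have "\<dots> = (\<Sum>k\<in>tw_range E. if k = j then \<phi> i j else 0)"
    proof (intro sum.cong refl)
      fix k assume k: "k \<in> tw_range E"
      show "DCmp C (tw_ob E j) (tw_ob E k) (tw_ob F i) (n + k - i) (j - k) (\<phi> i k) (pretr_id C E k j)
          = (if k = j then \<phi> i j else 0)"
        using True k pretr_hom_entry[OF \<phi> _ k, of i] o by (auto simp: pretr_id_def id_right)
    qed
    finally show ?thesis using True by simp
  qed (use pretr_hom_outside[OF \<phi>] in \<open>auto simp: pretr_cmp_def\<close>)
qed

lemma pretr_cmp_add_left:
  assumes O: "E \<in> graded_objects C" "F \<in> graded_objects C" "G \<in> graded_objects C"
    and \<psi>: "\<psi> \<in> pretr_hom C F G m" "\<psi>' \<in> pretr_hom C F G m" and \<phi>: "\<phi> \<in> pretr_hom C E F n"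
  shows "pretr_cmp C E F G m n (\<psi> + \<psi>') \<phi> = pretr_cmp C E F G m n \<psi> \<phi> + pretr_cmp C E F G m n \<psi>' \<phi>"
  using pretr_hom_entry[OF \<psi>(1)] pretr_hom_entry[OF \<psi>(2)] pretr_hom_entry[OF \<phi>]
    graded_objects_ob[OF O(1)] graded_objects_ob[OF O(2)] graded_objects_ob[OF O(3)]
  by (auto simp: pretr_cmp_def fun_eq_iff cmp_add_left simp flip: sum.distrib intro!: sum.cong)

lemma pretr_cmp_add_right:
  assumes O: "E \<in> graded_objects C" "F \<in> graded_objects C" "G \<in> graded_objects C"
    and \<psi>: "\<psi> \<in> pretr_hom C F G m" and \<phi>: "\<phi> \<in> pretr_hom C E F n" "\<phi>' \<in> pretr_hom C E F n"
  shows "pretr_cmp C E F G m n \<psi> (\<phi> + \<phi>') = pretr_cmp C E F G m n \<psi> \<phi> + pretr_cmp C E F G m n \<psi> \<phi>'"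
  using pretr_hom_entry[OF \<phi>(1)] pretr_hom_entry[OF \<phi>(2)] pretr_hom_entry[OF \<psi>]
    graded_objects_ob[OF O(1)] graded_objects_ob[OF O(2)] graded_objects_ob[OF O(3)]
  by (auto simp: pretr_cmp_def fun_eq_iff cmp_add_right simp flip: sum.distrib intro!: sum.cong)

lemma graded_dif_id: "E \<in> graded_objects C \<Longrightarrow> graded_dif C E E 0 (pretr_id C E) = 0"
  by (auto simp: graded_dif_def pretr_id_def id_dif graded_objects_ob fun_eq_iff)

lemma graded_dif_add:
  assumes "E \<in> graded_objects C" "F \<in> graded_objects C" "\<phi> \<in> pretr_hom C E F n" "\<psi> \<in> pretr_hom C E F n"
  shows "graded_dif C E F n (\<phi> + \<psi>) = graded_dif C E F n \<phi> + graded_dif C E F n \<psi>"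
  using assms(3,4)[THEN pretr_hom_entry] graded_objects_ob[OF assms(1)] graded_objects_ob[OF assms(2)]
  by (auto simp: graded_dif_def fun_eq_iff additive_on_add[OF dif_additive] ksign_add)

definition direct_sum_data ::
  "nat \<Rightarrow> (nat \<Rightarrow> 'o) \<Rightarrow> 'o \<Rightarrow> (nat \<Rightarrow> 'm) \<Rightarrow> (nat \<Rightarrow> 'm) \<Rightarrow> bool" where
  "direct_sum_data r A S inc proj \<longleftrightarrow> S \<in> DOb C \<and>
          (\<forall>k<r. inc k \<in> DHom C (A k) S 0 \<and> DDif C (A k) S 0 (inc k) = 0) \<and>
          (\<forall>k<r. proj k \<in> DHom C S (A k) 0 \<and> DDif C S (A k) 0 (proj k) = 0) \<and>
          (\<forall>k<r. \<forall>l<r. DCmp C (A k) S (A l) 0 0 (proj l) (inc k)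
                           = (if k = l then DId C (A k) else 0)) \<and>
          (\<Sum>k<r. DCmp C S (A k) S 0 0 (inc k) (proj k)) = DId C S"

lemma direct_sum_exists:
  assumes "\<And>k. k < r \<Longrightarrow> A k \<in> DOb C"
  shows "\<exists>S inc proj. direct_sum_data r A S inc proj"
proof -
  obtain S where S: "S \<in> DOb C"
    and ex: "\<exists>inc proj.
          (\<forall>k<r. inc k \<in> DHom C (A k) S 0 \<and> DDif C (A k) S 0 (inc k) = 0) \<and>
          (\<forall>k<r. proj k \<in> DHom C S (A k) 0 \<and> DDif C S (A k) 0 (proj k) = 0) \<and>
          (\<forall>k<r. \<forall>l<r. DCmp C (A k) S (A l) 0 0 (proj l) (inc k)
                           = (if k = l then DId C (A k) else 0)) \<and>
          (\<Sum>k<r. DCmp C S (A k) S 0 0 (inc k) (proj k)) = DId C S"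
    by (rule bexE[OF finite_direct_sums[of r A, OF assms]]) auto
  from ex show ?thesis
    unfolding direct_sum_data_def by (elim exE) (intro exI[of _ S] exI conjI, auto simp: S)
qed

text \<open>The empty direct sum.\<close>

lemma zero_object_exists: "\<exists>Z\<in>DOb C. DId C Z = 0"
  using finite_direct_sums[of 0] by simp

text \<open>Direct sums are formed degree by degree, with a zero object in place of the summands that are
  not defined in the given degree.\<close>

lemma graded_direct_sums:
  fixes r :: nat
  assumes A: "\<And>k. k < r \<Longrightarrow> A k \<in> graded_objects C"
  shows "\<exists>S\<in>graded_objects C. \<exists>inc proj.
      (\<forall>k<r. inc k \<in> pretr_hom C (A k) S 0 \<and> graded_dif C (A k) S 0 (inc k) = 0) \<and>
      (\<forall>k<r. proj k \<in> pretr_hom C S (A k) 0 \<and> graded_dif C S (A k) 0 (proj k) = 0) \<and>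
      (\<forall>k<r. \<forall>l<r. pretr_cmp C (A k) S (A l) 0 0 (proj l) (inc k)
                       = (if k = l then pretr_id C (A k) else 0)) \<and>
      (\<Sum>k<r. pretr_cmp C S (A k) S 0 0 (inc k) (proj k)) = pretr_id C S"
proof -
  obtain Z where Z: "Z \<in> DOb C" "DId C Z = 0" using zero_object_exists by blast
  define ob where "ob i k = (if i \<in> tw_range (A k) then tw_ob (A k) i else Z)" for i k
  have ob: "ob i k \<in> DOb C" if "k < r" for i k
    using that Z A graded_objects_ob by (auto simp: ob_def)
  have "\<forall>i. \<exists>S inc proj. direct_sum_data r (ob i) S inc proj"
    using direct_sum_exists ob by blast
  then obtain So In Pr where "\<And>i. direct_sum_data r (ob i) (So i) (In i) (Pr i)" by metis
  then have So: "\<And>i. So i \<in> DOb C"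
    and In: "\<And>i k. k < r \<Longrightarrow> In i k \<in> DHom C (ob i k) (So i) 0"
      "\<And>i k. k < r \<Longrightarrow> DDif C (ob i k) (So i) 0 (In i k) = 0"
    and Pr: "\<And>i k. k < r \<Longrightarrow> Pr i k \<in> DHom C (So i) (ob i k) 0"
      "\<And>i k. k < r \<Longrightarrow> DDif C (So i) (ob i k) 0 (Pr i k) = 0"
    and PI: "\<And>i k l. k < r \<Longrightarrow> l < r \<Longrightarrow> DCmp C (ob i k) (So i) (ob i l) 0 0 (Pr i l) (In i k)
               = (if k = l then DId C (ob i k) else 0)"
    and IP: "\<And>i. (\<Sum>k<r. DCmp C (So i) (ob i k) (So i) 0 0 (In i k) (Pr i k)) = DId C (So i)"
    by (auto simp: direct_sum_data_def)
  \<comment> \<open>The element \<open>0\<close> serves to make the minimum and the maximum meaningful when all ranges are empty.\<close>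
  define U where "U = insert 0 (\<Union>k<r. tw_range (A k))"
  define S :: "('o, 'm) twisted" where
    "S = \<lparr>tw_lo = Min U, tw_hi = Max U, tw_ob = (\<lambda>i\<in>{Min U..Max U}. So i), tw_mor = (\<lambda>_ _. 0)\<rparr>"
  have finU: "finite U" by (simp add: U_def)
  have sub: "i \<in> tw_range S" if "k < r" "i \<in> tw_range (A k)" for i k
  proof -
    have "i \<in> U" unfolding U_def using that by blast
    then show ?thesis using Min_le[OF finU] Max_ge[OF finU] by (simp add: S_def)
  qed
  have obS: "tw_ob S i = So i" if "i \<in> tw_range S" for i using that by (simp add: S_def)
  have S: "S \<in> graded_objects C" using So by (simp add: graded_objects_def S_def)
  have obA: "ob i k = tw_ob (A k) i" if "i \<in> tw_range (A k)" for i k using that by (simp add: ob_def)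
  define inc where "inc k i j = (if i = j \<and> i \<in> tw_range (A k) then In i k else 0)" for k i j
  define proj where "proj k i j = (if i = j \<and> i \<in> tw_range (A k) then Pr i k else 0)" for k i j
  note AO = graded_objects_ob[OF A]
  have inc: "inc k \<in> pretr_hom C (A k) S 0" if k: "k < r" for k
    using In[OF k] sub[OF k] AO[OF k] So
    by (intro pretr_homI) (auto simp: inc_def obS simp flip: obA)
  have proj: "proj k \<in> pretr_hom C S (A k) 0" if k: "k < r" for k
    using Pr[OF k] sub[OF k] AO[OF k] So
    by (intro pretr_homI) (auto simp: proj_def obS simp flip: obA)
  have dinc: "graded_dif C (A k) S 0 (inc k) = 0" if k: "k < r" for k
    using In[OF k] AO[OF k] So
    by (auto simp: fun_eq_iff graded_dif_def inc_def obS simp flip: obA)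
  have dproj: "graded_dif C S (A k) 0 (proj k) = 0" if k: "k < r" for k
    using Pr[OF k] AO[OF k] So
    by (auto simp: fun_eq_iff graded_dif_def proj_def obS simp flip: obA)
  have pi: "pretr_cmp C (A k) S (A l) 0 0 (proj l) (inc k) = (if k = l then pretr_id C (A k) else 0)"
    if k: "k < r" and l: "l < r" for k l
  proof (intro ext)
    fix i j
    show "pretr_cmp C (A k) S (A l) 0 0 (proj l) (inc k) i j
        = (if k = l then pretr_id C (A k) else 0) i j"
    proof (cases "i \<in> tw_range (A l) \<and> j \<in> tw_range (A k)")
      case True
      have "pretr_cmp C (A k) S (A l) 0 0 (proj l) (inc k) i j = (\<Sum>t\<in>tw_range S.
          DCmp C (tw_ob (A k) j) (tw_ob S t) (tw_ob (A l) i) (t - i) (j - t) (proj l i t) (inc k t j))"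
        using True by (simp add: pretr_cmp_def)
      also have "\<dots> = (\<Sum>t\<in>tw_range S. if t = i then if i = j then DCmp C (ob i k) (So i) (ob i l) 0 0 (Pr i l) (In i k) else 0
            else 0)"
      proof (intro sum.cong refl)
        fix t assume t: "t \<in> tw_range S"
        have In': "In j k \<in> DHom C (tw_ob (A k) j) (So j) 0" using In(1)[OF k, of j] True by (simp add: obA)
        have Pr': "Pr i l \<in> DHom C (So i) (tw_ob (A l) i) 0" using Pr(1)[OF l, of i] True by (simp add: obA)
        show "DCmp C (tw_ob (A k) j) (tw_ob S t) (tw_ob (A l) i) (t - i) (j - t) (proj l i t) (inc k t j)
          = (if t = i then if i = j then DCmp C (ob i k) (So i) (ob i l) 0 0 (Pr i l) (In i k) else 0
            else 0)"
          using True t So AO[OF k] AO[OF l] In' Pr'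
          by (cases "t = i"; cases "t = j") (auto simp: proj_def inc_def obS obA)
      qed
      also have "\<dots> = (if i = j then DCmp C (ob i k) (So i) (ob i l) 0 0 (Pr i l) (In i k) else 0)"
        using sub[OF l] True by simp
      also have "\<dots> = (if k = l then pretr_id C (A k) else 0) i j"
        using PI[OF k l, of i] True obA[of j k] by (auto simp: pretr_id_def)
      finally show ?thesis .
    qed (auto simp: pretr_cmp_def pretr_id_def)
  qed
  have ip: "(\<Sum>k<r. pretr_cmp C S (A k) S 0 0 (inc k) (proj k)) = pretr_id C S"
  proof (intro ext)
    fix i j
    show "(\<Sum>k<r. pretr_cmp C S (A k) S 0 0 (inc k) (proj k)) i j = pretr_id C S i j"
    proof (cases "i \<in> tw_range S \<and> j \<in> tw_range S")
      case True
      have "pretr_cmp C S (A k) S 0 0 (inc k) (proj k) i j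
          = (if i = j then DCmp C (So i) (ob i k) (So i) 0 0 (In i k) (Pr i k) else 0)"
        if k: "k < r" for k
      proof -
        have "pretr_cmp C S (A k) S 0 0 (inc k) (proj k) i j = (\<Sum>t\<in>tw_range (A k).
            DCmp C (tw_ob S j) (tw_ob (A k) t) (tw_ob S i) (t - i) (j - t) (inc k i t) (proj k t j))"
          using True by (simp add: pretr_cmp_def)
        also have "\<dots> = (\<Sum>t\<in>tw_range (A k). if t = i then if i = j then
                DCmp C (So i) (ob i k) (So i) 0 0 (In i k) (Pr i k) else 0 else 0)"
        proof (intro sum.cong refl)
          fix t assume t: "t \<in> tw_range (A k)"
          have In': "In t k \<in> DHom C (tw_ob (A k) t) (So t) 0" using In(1)[OF k, of t] t by (simp add: obA)
          have Pr': "Pr t k \<in> DHom C (So t) (tw_ob (A k) t) 0" using Pr(1)[OF k, of t] t by (simp add: obA)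
          show "DCmp C (tw_ob S j) (tw_ob (A k) t) (tw_ob S i) (t - i) (j - t) (inc k i t) (proj k t j)
            = (if t = i then if i = j then
                DCmp C (So i) (ob i k) (So i) 0 0 (In i k) (Pr i k) else 0 else 0)"
            using True t So AO[OF k] In' Pr'
            by (cases "t = i"; cases "t = j") (auto simp: proj_def inc_def obS obA)
        qed
        also have "\<dots> = (if i = j then DCmp C (So i) (ob i k) (So i) 0 0 (In i k) (Pr i k) else 0)"
        proof (cases "i \<in> tw_range (A k)")
          case False
          then have "ob i k = Z" by (auto simp: ob_def)
          moreover have "Pr i k = 0"
            using id_left[OF So ob[OF k] Pr(1)[OF k], of i] Z Pr(1)[OF k, of i] So \<open>ob i k = Z\<close> by simp
          ultimately have "DCmp C (So i) (ob i k) (So i) 0 0 (In i k) (Pr i k) = 0"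
            using In(1)[OF k, of i] So Z by simp
          then show ?thesis using False by auto
        qed simp
        finally show ?thesis .
      qed
      then have "(\<Sum>k<r. pretr_cmp C S (A k) S 0 0 (inc k) (proj k)) i j
          = (if i = j then \<Sum>k<r. DCmp C (So i) (ob i k) (So i) 0 0 (In i k) (Pr i k) else 0)"
        by (simp add: sum_apply)
      then show ?thesis using True by (simp add: IP pretr_id_def obS)
    qed (auto simp: sum_apply pretr_cmp_def pretr_id_def)
  qed
  show ?thesis
    using S inc dinc proj dproj pi ip by (intro bexI[of _ S] exI[of _ inc] exI[of _ proj]) simp_all
qed

theorem graded_dg_category: "dg_category (graded_cat C)"
proof (unfold_locales, unfold graded_cat_simps)
  fix E F assume "E \<in> graded_objects C" "F \<in> graded_objects C"
  then show "cochain_complex (pretr_hom C E F) (graded_dif C E F)"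
    unfolding cochain_complex_def
    by (auto simp: graded_hom_subgroup graded_dif_closed graded_dif_add graded_dif_square)
qed (simp_all only: pretr_cmp_closed pretr_cmp_add_left pretr_cmp_add_right pretr_cmp_assoc
    pretr_id_closed graded_dif_id pretr_id_left pretr_id_right graded_dif_cmp graded_direct_sums)

end

section \<open>Parity of the sign exponents\<close>

lemma sum_below:
  fixes F :: "nat \<Rightarrow> nat \<Rightarrow> int"
  assumes "finite I"
  shows "(\<Sum>p\<in>I. \<Sum>i\<in>{i \<in> I. i < p}. F i p) = (\<Sum>i\<in>I. \<Sum>p\<in>I. if i < p then F i p else 0)"
proof -
  have "(\<Sum>p\<in>I. \<Sum>i\<in>{i \<in> I. i < p}. F i p) = (\<Sum>p\<in>I. \<Sum>i\<in>I. if i < p then F i p else 0)"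
    using assms by (intro sum.cong refl sum.inter_filter)
  also have "\<dots> = (\<Sum>i\<in>I. \<Sum>p\<in>I. if i < p then F i p else 0)"
    by (rule sum.swap)
  finally show ?thesis .
qed

lemma shuffle_exp_pairs:
  assumes "finite J"
  shows "shuffle_exp J \<pi> p = (\<Sum>x\<in>J. \<Sum>y\<in>J. if x < y \<and> \<pi> y < \<pi> x then p x * p y else 0)"
proof -
  have "{(a, b). a \<in> J \<and> b \<in> J \<and> a < b \<and> \<pi> b < \<pi> a}
      = {z \<in> J \<times> J. fst z < snd z \<and> \<pi> (snd z) < \<pi> (fst z)}" by auto
  then show ?thesis
    using assms by (simp add: shuffle_exp_def sum.inter_filter sum.cartesian_product case_prod_unfold)
qed

lemma pretr_exp_pairs:
  assumes "finite I" "finite J"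
  shows "pretr_exp J I \<pi> j \<kappa> n =
     (\<Sum>i\<in>I. \<Sum>p\<in>I. if i < p then
        j p * (n i - j i + (\<Sum>a\<in>fiber J \<pi> i. \<kappa> a)) + (\<Sum>a\<in>fiber J \<pi> i. \<kappa> a) * n p else 0)
     + (\<Sum>x\<in>J. \<Sum>y\<in>J. if x < y \<and> \<pi> y < \<pi> x then \<kappa> x * \<kappa> y else 0)"
  unfolding pretr_exp_def sum_below[OF assms(1)] shuffle_exp_pairs[OF assms(2)] ..

lemma assoc_exp_pairs:
  assumes "finite I" "finite J"
  shows "assoc_exp J I \<pi> n p =
     (\<Sum>i\<in>I. \<Sum>l\<in>I. if i < l then (\<Sum>j\<in>fiber J \<pi> i. p j) * n l else 0)
     + (\<Sum>x\<in>J. \<Sum>y\<in>J. if x < y \<and> \<pi> y < \<pi> x then p x * p y else 0)"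
  unfolding assoc_exp_def shuffle_exp_pairs[OF assms(2)] sum_distrib_right[of _ "{l \<in> I. l < _}"]
    sum_below[OF assms(1)] ..

lemma sum_fiber_pairs:
  fixes f g :: "nat \<Rightarrow> int"
  assumes s: "surjection J I \<pi>"
  shows "(\<Sum>i\<in>I. \<Sum>l\<in>I. if R i l then (\<Sum>x\<in>fiber J \<pi> i. f x) * (\<Sum>y\<in>fiber J \<pi> l. g y) else 0)
    = (\<Sum>x\<in>J. \<Sum>y\<in>J. if R (\<pi> x) (\<pi> y) then f x * g y else 0)"
proof -
  have "(\<Sum>x\<in>J. \<Sum>y\<in>J. if R (\<pi> x) (\<pi> y) then f x * g y else 0)
      = (\<Sum>i\<in>I. \<Sum>x\<in>fiber J \<pi> i. \<Sum>l\<in>I. \<Sum>y\<in>fiber J \<pi> l. if R (\<pi> x) (\<pi> y) then f x * g y else 0)"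
    by (simp add: sum_fibers[OF s])
  also have "\<dots> = (\<Sum>i\<in>I. \<Sum>x\<in>fiber J \<pi> i. \<Sum>l\<in>I. \<Sum>y\<in>fiber J \<pi> l. if R i l then f x * g y else 0)"
    by (intro sum.cong refl) (auto simp: fiber_def)
  also have "\<dots> = (\<Sum>i\<in>I. \<Sum>l\<in>I. \<Sum>x\<in>fiber J \<pi> i. \<Sum>y\<in>fiber J \<pi> l. if R i l then f x * g y else 0)"
    by (intro sum.cong refl sum.swap)
  also have "\<dots> = (\<Sum>i\<in>I. \<Sum>l\<in>I. if R i l then (\<Sum>x\<in>fiber J \<pi> i. f x) * (\<Sum>y\<in>fiber J \<pi> l. g y) else 0)"
    by (intro sum.cong refl) (simp add: sum_product)
  finally show ?thesis ..
qed

lemma sum_same_fiber_pairs: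
  fixes F :: "nat \<Rightarrow> nat \<Rightarrow> int"
  assumes s: "surjection J I \<pi>"
  shows "(\<Sum>i\<in>I. \<Sum>x\<in>fiber J \<pi> i. \<Sum>y\<in>fiber J \<pi> i. F x y)
    = (\<Sum>x\<in>J. \<Sum>y\<in>J. if \<pi> x = \<pi> y then F x y else 0)"
proof -
  have "(\<Sum>x\<in>J. \<Sum>y\<in>J. if \<pi> x = \<pi> y then F x y else 0)
      = (\<Sum>i\<in>I. \<Sum>x\<in>fiber J \<pi> i. \<Sum>y\<in>J. if \<pi> x = \<pi> y then F x y else 0)"
    by (simp add: sum_fibers[OF s])
  also have "\<dots> = (\<Sum>i\<in>I. \<Sum>x\<in>fiber J \<pi> i. \<Sum>y\<in>fiber J \<pi> i. F x y)"
  proof (rule sum.cong[OF refl], rule sum.cong[OF refl])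
    fix i x assume "x \<in> fiber J \<pi> i"
    then have "(\<Sum>y\<in>J. if \<pi> x = \<pi> y then F x y else 0) = (\<Sum>y\<in>J. if \<pi> y = i then F x y else 0)"
      by (intro sum.cong) (auto simp: fiber_def)
    then show "(\<Sum>y\<in>J. if \<pi> x = \<pi> y then F x y else 0) = (\<Sum>y\<in>fiber J \<pi> i. F x y)"
      using surjectionD(3)[OF s] by (simp add: fiber_def sum.inter_filter)
  qed
  finally show ?thesis ..
qed

lemma even_sum_pairs:
  fixes F :: "nat \<Rightarrow> nat \<Rightarrow> int"
  assumes "finite J" and "\<And>x. x \<in> J \<Longrightarrow> even (F x x)"
    and "\<And>x y. x \<in> J \<Longrightarrow> y \<in> J \<Longrightarrow> x < y \<Longrightarrow> even (F x y + F y x)"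
  shows "even (\<Sum>x\<in>J. \<Sum>y\<in>J. F x y)"
  using assms(2,3) by (subst sum_pairs_split[OF assms(1)]) (intro dvd_add dvd_sum, auto)

lemma fiber_compose:
  assumes "surjection J I \<pi>" "surjection K J \<rho>"
  shows "(\<Sum>u\<in>fiber K (compose K \<pi> \<rho>) i. c u) = (\<Sum>j\<in>fiber J \<pi> i. \<Sum>u\<in>fiber K \<rho> j. (c u :: int))"
proof -
  have "\<rho> ` fiber K (compose K \<pi> \<rho>) i \<subseteq> fiber J \<pi> i"
    using surjectionD(7)[OF assms(2)] by (auto simp: fiber_def compose_def)
  moreover have "finite (fiber K (compose K \<pi> \<rho>) i)" "finite (fiber J \<pi> i)"
    using surjectionD(3)[OF assms(1)] surjectionD(3)[OF assms(2)] by (auto simp: fiber_def)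
  ultimately have "(\<Sum>j\<in>fiber J \<pi> i. \<Sum>u\<in>{u \<in> fiber K (compose K \<pi> \<rho>) i. \<rho> u = j}. c u)
      = (\<Sum>u\<in>fiber K (compose K \<pi> \<rho>) i. c u)" by (intro sum.group)
  moreover have "{u \<in> fiber K (compose K \<pi> \<rho>) i. \<rho> u = j} = fiber K \<rho> j" if "j \<in> fiber J \<pi> i" for j
    using that by (auto simp: fiber_def compose_def)
  ultimately show ?thesis by simp
qed

lemma fiber_restrict:
  assumes "j \<in> fiber J \<pi> i"
  shows "fiber (fiber K (compose K \<pi> \<rho>) i) (restrict \<rho> (fiber K (compose K \<pi> \<rho>) i)) j = fiber K \<rho> j"
  using assms by (auto simp: fiber_def compose_def)

text \<open>Every exponent is a sum over pairs; pairs in \<open>I\<close> are resolved into pairs in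
  \<open>J\<close> along \<open>\<pi>\<close>, and what remains of these into pairs in \<open>K\<close> along \<open>\<rho>\<close>.\<close>

lemma pretr_exp_assoc:
  fixes K J I \<rho> \<pi> and a b c n p :: "nat \<Rightarrow> int"
  assumes sr: "surjection K J \<rho>" and sp: "surjection J I \<pi>"
  defines "\<sigma> \<equiv> compose K \<pi> \<rho>"
  shows "even (pretr_exp K I \<sigma> a c (\<lambda>i\<in>I. n i + (\<Sum>j\<in>fiber J \<pi> i. p j))
    + (\<Sum>i\<in>I. pretr_exp (fiber K \<sigma> i) (fiber J \<pi> i) (restrict \<rho> (fiber K \<sigma> i))
        (restrict b (fiber J \<pi> i)) (restrict c (fiber K \<sigma> i)) (restrict p (fiber J \<pi> i)))
    + assoc_exp J I \<pi> (\<lambda>i\<in>I. n i - a i + (\<Sum>j\<in>fiber J \<pi> i. b j))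
        (\<lambda>j\<in>J. p j - b j + (\<Sum>u\<in>fiber K \<rho> j. c u))
    + pretr_exp K J \<rho> b c p + pretr_exp J I \<pi> a b n + assoc_exp J I \<pi> n p)"
proof -
  note fI = surjectionD(4)[OF sp] and fJ = surjectionD(3)[OF sp] and fK = surjectionD(3)[OF sr]
  note ss = surjection_compose[OF sr sp, folded \<sigma>_def]
  define C where "C j = (\<Sum>u\<in>fiber K \<rho> j. c u)" for j
  define q where "q j = p j - b j + C j" for j
  define sB where "sB i = (\<Sum>j\<in>fiber J \<pi> i. b j)" for i
  define sP where "sP i = (\<Sum>j\<in>fiber J \<pi> i. p j)" for i
  define sC where "sC i = (\<Sum>j\<in>fiber J \<pi> i. C j)" for i
  \<comment> \<open>The summand of \<open>pretr_exp K J \<rho> b c p\<close> for a pair \<open>x < y\<close>.\<close>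
  define T where "T x y = b y * (p x - b x + C x) + C x * p y" for x y
  define inv where "inv w = (\<Sum>x\<in>J. \<Sum>y\<in>J. if x < y \<and> \<pi> y < \<pi> x then w x * w y else 0)"
    for w :: "nat \<Rightarrow> int"
  have finF: "finite (fiber J \<pi> i)" "finite (fiber K \<sigma> i)" for i
    using fJ fK by (auto intro: finite_subset[OF fiber_subset])
  have Csum: "(\<Sum>u\<in>fiber K \<sigma> i. c u) = sC i" for i
    unfolding \<sigma>_def sC_def C_def by (rule fiber_compose[OF sp sr])
  have e1: "pretr_exp K I \<sigma> a c (\<lambda>i\<in>I. n i + (\<Sum>j\<in>fiber J \<pi> i. p j))
    = (\<Sum>i\<in>I. \<Sum>l\<in>I. if i < l then a l * (n i + sP i - a i + sC i) + sC i * (n l + sP l) else 0)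
      + (\<Sum>u\<in>K. \<Sum>v\<in>K. if u < v \<and> \<sigma> v < \<sigma> u then c u * c v else 0)"
    unfolding pretr_exp_pairs[OF fI fK] Csum
    by (intro arg_cong2[where f = "(+)"] sum.cong refl) (auto simp: sP_def)
  have e2: "(\<Sum>i\<in>I. pretr_exp (fiber K \<sigma> i) (fiber J \<pi> i) (restrict \<rho> (fiber K \<sigma> i))
        (restrict b (fiber J \<pi> i)) (restrict c (fiber K \<sigma> i)) (restrict p (fiber J \<pi> i)))
    = (\<Sum>x\<in>J. \<Sum>y\<in>J. if \<pi> x = \<pi> y then if x < y then T x y else 0 else 0)
      + (\<Sum>u\<in>K. \<Sum>v\<in>K. if \<sigma> u = \<sigma> v then if u < v \<and> \<rho> v < \<rho> u then c u * c v else 0 else 0)"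
  proof -
    have "pretr_exp (fiber K \<sigma> i) (fiber J \<pi> i) (restrict \<rho> (fiber K \<sigma> i))
        (restrict b (fiber J \<pi> i)) (restrict c (fiber K \<sigma> i)) (restrict p (fiber J \<pi> i))
      = (\<Sum>x\<in>fiber J \<pi> i. \<Sum>y\<in>fiber J \<pi> i. if x < y then T x y else 0)
        + (\<Sum>u\<in>fiber K \<sigma> i. \<Sum>v\<in>fiber K \<sigma> i. if u < v \<and> \<rho> v < \<rho> u then c u * c v else 0)" for i
    proof -
      have "(\<Sum>u\<in>fiber (fiber K \<sigma> i) (restrict \<rho> (fiber K \<sigma> i)) x. restrict c (fiber K \<sigma> i) u) = C x"
        if "x \<in> fiber J \<pi> i" for x
      proof -
        have "fiber K \<rho> x \<subseteq> fiber K \<sigma> i"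
          using fiber_restrict[OF that, of K \<rho>] fiber_subset[of "fiber K \<sigma> i"] unfolding \<sigma>_def by metis
        then show ?thesis
          unfolding fiber_restrict[OF that, of K \<rho>, folded \<sigma>_def] C_def by (intro sum.cong) auto
      qed
      then show ?thesis
        unfolding pretr_exp_pairs[OF finF] T_def
        by (intro arg_cong2[where f = "(+)"] sum.cong refl) auto
    qed
    then show ?thesis
      by (simp only: sum.distrib sum_same_fiber_pairs[OF sp] sum_same_fiber_pairs[OF ss])
  qed
  have e3: "assoc_exp J I \<pi> (\<lambda>i\<in>I. n i - a i + (\<Sum>j\<in>fiber J \<pi> i. b j))
        (\<lambda>j\<in>J. p j - b j + (\<Sum>u\<in>fiber K \<rho> j. c u))
    = (\<Sum>i\<in>I. \<Sum>l\<in>I. if i < l then (sP i - sB i + sC i) * (n l - a l + sB l) else 0) + inv q"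
  proof -
    have "(\<Sum>j\<in>fiber J \<pi> i. (\<lambda>j\<in>J. p j - b j + (\<Sum>u\<in>fiber K \<rho> j. c u)) j) = sP i - sB i + sC i" for i
    proof -
      have "(\<Sum>j\<in>fiber J \<pi> i. (\<lambda>j\<in>J. p j - b j + (\<Sum>u\<in>fiber K \<rho> j. c u)) j)
          = (\<Sum>j\<in>fiber J \<pi> i. p j - b j + C j)"
        by (intro sum.cong) (auto simp: fiber_def C_def)
      then show ?thesis by (simp add: sum.distrib sum_subtractf sP_def sB_def sC_def)
    qed
    then show ?thesis
      unfolding assoc_exp_pairs[OF fI fJ] inv_def
      by (intro arg_cong2[where f = "(+)"] sum.cong refl) (auto simp: sB_def q_def C_def)
  qed
  have e4: "pretr_exp K J \<rho> b c p = (\<Sum>x\<in>J. \<Sum>y\<in>J. if x < y then T x y else 0)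
      + (\<Sum>u\<in>K. \<Sum>v\<in>K. if u < v \<and> \<rho> v < \<rho> u then c u * c v else 0)"
    unfolding pretr_exp_pairs[OF fJ fK] T_def C_def ..
  have e5: "pretr_exp J I \<pi> a b n
    = (\<Sum>i\<in>I. \<Sum>l\<in>I. if i < l then a l * (n i - a i + sB i) + sB i * n l else 0) + inv b"
    unfolding pretr_exp_pairs[OF fI fJ] sB_def inv_def ..
  have e6: "assoc_exp J I \<pi> n p = (\<Sum>i\<in>I. \<Sum>l\<in>I. if i < l then sP i * n l else 0) + inv p"
    unfolding assoc_exp_pairs[OF fI fJ] sP_def inv_def ..
  \<comment> \<open>Pairs in \<open>I\<close>: modulo \<open>2\<close> they give the sum of \<open>T\<close> over the pairs of \<open>J\<close> in different fibers.\<close>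
  have pI: "even ((\<Sum>i\<in>I. \<Sum>l\<in>I. if i < l then a l * (n i + sP i - a i + sC i) + sC i * (n l + sP l) else 0)
      + (\<Sum>i\<in>I. \<Sum>l\<in>I. if i < l then (sP i - sB i + sC i) * (n l - a l + sB l) else 0)
      + (\<Sum>i\<in>I. \<Sum>l\<in>I. if i < l then a l * (n i - a i + sB i) + sB i * n l else 0)
      + (\<Sum>i\<in>I. \<Sum>l\<in>I. if i < l then sP i * n l else 0)
      - (\<Sum>x\<in>J. \<Sum>y\<in>J. if \<pi> x < \<pi> y then T x y else 0))"
  proof -
    have "(\<Sum>x\<in>J. \<Sum>y\<in>J. if \<pi> x < \<pi> y then T x y else 0)
      = (\<Sum>x\<in>J. \<Sum>y\<in>J. (if \<pi> x < \<pi> y then (p x - b x + C x) * b y else 0)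
          + (if \<pi> x < \<pi> y then C x * p y else 0))"
      by (intro sum.cong refl) (auto simp: T_def algebra_simps)
    also have "\<dots> = (\<Sum>i\<in>I. \<Sum>l\<in>I. if i < l then (sP i - sB i + sC i) * sB l else 0)
        + (\<Sum>i\<in>I. \<Sum>l\<in>I. if i < l then sC i * sP l else 0)"
    proof -
      have 1: "(\<Sum>j\<in>fiber J \<pi> i. p j - b j + C j) = sP i - sB i + sC i" for i
        by (simp add: sum.distrib sum_subtractf sP_def sB_def sC_def)
      have 2: "(\<Sum>j\<in>fiber J \<pi> i. b j) = sB i" "(\<Sum>j\<in>fiber J \<pi> i. p j) = sP i"
        "(\<Sum>j\<in>fiber J \<pi> i. C j) = sC i" for i by (simp_all add: sB_def sP_def sC_def)
      show ?thesis
        using sum_fiber_pairs[OF sp, of "(<)" "\<lambda>x. p x - b x + C x" b, unfolded 1 2]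
          sum_fiber_pairs[OF sp, of "(<)" C p, unfolded 2]
        by (simp only: sum.distrib)
    qed
    finally have T: "(\<Sum>x\<in>J. \<Sum>y\<in>J. if \<pi> x < \<pi> y then T x y else 0)
      = (\<Sum>i\<in>I. \<Sum>l\<in>I. if i < l then (sP i - sB i + sC i) * sB l else 0)
        + (\<Sum>i\<in>I. \<Sum>l\<in>I. if i < l then sC i * sP l else 0)" .
    show ?thesis
      unfolding T sum.distrib[symmetric] sum_subtractf[symmetric]
    proof (intro dvd_sum)
      fix i l
      have e: "a l * (n i + sP i - a i + sC i) + sC i * (n l + sP l) + (sP i - sB i + sC i) * (n l - a l + sB l)
          + (a l * (n i - a i + sB i) + sB i * n l) + sP i * n l
          - ((sP i - sB i + sC i) * sB l + sC i * sP l)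
        = 2 * (a l * n i - a l * a i + sC i * n l + sP i * n l + sB i * a l)"
        by (simp add: algebra_simps)
      show "even ((if i < l then a l * (n i + sP i - a i + sC i) + sC i * (n l + sP l) else 0)
        + (if i < l then (sP i - sB i + sC i) * (n l - a l + sB l) else 0)
        + (if i < l then a l * (n i - a i + sB i) + sB i * n l else 0)
        + (if i < l then sP i * n l else 0)
        - ((if i < l then (sP i - sB i + sC i) * sB l else 0) + (if i < l then sC i * sP l else 0)))"
      proof (cases "i < l")
        case True
        show ?thesis unfolding if_P[OF True] e by (rule dvd_triv_left)
      qed simp
    qed
  qed
  \<comment> \<open>Pairs in \<open>J\<close>: modulo \<open>2\<close> only the products \<open>C x * C y\<close> over the inversions of \<open>\<pi>\<close> remain.\<close>
  have pJ: "even ((\<Sum>x\<in>J. \<Sum>y\<in>J. if \<pi> x < \<pi> y then T x y else 0)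
      + (\<Sum>x\<in>J. \<Sum>y\<in>J. if \<pi> x = \<pi> y then if x < y then T x y else 0 else 0)
      + (\<Sum>x\<in>J. \<Sum>y\<in>J. if x < y then T x y else 0) + inv q + inv b + inv p - inv C)"
    unfolding inv_def sum.distrib[symmetric] sum_subtractf[symmetric]
  proof (rule even_sum_pairs[OF fJ])
    fix x y :: nat assume xy: "x < y"
    have e: "T x y + T y x + q x * q y + b x * b y + p x * p y - C x * C y
        = 2 * (C x * p y + C y * p x + p x * p y)"
      by (simp add: T_def q_def algebra_simps)
    show "even ((if \<pi> x < \<pi> y then T x y else 0)
        + (if \<pi> x = \<pi> y then if x < y then T x y else 0 else 0) + (if x < y then T x y else 0)
        + (if x < y \<and> \<pi> y < \<pi> x then q x * q y else 0)
        + (if x < y \<and> \<pi> y < \<pi> x then b x * b y else 0)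
        + (if x < y \<and> \<pi> y < \<pi> x then p x * p y else 0)
        - (if x < y \<and> \<pi> y < \<pi> x then C x * C y else 0)
        + ((if \<pi> y < \<pi> x then T y x else 0)
        + (if \<pi> y = \<pi> x then if y < x then T y x else 0 else 0) + (if y < x then T y x else 0)
        + (if y < x \<and> \<pi> x < \<pi> y then q y * q x else 0)
        + (if y < x \<and> \<pi> x < \<pi> y then b y * b x else 0)
        + (if y < x \<and> \<pi> x < \<pi> y then p y * p x else 0)
        - (if y < x \<and> \<pi> x < \<pi> y then C y * C x else 0)))"
      (is "even ?E")
    proof (cases "\<pi> x" "\<pi> y" rule: linorder_cases)
      case greater
      then have "?E = T x y + T y x + q x * q y + b x * b y + p x * p y - C x * C y"
        using xy by simp
      then show ?thesis unfolding e by simp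
    qed (use xy in auto)
  qed auto
  \<comment> \<open>Pairs in \<open>K\<close>: as inversions of \<open>\<sigma>\<close>, of \<open>\<rho>\<close> or of \<open>\<pi>\<close>, they are counted an even number of times.\<close>
  have pK: "even ((\<Sum>u\<in>K. \<Sum>v\<in>K. if u < v \<and> \<sigma> v < \<sigma> u then c u * c v else 0)
      + (\<Sum>u\<in>K. \<Sum>v\<in>K. if \<sigma> u = \<sigma> v then if u < v \<and> \<rho> v < \<rho> u then c u * c v else 0 else 0)
      + (\<Sum>u\<in>K. \<Sum>v\<in>K. if u < v \<and> \<rho> v < \<rho> u then c u * c v else 0) + inv C)"
  proof -
    have "inv C = (\<Sum>u\<in>K. \<Sum>v\<in>K. if \<rho> u < \<rho> v \<and> \<pi> (\<rho> v) < \<pi> (\<rho> u) then c u * c v else 0)"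
      unfolding inv_def C_def by (rule sum_fiber_pairs[OF sr])
    also have "\<dots> = (\<Sum>u\<in>K. \<Sum>v\<in>K. if \<rho> u < \<rho> v \<and> \<sigma> v < \<sigma> u then c u * c v else 0)"
      by (intro sum.cong) (auto simp: \<sigma>_def compose_def)
    finally have C: "inv C = (\<Sum>u\<in>K. \<Sum>v\<in>K. if \<rho> u < \<rho> v \<and> \<sigma> v < \<sigma> u then c u * c v else 0)" .
    show ?thesis
      unfolding C sum.distrib[symmetric]
    proof (rule even_sum_pairs[OF fK])
      fix u v assume uv: "u \<in> K" "v \<in> K" "u < v"
      have "\<sigma> u = \<sigma> v" if "\<rho> u = \<rho> v" using uv that by (simp add: \<sigma>_def compose_def)
      then show "even ((if u < v \<and> \<sigma> v < \<sigma> u then c u * c v else 0)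
        + (if \<sigma> u = \<sigma> v then if u < v \<and> \<rho> v < \<rho> u then c u * c v else 0 else 0)
        + (if u < v \<and> \<rho> v < \<rho> u then c u * c v else 0)
        + (if \<rho> u < \<rho> v \<and> \<sigma> v < \<sigma> u then c u * c v else 0)
        + ((if v < u \<and> \<sigma> u < \<sigma> v then c v * c u else 0)
        + (if \<sigma> v = \<sigma> u then if v < u \<and> \<rho> u < \<rho> v then c v * c u else 0 else 0)
        + (if v < u \<and> \<rho> u < \<rho> v then c v * c u else 0)
        + (if \<rho> v < \<rho> u \<and> \<sigma> u < \<sigma> v then c v * c u else 0)))"
        using uv(3)
        by (cases "\<rho> u" "\<rho> v" rule: linorder_cases; cases "\<sigma> u" "\<sigma> v" rule: linorder_cases)
          (auto simp: algebra_simps)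
    qed auto
  qed
  show ?thesis
    unfolding e1 e2 e3 e4 e5 e6
    by (rule back_subst[of even, OF dvd_add[OF dvd_add[OF pI pJ] pK]]) linarith
qed

text \<open>How the sign of a composite changes when a differential, of degree \<open>1\<close>, is applied to the inner
  operation \<open>i\<close>.\<close>

lemma pretr_exp_add_1:
  assumes fin: "finite I" "finite J" and i: "i \<in> I"
  shows "pretr_exp J I \<pi> j \<kappa> (n(i := n i + 1)) = pretr_exp J I \<pi> j \<kappa> n
    + (\<Sum>l\<in>{l \<in> I. i < l}. j l) + (\<Sum>l\<in>{l \<in> I. l < i}. \<Sum>a\<in>fiber J \<pi> l. \<kappa> a)"
proof -
  let ?B = "\<lambda>l. \<Sum>a\<in>fiber J \<pi> l. \<kappa> a"
  have "(\<Sum>l\<in>I. \<Sum>p\<in>I. if l < p then j p * ((n(i := n i + 1)) l - j l + ?B l) + ?B l * (n(i := n i + 1)) p else 0)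
    = (\<Sum>l\<in>I. \<Sum>p\<in>I. (if l < p then j p * (n l - j l + ?B l) + ?B l * n p else 0)
        + (if l = i then if i < p then j p else 0 else 0) + (if p = i then if l < i then ?B l else 0 else 0))"
    by (intro sum.cong refl) (auto simp: algebra_simps)
  also have "\<dots> = (\<Sum>l\<in>I. \<Sum>p\<in>I. if l < p then j p * (n l - j l + ?B l) + ?B l * n p else 0)
      + (\<Sum>l\<in>I. \<Sum>p\<in>I. if l = i then if i < p then j p else 0 else 0)
      + (\<Sum>l\<in>I. \<Sum>p\<in>I. if p = i then if l < i then ?B l else 0 else 0)"
    by (simp only: sum.distrib)
  also have "(\<Sum>l\<in>I. \<Sum>p\<in>I. if l = i then if i < p then j p else 0 else 0) = (\<Sum>l\<in>{l \<in> I. i < l}. j l)"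
    using fin i by (subst sum.swap) (simp add: sum.inter_filter)
  also have "(\<Sum>l\<in>I. \<Sum>p\<in>I. if p = i then if l < i then ?B l else 0 else 0) = (\<Sum>l\<in>{l \<in> I. l < i}. ?B l)"
    using fin i by (simp add: sum.inter_filter)
  finally show ?thesis unfolding pretr_exp_pairs[OF fin] by simp
qed

section \<open>Operations between graded objects\<close>

definition graded_tdif ::
    "('o, 'm, 'p::ab_group_add) pseudo_tensor \<Rightarrow> nat set \<Rightarrow> (nat \<Rightarrow> ('o, 'm) twisted) \<Rightarrow>
     ('o, 'm) twisted \<Rightarrow> int \<Rightarrow> (int \<Rightarrow> (nat \<Rightarrow> int) \<Rightarrow> 'p) \<Rightarrow> int \<Rightarrow> (nat \<Rightarrow> int) \<Rightarrow> 'p" where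
  "graded_tdif P I E F n \<phi> = (\<lambda>k j. if k \<in> tw_range F \<and> j \<in> multi_range I E
     then ksign k (TDif P I (obs_at I E j) (tw_ob F k) (n - k + (\<Sum>i\<in>I. j i)) (\<phi> k j)) else 0)"

definition graded_tensor ::
    "('o, 'm::ab_group_add) dg_cat \<Rightarrow> ('o, 'm, 'p::ab_group_add) pseudo_tensor \<Rightarrow>
     (('o, 'm) twisted, int \<Rightarrow> int \<Rightarrow> 'm, int \<Rightarrow> (nat \<Rightarrow> int) \<Rightarrow> 'p) pseudo_tensor" where
  "graded_tensor C P = (pretr_pseudo_tensor C P)\<lparr>TDif := graded_tdif P\<rparr>"

lemma graded_tensor_simps [simp]:
  "TOp (graded_tensor C P) = pretr_op P" "TDif (graded_tensor C P) = graded_tdif P"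
  "TCmp (graded_tensor C P) = pretr_op_cmp P" "TOne (graded_tensor C P) = pretr_one P"
  by (simp_all add: graded_tensor_def pretr_pseudo_tensor_def)

text \<open>The signs are pulled out of one slot after the other.\<close>

lemma multiadditive_ksign:
  fixes \<Phi> :: "('i \<Rightarrow> 'a::ab_group_add) \<Rightarrow> 'b::ab_group_add"
  assumes fin: "finite I" and sub: "\<And>i. i \<in> I \<Longrightarrow> additive_subgroup (A i)"
    and add: "\<And>g i x y. g \<in> PiE I A \<Longrightarrow> i \<in> I \<Longrightarrow> x \<in> A i \<Longrightarrow> y \<in> A i \<Longrightarrow>
                \<Phi> (g(i := x + y)) = \<Phi> (g(i := x)) + \<Phi> (g(i := y))"
    and g: "g \<in> PiE I A"
  shows "\<Phi> (\<lambda>i\<in>I. ksign (s i) (g i)) = ksign (\<Sum>i\<in>I. s i) (\<Phi> g)"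
proof -
  have "S \<subseteq> I \<Longrightarrow> \<Phi> (\<lambda>i\<in>I. if i \<in> S then ksign (s i) (g i) else g i) = ksign (\<Sum>i\<in>S. s i) (\<Phi> g)"
    if "finite S" for S
    using that
  proof (induction S rule: finite_induct)
    case empty
    have "(\<lambda>i\<in>I. g i) = g" using g by (auto simp: PiE_iff extensional_restrict)
    then show ?case by simp
  next
    case (insert x S)
    define g' where "g' = (\<lambda>i\<in>I. if i \<in> S then ksign (s i) (g i) else g i)"
    have x: "x \<in> I" and S: "S \<subseteq> I" using insert.prems by auto
    have g': "g' \<in> PiE I A" unfolding g'_def using g sub by (auto simp: PiE_iff subgroup_ksign)
    have slot: "additive_on (A x) (\<lambda>y. \<Phi> (g'(x := y)))"
      unfolding additive_on_def using sub[OF x] add[OF g' x] by auto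
    have "(\<lambda>i\<in>I. if i \<in> insert x S then ksign (s i) (g i) else g i) = g'(x := ksign (s x) (g x))"
      unfolding g'_def using x by (auto simp: fun_eq_iff)
    moreover have "\<Phi> (g'(x := ksign (s x) (g x))) = ksign (s x) (\<Phi> (g'(x := g x)))"
      using x g by (intro additive_on_ksign[OF slot]) auto
    moreover have "g'(x := g x) = g'" unfolding g'_def using x insert.hyps by (auto simp: fun_eq_iff)
    ultimately have "\<Phi> (\<lambda>i\<in>I. if i \<in> insert x S then ksign (s i) (g i) else g i) = ksign (s x) (\<Phi> g')"
      by (simp only:)
    also have "\<Phi> g' = ksign (\<Sum>i\<in>S. s i) (\<Phi> g)" unfolding g'_def by (rule insert.IH[OF S])
    finally show ?case using insert.hyps by simp
  qed
  from this[OF fin] show ?thesis by (simp cong: restrict_cong)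
qed

lemma multi_range_mem: "j \<in> multi_range I E \<Longrightarrow> i \<in> I \<Longrightarrow> j i \<in> tw_range (E i)"
  unfolding multi_range_def by blast

lemma multi_range_ext: "j \<in> multi_range I E \<Longrightarrow> j \<in> extensional I"
  by (simp add: multi_range_def PiE_iff)

lemma finite_multi_range: "finite I \<Longrightarrow> finite (multi_range I E)"
  unfolding multi_range_def by (intro finite_PiE) auto

lemma multi_range_restrict:
  assumes "\<kappa> \<in> multi_range J H" "F \<subseteq> J"
  shows "restrict \<kappa> F \<in> multi_range F (restrict H F)"
  using multi_range_mem[OF assms(1)] assms(2) unfolding multi_range_def
  by (intro PiE_I) (simp_all add: subset_iff)

lemma obs_at_restrict:
  "F \<subseteq> J \<Longrightarrow> obs_at F (restrict H F) (restrict \<kappa> F) = restrict (obs_at J H \<kappa>) F"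
  by (auto simp: obs_at_def fun_eq_iff)

lemma obs_at_family:
  assumes "E \<in> I \<rightarrow>\<^sub>E graded_objects C" "j \<in> multi_range I E"
  shows "obs_at I E j \<in> I \<rightarrow>\<^sub>E DOb C"
proof (rule PiE_I)
  fix i assume i: "i \<in> I"
  then show "obs_at I E j i \<in> DOb C"
    using graded_objects_ob[OF PiE_mem[OF assms(1) i] multi_range_mem[OF assms(2) i]]
    by (simp add: obs_at_def)
qed (simp add: obs_at_def)

lemma multi_range_singleton: "(\<lambda>_\<in>{i}. b) \<in> multi_range {i} (\<lambda>_\<in>{i}. E) \<longleftrightarrow> b \<in> tw_range E"
  by (simp add: multi_range_def PiE_iff)

lemma multi_range_singletonE:
  assumes "j \<in> multi_range {i} (\<lambda>_\<in>{i}. E)"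
  shows "j = (\<lambda>_\<in>{i}. j i)" "j i \<in> tw_range E"
  using assms by (auto simp: multi_range_def PiE_iff extensional_def)

lemma sum_multi_range_singleton:
  "(\<Sum>j\<in>multi_range {i} (\<lambda>_\<in>{i}. E). G j) = (\<Sum>b\<in>tw_range E. G (\<lambda>_\<in>{i}. b))"
  by (rule sum.reindex_bij_witness[of _ "\<lambda>b. \<lambda>_\<in>{i}. b" "\<lambda>j. j i"])
    (auto simp: multi_range_singleton dest: multi_range_singletonE simp flip: multi_range_singletonE(1))

lemma pretr_exp_const [simp]: "pretr_exp J {i} (\<lambda>_\<in>J. i) j \<kappa> n = 0"
proof -
  have "{l \<in> {i}. l < i} = {}" by auto
  then show ?thesis by (auto simp: pretr_exp_def intro!: sum.neutral)
qed

lemma pretr_opI: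
  assumes "\<And>k j. k \<in> tw_range F \<Longrightarrow> j \<in> multi_range I E
      \<Longrightarrow> \<phi> k j \<in> TOp P I (obs_at I E j) (tw_ob F k) (n - k + (\<Sum>i\<in>I. j i))"
    and "\<And>k j. k \<notin> tw_range F \<or> j \<notin> multi_range I E \<Longrightarrow> \<phi> k j = 0"
  shows "\<phi> \<in> pretr_op P I E F n"
  unfolding pretr_op_def using assms by blast

lemma pretr_op_entry:
  "\<phi> \<in> pretr_op P I E F n \<Longrightarrow> k \<in> tw_range F \<Longrightarrow> j \<in> multi_range I E
    \<Longrightarrow> \<phi> k j \<in> TOp P I (obs_at I E j) (tw_ob F k) (n - k + (\<Sum>i\<in>I. j i))"
  unfolding pretr_op_def by blast

lemma pretr_op_outside:
  "\<phi> \<in> pretr_op P I E F n \<Longrightarrow> k \<notin> tw_range F \<or> j \<notin> multi_range I E \<Longrightarrow> \<phi> k j = 0"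
  unfolding pretr_op_def by blast

text \<open>In an iterated composite the intermediate multi-indices are chosen fiber by fiber; this bijection
  turns these choices into a single summation index.\<close>

lemma multi_range_fibers:
  assumes "surjection J I \<pi>"
  shows "bij_betw (\<lambda>b. \<lambda>i\<in>I. restrict b (fiber J \<pi> i)) (multi_range J X)
    (\<Pi>\<^sub>E i\<in>I. multi_range (fiber J \<pi> i) (restrict X (fiber J \<pi> i)))"
proof (rule bij_betw_byWitness[where f' = "\<lambda>B. \<lambda>j\<in>J. B (\<pi> j) j"])
  note sD = surjectionD[OF assms]
  show "\<forall>b\<in>multi_range J X. (\<lambda>j\<in>J. (\<lambda>i\<in>I. restrict b (fiber J \<pi> i)) (\<pi> j) j) = b"
  proof
    fix b assume "b \<in> multi_range J X"
    then have "b \<in> extensional J" by (rule multi_range_ext)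
    then show "(\<lambda>j\<in>J. (\<lambda>i\<in>I. restrict b (fiber J \<pi> i)) (\<pi> j) j) = b"
      using sD(7) by (auto simp: fun_eq_iff fiber_def extensional_def)
  qed
  show "\<forall>B\<in>\<Pi>\<^sub>E i\<in>I. multi_range (fiber J \<pi> i) (restrict X (fiber J \<pi> i)).
      (\<lambda>i\<in>I. restrict (\<lambda>j\<in>J. B (\<pi> j) j) (fiber J \<pi> i)) = B"
  proof
    fix B assume B: "B \<in> (\<Pi>\<^sub>E i\<in>I. multi_range (fiber J \<pi> i) (restrict X (fiber J \<pi> i)))"
    show "(\<lambda>i\<in>I. restrict (\<lambda>j\<in>J. B (\<pi> j) j) (fiber J \<pi> i)) = B"
    proof (rule ext)
      fix i
      show "(\<lambda>i\<in>I. restrict (\<lambda>j\<in>J. B (\<pi> j) j) (fiber J \<pi> i)) i = B i"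
      proof (cases "i \<in> I")
        case True
        then have "B i \<in> extensional (fiber J \<pi> i)" using B multi_range_ext by blast
        then show ?thesis using True by (auto simp: fun_eq_iff fiber_def extensional_def)
      next
        case False
        then show ?thesis using B by (simp add: PiE_iff extensional_def)
      qed
    qed
  qed
  show "(\<lambda>b. \<lambda>i\<in>I. restrict b (fiber J \<pi> i)) ` multi_range J X
      \<subseteq> (\<Pi>\<^sub>E i\<in>I. multi_range (fiber J \<pi> i) (restrict X (fiber J \<pi> i)))"
    using multi_range_restrict[OF _ fiber_subset] by (auto intro!: PiE_I)
  show "(\<lambda>B. \<lambda>j\<in>J. B (\<pi> j) j) ` (\<Pi>\<^sub>E i\<in>I. multi_range (fiber J \<pi> i) (restrict X (fiber J \<pi> i)))
      \<subseteq> multi_range J X"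
  proof (intro image_subsetI)
    fix B assume B: "B \<in> (\<Pi>\<^sub>E i\<in>I. multi_range (fiber J \<pi> i) (restrict X (fiber J \<pi> i)))"
    have "B (\<pi> j) j \<in> tw_range (X j)" if j: "j \<in> J" for j
    proof -
      have "j \<in> fiber J \<pi> (\<pi> j)" using j by (simp add: fiber_def)
      then show ?thesis
        using multi_range_mem[OF PiE_mem[OF B sD(7)[OF j]]] by fastforce
    qed
    then show "(\<lambda>j\<in>J. B (\<pi> j) j) \<in> multi_range J X"
      unfolding multi_range_def by (intro PiE_I) auto
  qed
qed

context pseudo_tensor_structure
begin

lemma pretr_op_subgroup:
  assumes "index_set I" "E \<in> I \<rightarrow>\<^sub>E graded_objects C" "F \<in> graded_objects C"
  shows "additive_subgroup (pretr_op P I E F n)"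
proof -
  have "additive_subgroup (TOp P I (obs_at I E j) (tw_ob F k) q)"
    if "j \<in> multi_range I E" "k \<in> tw_range F" for j k q
    using that assms by (intro op_subgroup obs_at_family graded_objects_ob)
  then show ?thesis
    unfolding additive_subgroup_def[of "pretr_op P I E F n"] unfolding pretr_op_def
    by (auto intro: subgroup_zero subgroup_add subgroup_minus)
qed

lemma graded_tdif_closed:
  assumes "index_set I" "E \<in> I \<rightarrow>\<^sub>E graded_objects C" "F \<in> graded_objects C" "\<phi> \<in> pretr_op P I E F n"
  shows "graded_tdif P I E F n \<phi> \<in> pretr_op P I E F (n + 1)"
proof (rule pretr_opI)
  fix k j assume kj: "k \<in> tw_range F" "j \<in> multi_range I E"
  note o = obs_at_family[OF assms(2) kj(2)] graded_objects_ob[OF assms(3) kj(1)]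
  have e: "n + 1 - k + (\<Sum>i\<in>I. j i) = n - k + (\<Sum>i\<in>I. j i) + 1" by simp
  have "ksign k (TDif P I (obs_at I E j) (tw_ob F k) (n - k + (\<Sum>i\<in>I. j i)) (\<phi> k j))
      \<in> TOp P I (obs_at I E j) (tw_ob F k) (n + 1 - k + (\<Sum>i\<in>I. j i))"
    unfolding e by (intro subgroup_ksign op_subgroup tdif_closed assms(1) o pretr_op_entry[OF assms(4) kj])
  then show "graded_tdif P I E F n \<phi> k j
      \<in> TOp P I (obs_at I E j) (tw_ob F k) (n + 1 - k + (\<Sum>i\<in>I. j i))"
    using kj by (simp add: graded_tdif_def)
qed (auto simp: graded_tdif_def)

lemma graded_tdif_add:
  assumes "index_set I" "E \<in> I \<rightarrow>\<^sub>E graded_objects C" "F \<in> graded_objects C"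
    "\<phi> \<in> pretr_op P I E F n" "\<psi> \<in> pretr_op P I E F n"
  shows "graded_tdif P I E F n (\<phi> + \<psi>) = graded_tdif P I E F n \<phi> + graded_tdif P I E F n \<psi>"
  using additive_on_add[OF tdif_additive[OF assms(1) obs_at_family[OF assms(2)] graded_objects_ob[OF assms(3)]]
      pretr_op_entry[OF assms(4)] pretr_op_entry[OF assms(5)]]
  by (auto simp: graded_tdif_def fun_eq_iff ksign_add)

lemma graded_tdif_square:
  assumes "index_set I" "E \<in> I \<rightarrow>\<^sub>E graded_objects C" "F \<in> graded_objects C" "\<phi> \<in> pretr_op P I E F n"
  shows "graded_tdif P I E F (n + 1) (graded_tdif P I E F n \<phi>) = 0"
proof (intro ext)
  fix k j
  show "graded_tdif P I E F (n + 1) (graded_tdif P I E F n \<phi>) k j = 0 k j"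
  proof (cases "k \<in> tw_range F \<and> j \<in> multi_range I E")
    case True
    then have kj: "k \<in> tw_range F" "j \<in> multi_range I E" by auto
    note o = obs_at_family[OF assms(2) kj(2)] graded_objects_ob[OF assms(3) kj(1)]
    note x = pretr_op_entry[OF assms(4) kj]
    let ?d = "TDif P I (obs_at I E j) (tw_ob F k)"
    have e: "n + 1 - k + (\<Sum>i\<in>I. j i) = n - k + (\<Sum>i\<in>I. j i) + 1" by simp
    have "graded_tdif P I E F (n + 1) (graded_tdif P I E F n \<phi>) k j
        = ksign k (?d (n - k + (\<Sum>i\<in>I. j i) + 1) (ksign k (?d (n - k + (\<Sum>i\<in>I. j i)) (\<phi> k j))))"
      using True unfolding e[symmetric] by (simp add: graded_tdif_def)
    also have "\<dots> = 0"
      using additive_on_ksign[OF tdif_additive[OF assms(1) o] tdif_closed[OF assms(1) o x]]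
        tdif_tdif[OF assms(1) o x] by simp
    finally show ?thesis by simp
  qed (auto simp: graded_tdif_def)
qed

lemma pretr_one_entry:
  assumes "A \<in> graded_objects C" "B \<in> graded_objects C" "u \<in> pretr_hom C A B q"
    and "k \<in> tw_range B" "b \<in> tw_range A"
  shows "pretr_one P i A B q u k (\<lambda>_\<in>{i}. b) = TOne P i (tw_ob A b) (tw_ob B k) (q + b - k) (u k b)"
  using assms by (simp add: pretr_one_def multi_range_singleton)

lemma obs_at_singleton: "obs_at {i} (\<lambda>_\<in>{i}. A) (\<lambda>_\<in>{i}. b) = (\<lambda>_\<in>{i}. tw_ob A b)"
  by (auto simp: obs_at_def)

lemma pretr_one_closed:
  assumes A: "A \<in> graded_objects C" and B: "B \<in> graded_objects C" and u: "u \<in> pretr_hom C A B q"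
  shows "pretr_one P i A B q u \<in> pretr_op P {i} (\<lambda>_\<in>{i}. A) B q"
proof (rule pretr_opI)
  fix k j assume k: "k \<in> tw_range B" and j: "j \<in> multi_range {i} (\<lambda>_\<in>{i}. A)"
  define b where "b = j i"
  have b: "b \<in> tw_range A" and jb: "j = (\<lambda>_\<in>{i}. b)"
    using multi_range_singletonE[OF j] by (auto simp: b_def)
  have e: "q - k + (\<Sum>a\<in>{i}. (\<lambda>_\<in>{i}. b) a) = q + b - k" by simp
  show "pretr_one P i A B q u k j
      \<in> TOp P {i} (obs_at {i} (\<lambda>_\<in>{i}. A) j) (tw_ob B k) (q - k + (\<Sum>i\<in>{i}. j i))"
    unfolding jb obs_at_singleton e pretr_one_entry[OF A B u k b]
    by (intro one_closed graded_objects_ob[OF A b] graded_objects_ob[OF B k] pretr_hom_entry[OF u k b])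
qed (auto simp: pretr_one_def)

lemma pretr_one_bij:
  assumes A: "A \<in> graded_objects C" and B: "B \<in> graded_objects C"
  shows "bij_betw (pretr_one P i A B q) (pretr_hom C A B q) (pretr_op P {i} (\<lambda>_\<in>{i}. A) B q)"
proof (rule bij_betw_imageI)
  note AO = graded_objects_ob[OF A] and BO = graded_objects_ob[OF B]
  let ?one = "\<lambda>k b. TOne P i (tw_ob A b) (tw_ob B k) (q + b - k)"
  note bij = one_bij[of _ _ i, unfolded bij_betw_def]
  show "inj_on (pretr_one P i A B q) (pretr_hom C A B q)"
  proof (rule inj_onI)
    fix u v assume u: "u \<in> pretr_hom C A B q" and v: "v \<in> pretr_hom C A B q"
      and eq: "pretr_one P i A B q u = pretr_one P i A B q v"
    show "u = v"
    proof (intro ext)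
      fix k b
      show "u k b = v k b"
      proof (cases "k \<in> tw_range B \<and> b \<in> tw_range A")
        case True
        then have kb: "k \<in> tw_range B" "b \<in> tw_range A" by auto
        have "?one k b (u k b) = ?one k b (v k b)"
          using fun_cong[OF fun_cong[OF eq], of k "\<lambda>_\<in>{i}. b"]
          by (simp only: pretr_one_entry[OF A B u kb] pretr_one_entry[OF A B v kb])
        then show ?thesis
          using bij[OF AO[OF kb(2)] BO[OF kb(1)]] pretr_hom_entry[OF u kb] pretr_hom_entry[OF v kb]
          by (auto dest: inj_onD)
      next
        case False
        then show ?thesis using pretr_hom_outside[OF u, of k b] pretr_hom_outside[OF v, of k b] by auto
      qed
    qed
  qed
  show "pretr_one P i A B q ` pretr_hom C A B q = pretr_op P {i} (\<lambda>_\<in>{i}. A) B q"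
  proof
    show "pretr_one P i A B q ` pretr_hom C A B q \<subseteq> pretr_op P {i} (\<lambda>_\<in>{i}. A) B q"
      using pretr_one_closed[OF A B] by auto
    show "pretr_op P {i} (\<lambda>_\<in>{i}. A) B q \<subseteq> pretr_one P i A B q ` pretr_hom C A B q"
    proof
      fix \<phi> assume \<phi>: "\<phi> \<in> pretr_op P {i} (\<lambda>_\<in>{i}. A) B q"
      define u where "u k b = (if k \<in> tw_range B \<and> b \<in> tw_range A then
          inv_into (DHom C (tw_ob A b) (tw_ob B k) (q + b - k)) (?one k b) (\<phi> k (\<lambda>_\<in>{i}. b)) else 0)"
        for k b
      have im: "\<phi> k (\<lambda>_\<in>{i}. b) \<in> ?one k b ` DHom C (tw_ob A b) (tw_ob B k) (q + b - k)"
        if kb: "k \<in> tw_range B" "b \<in> tw_range A" for k b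
      proof -
        have e: "q - k + (\<Sum>a\<in>{i}. (\<lambda>_\<in>{i}. b) a) = q + b - k" by simp
        have "\<phi> k (\<lambda>_\<in>{i}. b) \<in> TOp P {i} (\<lambda>_\<in>{i}. tw_ob A b) (tw_ob B k) (q + b - k)"
          using pretr_op_entry[OF \<phi> kb(1), of "\<lambda>_\<in>{i}. b"] kb(2)
          unfolding multi_range_singleton obs_at_singleton e by simp
        then show ?thesis using bij[OF AO[OF kb(2)] BO[OF kb(1)]] by simp
      qed
      have u: "u \<in> pretr_hom C A B q"
        by (rule pretr_homI) (use im in \<open>auto simp: u_def intro!: inv_into_into\<close>)
      have "pretr_one P i A B q u = \<phi>"
      proof (intro ext)
        fix k j
        show "pretr_one P i A B q u k j = \<phi> k j"
        proof (cases "k \<in> tw_range B \<and> j \<in> multi_range {i} (\<lambda>_\<in>{i}. A)")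
          case True
          define b where "b = j i"
          have k: "k \<in> tw_range B" and b: "b \<in> tw_range A" and jb: "j = (\<lambda>_\<in>{i}. b)"
            using True multi_range_singletonE[of j i A] by (auto simp: b_def)
          show ?thesis
            unfolding jb pretr_one_entry[OF A B u k b]
            using f_inv_into_f[OF im[OF k b]] k b by (simp add: u_def)
        next
          case False
          then show ?thesis using pretr_op_outside[OF \<phi>, of k j] by (auto simp: pretr_one_def)
        qed
      qed
      then show "\<phi> \<in> pretr_one P i A B q ` pretr_hom C A B q" using u by blast
    qed
  qed
qed

lemma pretr_one_add:
  assumes A: "A \<in> graded_objects C" and B: "B \<in> graded_objects C"
    and u: "u \<in> pretr_hom C A B q" and v: "v \<in> pretr_hom C A B q"
  shows "pretr_one P i A B q (u + v) = pretr_one P i A B q u + pretr_one P i A B q v"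
proof (intro ext)
  fix k j
  show "pretr_one P i A B q (u + v) k j = (pretr_one P i A B q u + pretr_one P i A B q v) k j"
    using multi_range_singletonE(2)[of j i A] pretr_hom_entry[OF u, of k "j i"]
      pretr_hom_entry[OF v, of k "j i"] graded_objects_ob[OF A] graded_objects_ob[OF B]
    by (simp add: pretr_one_def one_add)
qed

lemma pretr_one_dif:
  assumes A: "A \<in> graded_objects C" and B: "B \<in> graded_objects C" and u: "u \<in> pretr_hom C A B q"
  shows "pretr_one P i A B (q + 1) (graded_dif C A B q u)
    = graded_tdif P {i} (\<lambda>_\<in>{i}. A) B q (pretr_one P i A B q u)"
proof (intro ext)
  fix k j
  show "pretr_one P i A B (q + 1) (graded_dif C A B q u) k j
    = graded_tdif P {i} (\<lambda>_\<in>{i}. A) B q (pretr_one P i A B q u) k j"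
  proof (cases "k \<in> tw_range B \<and> j \<in> multi_range {i} (\<lambda>_\<in>{i}. A)")
    case True
    define b where "b = j i"
    have k: "k \<in> tw_range B" and b: "b \<in> tw_range A" and jb: "j = (\<lambda>_\<in>{i}. b)"
      using True multi_range_singletonE[of j i A] by (auto simp: b_def)
    note o = graded_objects_ob[OF A b] graded_objects_ob[OF B k]
    note x = pretr_hom_entry[OF u k b]
    have e: "q - k + (\<Sum>a\<in>{i}. (\<lambda>_\<in>{i}. b) a) = q + b - k" "q + 1 + b - k = q + b - k + 1" by simp_all
    have "pretr_one P i A B (q + 1) (graded_dif C A B q u) k (\<lambda>_\<in>{i}. b)
      = TOne P i (tw_ob A b) (tw_ob B k) (q + b - k + 1) (ksign k (DDif C (tw_ob A b) (tw_ob B k) (q + b - k) (u k b)))"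
      unfolding pretr_one_entry[OF A B graded_dif_closed[OF A B u] k b] e(2)
      using k b by (simp add: graded_dif_def)
    also have "\<dots> = ksign k (TDif P {i} (\<lambda>_\<in>{i}. tw_ob A b) (tw_ob B k) (q + b - k)
        (TOne P i (tw_ob A b) (tw_ob B k) (q + b - k) (u k b)))"
      by (simp add: additive_on_ksign[OF one_additive[OF o] dif_closed[OF o x]] one_dif[OF o x])
    also have "\<dots> = graded_tdif P {i} (\<lambda>_\<in>{i}. A) B q (pretr_one P i A B q u) k (\<lambda>_\<in>{i}. b)"
      unfolding graded_tdif_def obs_at_singleton e(1) multi_range_singleton pretr_one_entry[OF A B u k b]
      using k b by simp
    finally show ?thesis unfolding jb .
  qed (auto simp: pretr_one_def graded_tdif_def)
qed

text \<open>The degrees and the entries of the inner operations in the summand of a composite with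
  intermediate multi-index \<open>j\<close>.\<close>

abbreviation inner_deg where
  "inner_deg J I \<pi> n j \<kappa> \<equiv> \<lambda>i\<in>I. n i - j i + (\<Sum>a\<in>fiber J \<pi> i. \<kappa> a) :: int"

abbreviation inner_ops where
  "inner_ops J I \<pi> \<psi> j \<kappa> \<equiv> \<lambda>i\<in>I. \<psi> i (j i) (restrict \<kappa> (fiber J \<pi> i))"

lemma inner_ops_entry:
  assumes \<psi>: "\<psi> \<in> op_families (graded_tensor C P) J I \<pi> H E n"
    and i: "i \<in> I" and j: "j \<in> multi_range I E" and \<kappa>: "\<kappa> \<in> multi_range J H"
  shows "\<psi> i (j i) (restrict \<kappa> (fiber J \<pi> i))
    \<in> TOp P (fiber J \<pi> i) (restrict (obs_at J H \<kappa>) (fiber J \<pi> i)) (obs_at I E j i)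
        (n i - j i + (\<Sum>a\<in>fiber J \<pi> i. \<kappa> a))"
proof -
  let ?F = "fiber J \<pi> i"
  have "\<psi> i \<in> pretr_op P ?F (restrict H ?F) (E i) (n i)"
    using \<psi> i by (simp add: op_families_iff)
  from pretr_op_entry[OF this multi_range_mem[OF j i] multi_range_restrict[OF \<kappa> fiber_subset]]
  moreover have "(\<Sum>a\<in>?F. restrict \<kappa> ?F a) = (\<Sum>a\<in>?F. \<kappa> a)" "obs_at I E j i = tw_ob (E i) (j i)"
    using i by (simp_all add: obs_at_def)
  ultimately show ?thesis unfolding obs_at_restrict[OF fiber_subset] by (simp only:)
qed

lemma inner_ops_family:
  assumes "\<psi> \<in> op_families (graded_tensor C P) J I \<pi> H E n"
    and "j \<in> multi_range I E" and "\<kappa> \<in> multi_range J H"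
  shows "inner_ops J I \<pi> \<psi> j \<kappa>
    \<in> op_families P J I \<pi> (obs_at J H \<kappa>) (obs_at I E j) (inner_deg J I \<pi> n j \<kappa>)"
  using inner_ops_entry[OF assms(1) _ assms(2,3)] by (intro op_familiesI) simp_all

lemma inner_deg_sum:
  assumes "surjection J I \<pi>"
  shows "r - k + (\<Sum>i\<in>I. j i) + (\<Sum>i\<in>I. inner_deg J I \<pi> n j \<kappa> i)
    = r + (\<Sum>i\<in>I. n i) - k + (\<Sum>a\<in>J. \<kappa> a)"
proof -
  have "(\<Sum>i\<in>I. inner_deg J I \<pi> n j \<kappa> i) = (\<Sum>i\<in>I. n i - j i + (\<Sum>a\<in>fiber J \<pi> i. \<kappa> a))"
    by (intro sum.cong) auto
  then show ?thesis unfolding sum.distrib sum_subtractf sum_fibers[OF assms] by simp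
qed

context
  fixes J I \<pi> H E F
  assumes s: "surjection J I \<pi>" and H: "H \<in> J \<rightarrow>\<^sub>E graded_objects C"
    and E: "E \<in> I \<rightarrow>\<^sub>E graded_objects C" and F: "F \<in> graded_objects C"
begin

private lemmas sD = surjectionD[OF s]
private lemmas HO = obs_at_family[OF H]
private lemmas EO = obs_at_family[OF E]
private lemmas FO = graded_objects_ob[OF F]

lemma pretr_op_cmp_term:
  assumes \<phi>: "\<phi> \<in> pretr_op P I E F r" and \<psi>: "\<psi> \<in> op_families (graded_tensor C P) J I \<pi> H E n"
    and k: "k \<in> tw_range F" and \<kappa>: "\<kappa> \<in> multi_range J H" and j: "j \<in> multi_range I E"
  shows "TCmp P J I \<pi> (obs_at J H \<kappa>) (obs_at I E j) (tw_ob F k) (r - k + (\<Sum>i\<in>I. j i))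
      (inner_deg J I \<pi> n j \<kappa>) (\<phi> k j) (inner_ops J I \<pi> \<psi> j \<kappa>)
    \<in> TOp P J (obs_at J H \<kappa>) (tw_ob F k) (r + (\<Sum>i\<in>I. n i) - k + (\<Sum>a\<in>J. \<kappa> a))"
  using tcmp_closed[OF s HO[OF \<kappa>] EO[OF j] FO[OF k] restrict_extensional pretr_op_entry[OF \<phi> k j]
      inner_ops_family[OF \<psi> j \<kappa>]]
  unfolding inner_deg_sum[OF s] .

lemma pretr_op_cmp_closed:
  assumes \<phi>: "\<phi> \<in> pretr_op P I E F r" and \<psi>: "\<psi> \<in> op_families (graded_tensor C P) J I \<pi> H E n"
  shows "pretr_op_cmp P J I \<pi> H E F r n \<phi> \<psi> \<in> pretr_op P J H F (r + (\<Sum>i\<in>I. n i))"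
proof (rule pretr_opI)
  fix k \<kappa> assume k: "k \<in> tw_range F" and \<kappa>: "\<kappa> \<in> multi_range J H"
  show "pretr_op_cmp P J I \<pi> H E F r n \<phi> \<psi> k \<kappa>
      \<in> TOp P J (obs_at J H \<kappa>) (tw_ob F k) (r + (\<Sum>i\<in>I. n i) - k + (\<Sum>a\<in>J. \<kappa> a))"
    unfolding pretr_op_cmp_def
    using k \<kappa> by (auto intro!: subgroup_sum subgroup_ksign op_subgroup sD HO FO pretr_op_cmp_term[OF \<phi> \<psi>])
qed (auto simp: pretr_op_cmp_def)

lemma pretr_op_cmp_add_left:
  assumes \<phi>: "\<phi> \<in> pretr_op P I E F r" "\<phi>' \<in> pretr_op P I E F r"
    and \<psi>: "\<psi> \<in> op_families (graded_tensor C P) J I \<pi> H E n"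
  shows "pretr_op_cmp P J I \<pi> H E F r n (\<phi> + \<phi>') \<psi>
    = pretr_op_cmp P J I \<pi> H E F r n \<phi> \<psi> + pretr_op_cmp P J I \<pi> H E F r n \<phi>' \<psi>"
  using tcmp_add_left[OF s HO EO FO restrict_extensional pretr_op_entry[OF \<phi>(1)]
      pretr_op_entry[OF \<phi>(2)] inner_ops_family[OF \<psi>]]
  by (auto simp: pretr_op_cmp_def fun_eq_iff ksign_add simp flip: sum.distrib simp del: restrict_apply
      intro!: sum.cong)

lemma inner_ops_upd:
  assumes "i \<in> I"
  shows "inner_ops J I \<pi> (\<psi>(i := x)) j \<kappa>
    = (inner_ops J I \<pi> \<psi> j \<kappa>)(i := x (j i) (restrict \<kappa> (fiber J \<pi> i)))"
  using assms by (auto simp: fun_eq_iff)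

lemma pretr_op_cmp_add_right:
  assumes \<phi>: "\<phi> \<in> pretr_op P I E F r"
    and \<psi>: "\<psi> \<in> op_families (graded_tensor C P) J I \<pi> H E n" and i: "i \<in> I"
    and x: "x \<in> pretr_op P (fiber J \<pi> i) (restrict H (fiber J \<pi> i)) (E i) (n i)"
    and y: "y \<in> pretr_op P (fiber J \<pi> i) (restrict H (fiber J \<pi> i)) (E i) (n i)"
  shows "pretr_op_cmp P J I \<pi> H E F r n \<phi> (\<psi>(i := x + y))
    = pretr_op_cmp P J I \<pi> H E F r n \<phi> (\<psi>(i := x)) + pretr_op_cmp P J I \<pi> H E F r n \<phi> (\<psi>(i := y))"
proof -
  have upd: "\<psi>(i := z) \<in> op_families (graded_tensor C P) J I \<pi> H E n"
    if "z \<in> pretr_op P (fiber J \<pi> i) (restrict H (fiber J \<pi> i)) (E i) (n i)" for z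
    using op_families_upd'[OF \<psi> i] that by simp
  have "TCmp P J I \<pi> (obs_at J H \<kappa>) (obs_at I E j) (tw_ob F k) (r - k + (\<Sum>i\<in>I. j i))
      (inner_deg J I \<pi> n j \<kappa>) (\<phi> k j) (inner_ops J I \<pi> (\<psi>(i := x + y)) j \<kappa>)
    = TCmp P J I \<pi> (obs_at J H \<kappa>) (obs_at I E j) (tw_ob F k) (r - k + (\<Sum>i\<in>I. j i))
      (inner_deg J I \<pi> n j \<kappa>) (\<phi> k j) (inner_ops J I \<pi> (\<psi>(i := x)) j \<kappa>)
    + TCmp P J I \<pi> (obs_at J H \<kappa>) (obs_at I E j) (tw_ob F k) (r - k + (\<Sum>i\<in>I. j i))
      (inner_deg J I \<pi> n j \<kappa>) (\<phi> k j) (inner_ops J I \<pi> (\<psi>(i := y)) j \<kappa>)"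
    if k: "k \<in> tw_range F" and \<kappa>: "\<kappa> \<in> multi_range J H" and j: "j \<in> multi_range I E" for k \<kappa> j
    unfolding inner_ops_upd[OF i] plus_fun_apply
    using inner_ops_entry[OF upd[OF x] i j \<kappa>] inner_ops_entry[OF upd[OF y] i j \<kappa>] i
    by (intro tcmp_add_right[OF s HO[OF \<kappa>] EO[OF j] FO[OF k] restrict_extensional
          pretr_op_entry[OF \<phi> k j] inner_ops_family[OF \<psi> j \<kappa>] i]) simp_all
  then show ?thesis
    by (auto simp: pretr_op_cmp_def fun_eq_iff ksign_add simp flip: sum.distrib simp del: restrict_apply
        fun_upd_apply intro!: sum.cong)
qed

text \<open>Each summand of the composite satisfies the Leibniz rule of \<open>P\<close>. On the two sides the
  differential of \<open>\<psi> i\<close> carries different signs: that of \<open>P\<close> counts the degrees of the entries, that of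
  the matrices the degrees \<open>n l\<close>. The difference is made up by the sign $(-1)^{j_i}$ in the
  differential of \<open>\<psi> i\<close> and by the change of the exponent $S$.\<close>

lemma graded_tdif_cmp:
  assumes n: "n \<in> extensional I"
    and \<phi>: "\<phi> \<in> pretr_op P I E F r" and \<psi>: "\<psi> \<in> op_families (graded_tensor C P) J I \<pi> H E n"
  shows "graded_tdif P J H F (r + (\<Sum>i\<in>I. n i)) (pretr_op_cmp P J I \<pi> H E F r n \<phi> \<psi>)
    = pretr_op_cmp P J I \<pi> H E F (r + 1) n (graded_tdif P I E F r \<phi>) \<psi>
      + (\<Sum>i\<in>I. ksign (r + (\<Sum>l\<in>{l \<in> I. l < i}. n l))
          (pretr_op_cmp P J I \<pi> H E F r (n(i := n i + 1)) \<phi>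
            (\<psi>(i := graded_tdif P (fiber J \<pi> i) (restrict H (fiber J \<pi> i)) (E i) (n i) (\<psi> i)))))"
proof (intro ext)
  fix k \<kappa>
  let ?d\<psi> = "\<lambda>i. graded_tdif P (fiber J \<pi> i) (restrict H (fiber J \<pi> i)) (E i) (n i) (\<psi> i)"
  show "graded_tdif P J H F (r + (\<Sum>i\<in>I. n i)) (pretr_op_cmp P J I \<pi> H E F r n \<phi> \<psi>) k \<kappa>
    = (pretr_op_cmp P J I \<pi> H E F (r + 1) n (graded_tdif P I E F r \<phi>) \<psi>
      + (\<Sum>i\<in>I. ksign (r + (\<Sum>l\<in>{l \<in> I. l < i}. n l))
          (pretr_op_cmp P J I \<pi> H E F r (n(i := n i + 1)) \<phi> (\<psi>(i := ?d\<psi> i))))) k \<kappa>"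
  proof (cases "k \<in> tw_range F \<and> \<kappa> \<in> multi_range J H")
    case True
    then have k: "k \<in> tw_range F" and \<kappa>: "\<kappa> \<in> multi_range J H" by auto
    let ?T = "\<lambda>j. TCmp P J I \<pi> (obs_at J H \<kappa>) (obs_at I E j) (tw_ob F k)"
    let ?m = "\<lambda>j. r - k + (\<Sum>i\<in>I. j i)"
    let ?S = "\<lambda>j n. pretr_exp J I \<pi> j \<kappa> n"
    let ?B = "\<lambda>i. \<Sum>a\<in>fiber J \<pi> i. \<kappa> a"
    define first where "first j = ksign (?S j n) (?T j (r + 1 - k + (\<Sum>i\<in>I. j i)) (inner_deg J I \<pi> n j \<kappa>)
      (graded_tdif P I E F r \<phi> k j) (inner_ops J I \<pi> \<psi> j \<kappa>))" for j
    define rest where "rest j i = ksign (r + (\<Sum>l\<in>{l \<in> I. l < i}. n l))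
      (ksign (?S j (n(i := n i + 1))) (?T j (?m j) (inner_deg J I \<pi> (n(i := n i + 1)) j \<kappa>) (\<phi> k j)
        (inner_ops J I \<pi> (\<psi>(i := ?d\<psi> i)) j \<kappa>)))" for j i
    have main: "ksign k (ksign (?S j n) (TDif P J (obs_at J H \<kappa>) (tw_ob F k) (r + (\<Sum>i\<in>I. n i) - k + (\<Sum>a\<in>J. \<kappa> a))
        (?T j (?m j) (inner_deg J I \<pi> n j \<kappa>) (\<phi> k j) (inner_ops J I \<pi> \<psi> j \<kappa>))))
      = first j + (\<Sum>i\<in>I. rest j i)" if j: "j \<in> multi_range I E" for j
    proof -
      let ?N = "inner_deg J I \<pi> n j \<kappa>" and ?G = "inner_ops J I \<pi> \<psi> j \<kappa>"
      note \<phi>kj = pretr_op_entry[OF \<phi> k j]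
      note G = inner_ops_family[OF \<psi> j \<kappa>]
      have "TDif P J (obs_at J H \<kappa>) (tw_ob F k) (?m j + (\<Sum>i\<in>I. ?N i)) (?T j (?m j) ?N (\<phi> k j) ?G)
        = ?T j (?m j + 1) ?N (TDif P I (obs_at I E j) (tw_ob F k) (?m j) (\<phi> k j)) ?G
          + (\<Sum>i\<in>I. ksign (?m j + (\<Sum>l\<in>{l \<in> I. l < i}. ?N l)) (?T j (?m j) (?N(i := ?N i + 1)) (\<phi> k j)
              (?G(i := TDif P (fiber J \<pi> i) (restrict (obs_at J H \<kappa>) (fiber J \<pi> i)) (obs_at I E j i) (?N i) (?G i)))))"
        by (rule tcmp_dif[OF s HO[OF \<kappa>] EO[OF j] FO[OF k] restrict_extensional \<phi>kj G])
      then have leib: "TDif P J (obs_at J H \<kappa>) (tw_ob F k) (r + (\<Sum>i\<in>I. n i) - k + (\<Sum>a\<in>J. \<kappa> a))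
          (?T j (?m j) ?N (\<phi> k j) ?G)
        = ?T j (?m j + 1) ?N (TDif P I (obs_at I E j) (tw_ob F k) (?m j) (\<phi> k j)) ?G
          + (\<Sum>i\<in>I. ksign (?m j + (\<Sum>l\<in>{l \<in> I. l < i}. ?N l)) (?T j (?m j) (?N(i := ?N i + 1)) (\<phi> k j)
              (?G(i := TDif P (fiber J \<pi> i) (restrict (obs_at J H \<kappa>) (fiber J \<pi> i)) (obs_at I E j i) (?N i) (?G i)))))"
        unfolding inner_deg_sum[OF s] .
      have f: "first j = ksign k (ksign (?S j n)
          (?T j (?m j + 1) ?N (TDif P I (obs_at I E j) (tw_ob F k) (?m j) (\<phi> k j)) ?G))"
      proof -
        have e: "r + 1 - k + (\<Sum>i\<in>I. j i) = ?m j + 1" by simp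
        have d: "graded_tdif P I E F r \<phi> k j
            = ksign k (TDif P I (obs_at I E j) (tw_ob F k) (?m j) (\<phi> k j))"
          using k j by (simp add: graded_tdif_def)
        note lin = additive_on_ksign[OF tcmp_additive_left[OF s HO[OF \<kappa>] EO[OF j] FO[OF k] restrict_extensional G]
              tdif_closed[OF sD(2) EO[OF j] FO[OF k] \<phi>kj], of k]
        show ?thesis unfolding first_def e d lin by (simp only: ksign_ksign add.commute)
      qed
      have r: "rest j i = ksign k (ksign (?S j n) (ksign (?m j + (\<Sum>l\<in>{l \<in> I. l < i}. ?N l))
          (?T j (?m j) (?N(i := ?N i + 1)) (\<phi> k j)
              (?G(i := TDif P (fiber J \<pi> i) (restrict (obs_at J H \<kappa>) (fiber J \<pi> i)) (obs_at I E j i) (?N i) (?G i))))))"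
        if i: "i \<in> I" for i
      proof -
        let ?F = "fiber J \<pi> i"
        let ?D = "TDif P ?F (restrict (obs_at J H \<kappa>) ?F) (obs_at I E j i) (?N i) (?G i)"
        have Gi: "?G i \<in> TOp P ?F (restrict (obs_at J H \<kappa>) ?F) (obs_at I E j i) (?N i)"
          using G i by (simp only: op_families_iff)
        have oi: "obs_at I E j i \<in> DOb C" using EO[OF j] i by auto
        have Di: "?D \<in> TOp P ?F (restrict (obs_at J H \<kappa>) ?F) (obs_at I E j i) (?N i + 1)"
          by (rule tdif_closed[OF surjection_fiber[OF s i] fiber_objects[OF s HO[OF \<kappa>] i] oi Gi])
        have Nu: "inner_deg J I \<pi> (n(i := n i + 1)) j \<kappa> = ?N(i := ?N i + 1)"
          using i by (auto simp: fun_eq_iff)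
        have sumF: "(\<Sum>a\<in>?F. restrict \<kappa> ?F a) = ?B i" by simp
        have Gu: "inner_ops J I \<pi> (\<psi>(i := ?d\<psi> i)) j \<kappa> = ?G(i := ksign (j i) ?D)"
        proof -
          have "?d\<psi> i (j i) (restrict \<kappa> ?F) = ksign (j i) ?D"
            unfolding graded_tdif_def obs_at_restrict[OF fiber_subset] sumF
            using multi_range_mem[OF j i] multi_range_restrict[OF \<kappa> fiber_subset, of \<pi> i] i
            by (simp add: obs_at_def)
          then show ?thesis unfolding inner_ops_upd[OF i] by simp
        qed
        have D\<psi>: "?G(i := ?D) \<in> op_families P J I \<pi> (obs_at J H \<kappa>) (obs_at I E j) (?N(i := ?N i + 1))"
          by (rule op_families_upd[OF G i Di])
        have lin: "?T j (?m j) (?N(i := ?N i + 1)) (\<phi> k j) (?G(i := ksign (j i) ?D))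
          = ksign (j i) (?T j (?m j) (?N(i := ?N i + 1)) (\<phi> k j) (?G(i := ?D)))"
        proof -
          have "?N(i := ?N i + 1) \<in> extensional I" using i by (auto simp: extensional_def)
          from additive_on_ksign[OF tcmp_additive_slot[OF s HO[OF \<kappa>] EO[OF j] FO[OF k] this \<phi>kj D\<psi> i],
              of ?D "j i"] Di
          show ?thesis by simp
        qed
        have split: "sum h I = (\<Sum>l\<in>{l \<in> I. l < i}. h l) + (h i + (\<Sum>l\<in>{l \<in> I. i < l}. h l))"
          for h :: "nat \<Rightarrow> int"
        proof -
          have "I = {l \<in> I. l < i} \<union> ({i} \<union> {l \<in> I. i < l})" using i by auto
          then have "sum h I = sum h ({l \<in> I. l < i} \<union> ({i} \<union> {l \<in> I. i < l}))" by simp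
          also have "\<dots> = (\<Sum>l\<in>{l \<in> I. l < i}. h l) + (h i + (\<Sum>l\<in>{l \<in> I. i < l}. h l))"
            using sD(4) by (subst sum.union_disjoint, auto)+
          finally show ?thesis .
        qed
        have Nl: "(\<Sum>l\<in>{l \<in> I. l < i}. ?N l)
            = (\<Sum>l\<in>{l \<in> I. l < i}. n l) - (\<Sum>l\<in>{l \<in> I. l < i}. j l) + (\<Sum>l\<in>{l \<in> I. l < i}. ?B l)"
          by (simp add: sum.distrib sum_subtractf)
        have par: "even (r + (\<Sum>l\<in>{l \<in> I. l < i}. n l) + ?S j (n(i := n i + 1)) + j i
            + (k + ?S j n + (?m j + (\<Sum>l\<in>{l \<in> I. l < i}. ?N l))))"
          unfolding pretr_exp_add_1[OF sD(4,3) i] Nl split[of j] by simp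
        show ?thesis
          unfolding rest_def Nu Gu lin ksign_ksign
          by (rule ksign_cong) (use par in \<open>simp only: add.assoc\<close>)
      qed
      show ?thesis
        unfolding leib f ksign_add ksign_sum using r by simp
    qed
    have "graded_tdif P J H F (r + (\<Sum>i\<in>I. n i)) (pretr_op_cmp P J I \<pi> H E F r n \<phi> \<psi>) k \<kappa>
      = ksign k (TDif P J (obs_at J H \<kappa>) (tw_ob F k) (r + (\<Sum>i\<in>I. n i) - k + (\<Sum>a\<in>J. \<kappa> a))
        (\<Sum>j\<in>multi_range I E. ksign (?S j n)
          (?T j (?m j) (inner_deg J I \<pi> n j \<kappa>) (\<phi> k j) (inner_ops J I \<pi> \<psi> j \<kappa>))))"
      using True by (simp add: graded_tdif_def pretr_op_cmp_def)
    also have "\<dots> = (\<Sum>j\<in>multi_range I E. ksign k (ksign (?S j n)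
        (TDif P J (obs_at J H \<kappa>) (tw_ob F k) (r + (\<Sum>i\<in>I. n i) - k + (\<Sum>a\<in>J. \<kappa> a))
        (?T j (?m j) (inner_deg J I \<pi> n j \<kappa>) (\<phi> k j) (inner_ops J I \<pi> \<psi> j \<kappa>)))))"
    proof -
      note add = tdif_additive[OF sD(1) HO[OF \<kappa>] FO[OF k],
          of "r + (\<Sum>i\<in>I. n i) - k + (\<Sum>a\<in>J. \<kappa> a)"]
      note t = pretr_op_cmp_term[OF \<phi> \<psi> k \<kappa>]
      have "TDif P J (obs_at J H \<kappa>) (tw_ob F k) (r + (\<Sum>i\<in>I. n i) - k + (\<Sum>a\<in>J. \<kappa> a))
        (\<Sum>j\<in>multi_range I E. ksign (?S j n)
          (?T j (?m j) (inner_deg J I \<pi> n j \<kappa>) (\<phi> k j) (inner_ops J I \<pi> \<psi> j \<kappa>)))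
        = (\<Sum>j\<in>multi_range I E. ksign (?S j n)
        (TDif P J (obs_at J H \<kappa>) (tw_ob F k) (r + (\<Sum>i\<in>I. n i) - k + (\<Sum>a\<in>J. \<kappa> a))
        (?T j (?m j) (inner_deg J I \<pi> n j \<kappa>) (\<phi> k j) (inner_ops J I \<pi> \<psi> j \<kappa>))))"
        by (subst additive_on_sum[OF add subgroup_ksign[OF additive_on_subgroup[OF add] t]])
          (simp_all only: additive_on_ksign[OF add t] cong: sum.cong)
      then show ?thesis by (simp only: ksign_sum)
    qed
    also have "\<dots> = (\<Sum>j\<in>multi_range I E. first j + (\<Sum>i\<in>I. rest j i))"
      using main by (rule sum.cong[OF refl])
    also have "\<dots> = (\<Sum>j\<in>multi_range I E. first j) + (\<Sum>i\<in>I. \<Sum>j\<in>multi_range I E. rest j i)"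
      by (simp only: sum.distrib sum.swap[of _ I "multi_range I E"])
    also have "\<dots> = (pretr_op_cmp P J I \<pi> H E F (r + 1) n (graded_tdif P I E F r \<phi>) \<psi>
      + (\<Sum>i\<in>I. ksign (r + (\<Sum>l\<in>{l \<in> I. l < i}. n l))
          (pretr_op_cmp P J I \<pi> H E F r (n(i := n i + 1)) \<phi> (\<psi>(i := ?d\<psi> i))))) k \<kappa>"
      unfolding plus_fun_apply sum_apply ksign_apply pretr_op_cmp_def ksign_sum first_def rest_def
      using True by (simp add: ksign_sum del: restrict_apply fun_upd_apply)
    finally show ?thesis .
  next
    case False
    then show ?thesis by (auto simp: graded_tdif_def pretr_op_cmp_def sum_apply ksign_apply)
  qed
qed

end

lemma pretr_one_cmp:
  assumes A: "A \<in> graded_objects C" and B: "B \<in> graded_objects C" and D: "D \<in> graded_objects C"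
    and u: "u \<in> pretr_hom C B D m" and v: "v \<in> pretr_hom C A B q"
  shows "pretr_one P j A D (m + q) (pretr_cmp C A B D m q u v)
    = pretr_op_cmp P {j} {i} (\<lambda>_\<in>{j}. i) (\<lambda>_\<in>{j}. A) (\<lambda>_\<in>{i}. B) D m (\<lambda>_\<in>{i}. q)
        (pretr_one P i B D m u) (\<lambda>_\<in>{i}. pretr_one P j A B q v)"
proof (intro ext)
  fix k \<kappa>
  show "pretr_one P j A D (m + q) (pretr_cmp C A B D m q u v) k \<kappa>
    = pretr_op_cmp P {j} {i} (\<lambda>_\<in>{j}. i) (\<lambda>_\<in>{j}. A) (\<lambda>_\<in>{i}. B) D m (\<lambda>_\<in>{i}. q)
        (pretr_one P i B D m u) (\<lambda>_\<in>{i}. pretr_one P j A B q v) k \<kappa>"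
  proof (cases "k \<in> tw_range D \<and> \<kappa> \<in> multi_range {j} (\<lambda>_\<in>{j}. A)")
    case True
    define a where "a = \<kappa> j"
    have k: "k \<in> tw_range D" and a: "a \<in> tw_range A" and ja: "\<kappa> = (\<lambda>_\<in>{j}. a)"
      using True multi_range_singletonE[of \<kappa> j A] by (auto simp: a_def)
    note AO = graded_objects_ob[OF A a] and BO = graded_objects_ob[OF B] and DO = graded_objects_ob[OF D k]
    let ?c = "\<lambda>b. DCmp C (tw_ob A a) (tw_ob B b) (tw_ob D k) (m + b - k) (q + a - b) (u k b) (v b a)"
    have t: "?c b \<in> DHom C (tw_ob A a) (tw_ob D k) (m + q + a - k)" if "b \<in> tw_range B" for b
      by (rule pretr_cmp_terms[OF A B D u v k a that refl])
    have "pretr_one P j A D (m + q) (pretr_cmp C A B D m q u v) k \<kappa>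
        = TOne P j (tw_ob A a) (tw_ob D k) (m + q + a - k) (\<Sum>b\<in>tw_range B. ?c b)"
      unfolding ja pretr_one_entry[OF A D pretr_cmp_closed[OF A B D u v] k a]
      using k a by (simp add: pretr_cmp_def)
    also have "\<dots> = (\<Sum>b\<in>tw_range B. TOne P j (tw_ob A a) (tw_ob D k) (m + q + a - k) (?c b))"
      by (rule additive_on_sum[OF one_additive[OF AO DO] t])
    also have "\<dots> = (\<Sum>b\<in>tw_range B. TCmp P {j} {i} (\<lambda>_\<in>{j}. i) (\<lambda>_\<in>{j}. tw_ob A a) (\<lambda>_\<in>{i}. tw_ob B b)
        (tw_ob D k) (m + b - k) (\<lambda>_\<in>{i}. q + a - b) (pretr_one P i B D m u k (\<lambda>_\<in>{i}. b))
        (\<lambda>_\<in>{i}. pretr_one P j A B q v b (\<lambda>_\<in>{j}. a)))"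
    proof (intro sum.cong refl)
      fix b assume b: "b \<in> tw_range B"
      have e: "m + q + a - k = (m + b - k) + (q + a - b)" by simp
      show "TOne P j (tw_ob A a) (tw_ob D k) (m + q + a - k) (?c b)
        = TCmp P {j} {i} (\<lambda>_\<in>{j}. i) (\<lambda>_\<in>{j}. tw_ob A a) (\<lambda>_\<in>{i}. tw_ob B b)
        (tw_ob D k) (m + b - k) (\<lambda>_\<in>{i}. q + a - b) (pretr_one P i B D m u k (\<lambda>_\<in>{i}. b))
        (\<lambda>_\<in>{i}. pretr_one P j A B q v b (\<lambda>_\<in>{j}. a))"
        unfolding e pretr_one_entry[OF B D u k b] pretr_one_entry[OF A B v b a]
        by (rule one_cmp[OF AO BO[OF b] DO pretr_hom_entry[OF u k b] pretr_hom_entry[OF v b a]])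
    qed
    also have "\<dots> = pretr_op_cmp P {j} {i} (\<lambda>_\<in>{j}. i) (\<lambda>_\<in>{j}. A) (\<lambda>_\<in>{i}. B) D m (\<lambda>_\<in>{i}. q)
        (pretr_one P i B D m u) (\<lambda>_\<in>{i}. pretr_one P j A B q v) k \<kappa>"
    proof -
      have "(\<lambda>l\<in>{i}. (\<lambda>_\<in>{i}. q) l - (\<lambda>_\<in>{i}. b) l + (\<Sum>x\<in>fiber {j} (\<lambda>_\<in>{j}. i) l. (\<lambda>_\<in>{j}. a) x))
          = (\<lambda>_\<in>{i}. q + a - b)"
        "(\<lambda>l\<in>{i}. (\<lambda>_\<in>{i}. pretr_one P j A B q v) l ((\<lambda>_\<in>{i}. b) l)
            (restrict (\<lambda>_\<in>{j}. a) (fiber {j} (\<lambda>_\<in>{j}. i) l)))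
          = (\<lambda>_\<in>{i}. pretr_one P j A B q v b (\<lambda>_\<in>{j}. a))"
        "m - k + (\<Sum>l\<in>{i}. (\<lambda>_\<in>{i}. b) l) = m + b - k" for b
        by (auto simp: fun_eq_iff)
      then show ?thesis
        using True unfolding ja
        by (simp only: pretr_op_cmp_def sum_multi_range_singleton obs_at_singleton pretr_exp_const
            ksign_0_left if_True simp_thms)
    qed
    finally show ?thesis .
  qed (auto simp: pretr_one_def pretr_op_cmp_def)
qed

lemma pretr_op_id_left:
  assumes I: "index_set I" and X: "X \<in> I \<rightarrow>\<^sub>E graded_objects C" and B: "B \<in> graded_objects C"
    and \<phi>: "\<phi> \<in> pretr_op P I X B q"
  shows "pretr_op_cmp P I {i} (\<lambda>_\<in>I. i) X (\<lambda>_\<in>{i}. B) B 0 (\<lambda>_\<in>{i}. q)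
      (pretr_one P i B B 0 (pretr_id C B)) (\<lambda>_\<in>{i}. \<phi>) = \<phi>"
proof (intro ext)
  fix k \<kappa>
  show "pretr_op_cmp P I {i} (\<lambda>_\<in>I. i) X (\<lambda>_\<in>{i}. B) B 0 (\<lambda>_\<in>{i}. q)
      (pretr_one P i B B 0 (pretr_id C B)) (\<lambda>_\<in>{i}. \<phi>) k \<kappa> = \<phi> k \<kappa>"
  proof (cases "k \<in> tw_range B \<and> \<kappa> \<in> multi_range I X")
    case True
    then have k: "k \<in> tw_range B" and \<kappa>: "\<kappa> \<in> multi_range I X" by auto
    note BO = graded_objects_ob[OF B] and XO = obs_at_family[OF X \<kappa>]
    note idB = pretr_id_closed[OF B]
    have Xe: "obs_at I X \<kappa> \<in> extensional I" by (simp add: obs_at_def)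
    let ?s = "\<Sum>a\<in>I. \<kappa> a"
    have "(\<lambda>l\<in>{i}. (\<lambda>_\<in>{i}. q) l - (\<lambda>_\<in>{i}. b) l + (\<Sum>x\<in>fiber I (\<lambda>_\<in>I. i) l. \<kappa> x))
          = (\<lambda>_\<in>{i}. q - b + ?s)"
        "(\<lambda>l\<in>{i}. (\<lambda>_\<in>{i}. \<phi>) l ((\<lambda>_\<in>{i}. b) l) (restrict \<kappa> (fiber I (\<lambda>_\<in>I. i) l))) = (\<lambda>_\<in>{i}. \<phi> b \<kappa>)"
        "0 - k + (\<Sum>l\<in>{i}. (\<lambda>_\<in>{i}. b) l) = 0 + b - k" for b
      using multi_range_ext[OF \<kappa>] by (auto simp: fun_eq_iff extensional_restrict)
    then have "pretr_op_cmp P I {i} (\<lambda>_\<in>I. i) X (\<lambda>_\<in>{i}. B) B 0 (\<lambda>_\<in>{i}. q)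
        (pretr_one P i B B 0 (pretr_id C B)) (\<lambda>_\<in>{i}. \<phi>) k \<kappa>
      = (\<Sum>b\<in>tw_range B. TCmp P I {i} (\<lambda>_\<in>I. i) (obs_at I X \<kappa>) (\<lambda>_\<in>{i}. tw_ob B b) (tw_ob B k)
          (0 + b - k) (\<lambda>_\<in>{i}. q - b + ?s) (pretr_one P i B B 0 (pretr_id C B) k (\<lambda>_\<in>{i}. b)) (\<lambda>_\<in>{i}. \<phi> b \<kappa>))"
      using True
      by (simp only: pretr_op_cmp_def sum_multi_range_singleton obs_at_singleton pretr_exp_const
          ksign_0_left if_True simp_thms)
    also have "\<dots> = (\<Sum>b\<in>tw_range B. if b = k then \<phi> k \<kappa> else 0)"
    proof (intro sum.cong refl)
      fix b assume b: "b \<in> tw_range B"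
      note \<phi>b = pretr_op_entry[OF \<phi> b \<kappa>]
      show "TCmp P I {i} (\<lambda>_\<in>I. i) (obs_at I X \<kappa>) (\<lambda>_\<in>{i}. tw_ob B b) (tw_ob B k)
          (0 + b - k) (\<lambda>_\<in>{i}. q - b + ?s) (pretr_one P i B B 0 (pretr_id C B) k (\<lambda>_\<in>{i}. b)) (\<lambda>_\<in>{i}. \<phi> b \<kappa>)
        = (if b = k then \<phi> k \<kappa> else 0)"
      proof (cases "b = k")
        case True
        then show ?thesis
          using tcmp_id_left[OF I XO BO[OF b] \<phi>b, of i] k
          unfolding pretr_one_entry[OF B B idB k b] by (simp add: pretr_id_def del: restrict_apply)
      next
        case False
        have "pretr_one P i B B 0 (pretr_id C B) k (\<lambda>_\<in>{i}. b) = 0"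
          unfolding pretr_one_entry[OF B B idB k b]
          using False additive_on_zero[OF one_additive[OF BO[OF b] BO[OF k]]] by (simp add: pretr_id_def)
        then show ?thesis
          using False additive_on_zero[OF tcmp_additive_left[OF surjection_const[OF I] XO _ BO[OF k] _
              const_family[OF \<phi>b Xe]]] BO[OF b]
          by (simp del: restrict_apply)
      qed
    qed
    finally show ?thesis using k by simp
  qed (use pretr_op_outside[OF \<phi>] in \<open>auto simp: pretr_op_cmp_def\<close>)
qed

text \<open>Families of endomorphisms of graded objects, to be substituted into all the slots of an operation.
  Their entries are families of morphisms of \<open>C\<close>, and a single vanishing entry makes the whole summand
  of the composite vanish.\<close>

abbreviation graded_slots where
  "graded_slots I X d u \<equiv> \<lambda>a\<in>I. pretr_one P a (X a) (X a) (d a) (u a)"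

context
  fixes I X d u
  assumes I: "index_set I" and X: "X \<in> I \<rightarrow>\<^sub>E graded_objects C"
    and u: "\<And>a. a \<in> I \<Longrightarrow> u a \<in> pretr_hom C (X a) (X a) (d a)"
begin

private lemma XG: "a \<in> I \<Longrightarrow> X a \<in> graded_objects C"
  using X by auto

lemma graded_slots_family:
  "graded_slots I X d u \<in> op_families (graded_tensor C P) I I (\<lambda>a\<in>I. a) X X (restrict d I)"
proof (rule op_familiesI)
  fix a assume a: "a \<in> I"
  have "restrict X {a} = (\<lambda>_\<in>{a}. X a)" by auto
  then show "graded_slots I X d u a \<in> TOp (graded_tensor C P) (fiber I (\<lambda>a\<in>I. a) a)
      (restrict X (fiber I (\<lambda>a\<in>I. a) a)) (X a) (restrict d I a)"
    using a pretr_one_closed[OF XG[OF a] XG[OF a] u[OF a], of a] by simp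
qed simp

lemma graded_slots_entry:
  assumes j: "j \<in> multi_range I X" and \<kappa>: "\<kappa> \<in> multi_range I X" and a: "a \<in> I"
  shows "inner_ops I I (\<lambda>a\<in>I. a) (graded_slots I X d u) j \<kappa> a
      = TOne P a (tw_ob (X a) (\<kappa> a)) (tw_ob (X a) (j a)) (d a + \<kappa> a - j a) (u a (j a) (\<kappa> a))"
proof -
  have "restrict \<kappa> {a} = (\<lambda>_\<in>{a}. \<kappa> a)" by auto
  then show ?thesis
    using a pretr_one_entry[OF XG[OF a] XG[OF a] u[OF a] multi_range_mem[OF j a]
        multi_range_mem[OF \<kappa> a], of a] by simp
qed

lemma graded_slots_zero:
  assumes B: "B \<in> graded_objects C" and \<phi>: "\<phi> \<in> pretr_op P I X B q" and k: "k \<in> tw_range B"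
    and j: "j \<in> multi_range I X" and \<kappa>: "\<kappa> \<in> multi_range I X"
    and a: "a \<in> I" "u a (j a) (\<kappa> a) = 0"
  shows "TCmp P I I (\<lambda>a\<in>I. a) (obs_at I X \<kappa>) (obs_at I X j) (tw_ob B k) (q - k + (\<Sum>a\<in>I. j a))
    (inner_deg I I (\<lambda>a\<in>I. a) (restrict d I) j \<kappa>) (\<phi> k j)
    (inner_ops I I (\<lambda>a\<in>I. a) (graded_slots I X d u) j \<kappa>) = 0"
proof -
  have "inner_ops I I (\<lambda>a\<in>I. a) (graded_slots I X d u) j \<kappa> a = 0"
    unfolding graded_slots_entry[OF j \<kappa> a(1)] a(2)
    by (rule additive_on_zero[OF one_additive[OF graded_objects_ob graded_objects_ob]])
      (use XG[OF a(1)] multi_range_mem[OF j a(1)] multi_range_mem[OF \<kappa> a(1)] in auto)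
  then show ?thesis
    by (rule tcmp_zero_slot[OF surjection_identity[OF I] obs_at_family[OF X \<kappa>] obs_at_family[OF X j]
        graded_objects_ob[OF B k] restrict_extensional pretr_op_entry[OF \<phi> k j]
        inner_ops_family[OF graded_slots_family j \<kappa>] a(1)])
qed

end

lemma pretr_op_id_right:
  assumes I: "index_set I" and X: "X \<in> I \<rightarrow>\<^sub>E graded_objects C" and B: "B \<in> graded_objects C"
    and \<phi>: "\<phi> \<in> pretr_op P I X B q"
  shows "pretr_op_cmp P I I (\<lambda>i\<in>I. i) X X B q (\<lambda>_\<in>I. 0) \<phi>
      (\<lambda>i\<in>I. pretr_one P i (X i) (X i) 0 (pretr_id C (X i))) = \<phi>"
proof (intro ext)
  fix k \<kappa>
  let ?\<psi> = "graded_slots I X (\<lambda>_. 0) (\<lambda>i. pretr_id C (X i))"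
  have idX: "pretr_id C (X i) \<in> pretr_hom C (X i) (X i) 0" if "i \<in> I" for i
    using X that by (intro pretr_id_closed) auto
  show "pretr_op_cmp P I I (\<lambda>i\<in>I. i) X X B q (\<lambda>_\<in>I. 0) \<phi> ?\<psi> k \<kappa> = \<phi> k \<kappa>"
  proof (cases "k \<in> tw_range B \<and> \<kappa> \<in> multi_range I X")
    case True
    then have k: "k \<in> tw_range B" and \<kappa>: "\<kappa> \<in> multi_range I X" by auto
    let ?F = "\<lambda>j. ksign (pretr_exp I I (\<lambda>i\<in>I. i) j \<kappa> (\<lambda>_\<in>I. 0))
          (TCmp P I I (\<lambda>i\<in>I. i) (obs_at I X \<kappa>) (obs_at I X j) (tw_ob B k) (q - k + (\<Sum>i\<in>I. j i))
            (inner_deg I I (\<lambda>i\<in>I. i) (\<lambda>_\<in>I. 0) j \<kappa>) (\<phi> k j) (inner_ops I I (\<lambda>i\<in>I. i) ?\<psi> j \<kappa>))"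
    have "?F j = (if j = \<kappa> then \<phi> k \<kappa> else 0)" if j: "j \<in> multi_range I X" for j
    proof (cases "j = \<kappa>")
      case True
      have d: "inner_deg I I (\<lambda>i\<in>I. i) (\<lambda>_\<in>I. 0) \<kappa> \<kappa> = (\<lambda>_\<in>I. 0)" by (auto simp: fun_eq_iff)
      have g: "inner_ops I I (\<lambda>i\<in>I. i) ?\<psi> \<kappa> \<kappa>
          = (\<lambda>i\<in>I. TOne P i (obs_at I X \<kappa> i) (obs_at I X \<kappa> i) 0 (DId C (obs_at I X \<kappa> i)))"
      proof (rule ext)
        fix i
        show "inner_ops I I (\<lambda>i\<in>I. i) ?\<psi> \<kappa> \<kappa> i
          = (\<lambda>i\<in>I. TOne P i (obs_at I X \<kappa> i) (obs_at I X \<kappa> i) 0 (DId C (obs_at I X \<kappa> i))) i"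
        proof (cases "i \<in> I")
          case True
          then show ?thesis
            using graded_slots_entry[OF I X idX \<kappa> \<kappa> True] multi_range_mem[OF \<kappa> True]
            by (simp add: obs_at_def pretr_id_def)
        qed simp
      qed
      have "pretr_exp I I (\<lambda>i\<in>I. i) \<kappa> \<kappa> (\<lambda>_\<in>I. 0) = 0"
        by (auto simp: pretr_exp_def intro!: sum.neutral)
      then show ?thesis
        unfolding True d g
        using tcmp_id_right[OF I obs_at_family[OF X \<kappa>] graded_objects_ob[OF B k] pretr_op_entry[OF \<phi> k \<kappa>]]
        by (simp del: restrict_apply)
    next
      case False
      then obtain i where i: "i \<in> I" "j i \<noteq> \<kappa> i"
        using multi_range_ext[OF j] multi_range_ext[OF \<kappa>] by (metis extensionalityI)
      show ?thesis
        using False graded_slots_zero[OF I X idX B \<phi> k j \<kappa> i(1)] i by (simp add: pretr_id_def del: restrict_apply)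
    qed
    then have "(\<Sum>j\<in>multi_range I X. ?F j) = \<phi> k \<kappa>"
      using \<kappa> finite_multi_range[of I X] I by (simp add: index_set_def cong: sum.cong del: restrict_apply)
    then show ?thesis
      using True by (simp only: pretr_op_cmp_def if_True simp_thms)
  qed (use pretr_op_outside[OF \<phi>] in \<open>auto simp: pretr_op_cmp_def\<close>)
qed

lemma tcmp_ksign_slots:
  assumes "surjection J I \<pi>" "X \<in> J \<rightarrow>\<^sub>E DOb C" "Y \<in> I \<rightarrow>\<^sub>E DOb C" "Z \<in> DOb C" "n \<in> extensional I"
    and "f \<in> TOp P I Y Z m" and "g \<in> op_families P J I \<pi> X Y n"
  shows "TCmp P J I \<pi> X Y Z m n f (\<lambda>i\<in>I. ksign (q i) (g i))
       = ksign (\<Sum>i\<in>I. q i) (TCmp P J I \<pi> X Y Z m n f g)"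
  using assms
  by (intro multiadditive_ksign[where
        A = "\<lambda>i. TOp P (fiber J \<pi> i) (restrict X (fiber J \<pi> i)) (Y i) (n i)"]
      surjectionD(4)[OF assms(1)] fiber_op_subgroup tcmp_add_right)
    (auto simp: op_families_def)

lemma surjection_restrict:
  assumes "surjection K J \<rho>" "surjection J I \<pi>" "i \<in> I"
  shows "surjection (fiber K (compose K \<pi> \<rho>) i) (fiber J \<pi> i)
    (restrict \<rho> (fiber K (compose K \<pi> \<rho>) i))"
proof -
  have "\<rho> ` fiber K (compose K \<pi> \<rho>) i = fiber J \<pi> i"
  proof
    show "\<rho> ` fiber K (compose K \<pi> \<rho>) i \<subseteq> fiber J \<pi> i"
      using surjectionD(7)[OF assms(1)] by (auto simp: fiber_def compose_def)
    show "fiber J \<pi> i \<subseteq> \<rho> ` fiber K (compose K \<pi> \<rho>) i"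
    proof
      fix j assume j: "j \<in> fiber J \<pi> i"
      then obtain u where "u \<in> K" "\<rho> u = j"
        using surjectionD(6)[OF assms(1)] by (auto simp: fiber_def)
      then show "j \<in> \<rho> ` fiber K (compose K \<pi> \<rho>) i"
        using j by (auto simp: fiber_def compose_def)
    qed
  qed
  then show ?thesis
    using surjection_fiber[OF assms(2,3)] surjection_fiber[OF surjection_compose[OF assms(1,2)] assms(3)]
    by (simp add: surjection_def)
qed

text \<open>
  Both sides are sums over a multi-index \<open>a\<close> for \<open>I\<close> and a multi-index \<open>b\<close> for \<open>J\<close>. On the left \<open>b\<close>
  is at first chosen fiber by fiber, inside the inner composites; full distributivity collects these
  choices. The summands then agree up to sign by associativity for \<open>P\<close>, and the signs by
  \<open>pretr_exp_assoc\<close>.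
\<close>

lemma pretr_op_cmp_assoc:
  assumes sr: "surjection K J \<rho>" and sp: "surjection J I \<pi>"
    and W: "W \<in> K \<rightarrow>\<^sub>E graded_objects C" and X: "X \<in> J \<rightarrow>\<^sub>E graded_objects C"
    and Y: "Y \<in> I \<rightarrow>\<^sub>E graded_objects C" and Z: "Z \<in> graded_objects C"
    and \<phi>: "\<phi> \<in> pretr_op P I Y Z m" and \<psi>: "\<psi> \<in> op_families (graded_tensor C P) J I \<pi> X Y n"
    and \<chi>: "\<chi> \<in> op_families (graded_tensor C P) K J \<rho> W X p"
  shows "pretr_op_cmp P K I (compose K \<pi> \<rho>) W Y Z m (\<lambda>i\<in>I. n i + (\<Sum>j\<in>fiber J \<pi> i. p j)) \<phi>
      (\<lambda>i\<in>I. let Ji = fiber J \<pi> i; Ki = fiber K (compose K \<pi> \<rho>) i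
        in pretr_op_cmp P Ki Ji (restrict \<rho> Ki) (restrict W Ki) (restrict X Ji) (Y i)
             (n i) (restrict p Ji) (\<psi> i) (restrict \<chi> Ji))
    = ksign (assoc_exp J I \<pi> n p)
        (pretr_op_cmp P K J \<rho> W X Z (m + (\<Sum>i\<in>I. n i)) p (pretr_op_cmp P J I \<pi> X Y Z m n \<phi> \<psi>) \<chi>)"
proof (intro ext)
  fix k c
  define \<sigma> where "\<sigma> = compose K \<pi> \<rho>"
  define n' where "n' = (\<lambda>i\<in>I. n i + (\<Sum>j\<in>fiber J \<pi> i. p j))"
  define \<Psi> where "\<Psi> = (\<lambda>i\<in>I. let Ji = fiber J \<pi> i; Ki = fiber K \<sigma> i
        in pretr_op_cmp P Ki Ji (restrict \<rho> Ki) (restrict W Ki) (restrict X Ji) (Y i)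
             (n i) (restrict p Ji) (\<psi> i) (restrict \<chi> Ji))"
  note ss = surjection_compose[OF sr sp, folded \<sigma>_def]
  let ?J = "fiber J \<pi>" and ?K = "fiber K \<sigma>"
  have "pretr_op_cmp P K I \<sigma> W Y Z m n' \<phi> \<Psi> k c
    = ksign (assoc_exp J I \<pi> n p)
        (pretr_op_cmp P K J \<rho> W X Z (m + (\<Sum>i\<in>I. n i)) p (pretr_op_cmp P J I \<pi> X Y Z m n \<phi> \<psi>) \<chi> k c)"
  proof (cases "k \<in> tw_range Z \<and> c \<in> multi_range K W")
    case True
    then have k: "k \<in> tw_range Z" and c: "c \<in> multi_range K W" by auto
    note WO = obs_at_family[OF W c] and XO = obs_at_family[OF X] and YO = obs_at_family[OF Y]
      and ZO = graded_objects_ob[OF Z k]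
    let ?w = "obs_at K W c" and ?x = "\<lambda>b. obs_at J X b" and ?y = "\<lambda>a. obs_at I Y a"
    let ?m = "\<lambda>a. m - k + (\<Sum>i\<in>I. a i)"
    let ?n = "\<lambda>a b. inner_deg J I \<pi> n a b" and ?p = "\<lambda>b. inner_deg K J \<rho> p b c"
    let ?g = "\<lambda>a b. inner_ops J I \<pi> \<psi> a b" and ?h = "\<lambda>b. inner_ops K J \<rho> \<chi> b c"
    let ?D = "\<lambda>a. inner_deg K I \<sigma> n' a c"
    let ?B = "\<lambda>i. multi_range (?J i) (restrict X (?J i))"
    let ?e = "\<lambda>b i. pretr_exp (?K i) (?J i) (restrict \<rho> (?K i)) (restrict b (?J i))
        (restrict c (?K i)) (restrict p (?J i))"
    define V where "V a b = TCmp P J I \<pi> (?x b) (?y a) (tw_ob Z k) (?m a) (?n a b) (\<phi> k a) (?g a b)" for a b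
    define U where "U a b = TCmp P K J \<rho> ?w (?x b) (tw_ob Z k) (m + (\<Sum>i\<in>I. n i) - k + (\<Sum>j\<in>J. b j))
        (?p b) (V a b) (?h b)" for a b
    define inner where "inner a b i = TCmp P (?K i) (?J i) (restrict \<rho> (?K i)) (restrict ?w (?K i))
        (restrict (?x b) (?J i)) (?y a i) (?n a b i) (restrict (?p b) (?J i)) (?g a b i)
        (restrict (?h b) (?J i))" for a b i
    define h where "h a i b = ksign (pretr_exp (?K i) (?J i) (restrict \<rho> (?K i)) b (restrict c (?K i)) (restrict p (?J i)))
        (TCmp P (?K i) (?J i) (restrict \<rho> (?K i)) (obs_at (?K i) (restrict W (?K i)) (restrict c (?K i)))
          (obs_at (?J i) (restrict X (?J i)) b) (tw_ob (Y i) (a i)) (n i - a i + (\<Sum>j\<in>?J i. b j))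
          (inner_deg (?K i) (?J i) (restrict \<rho> (?K i)) (restrict p (?J i)) b (restrict c (?K i)))
          (\<psi> i (a i) b)
          (inner_ops (?K i) (?J i) (restrict \<rho> (?K i)) (restrict \<chi> (?J i)) b (restrict c (?K i))))" for a i b
    have fsub: "fiber K \<rho> j \<subseteq> ?K i" if "j \<in> ?J i" for i j
      using fiber_restrict[OF that, of K \<rho>] fiber_subset[of "?K i"] unfolding \<sigma>_def by metis
    have ffib: "fiber (?K i) (restrict \<rho> (?K i)) j = fiber K \<rho> j" if "j \<in> ?J i" for i j
      unfolding \<sigma>_def by (rule fiber_restrict[OF that])
    have si: "surjection (?K i) (?J i) (restrict \<rho> (?K i))" if "i \<in> I" for i
      unfolding \<sigma>_def by (rule surjection_restrict[OF sr sp that])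
    have res: "restrict c (?K i) \<in> multi_range (?K i) (restrict W (?K i))" for i
      by (rule multi_range_restrict[OF c fiber_subset])
    have \<psi>i: "\<psi> i \<in> pretr_op P (?J i) (restrict X (?J i)) (Y i) (n i)" if "i \<in> I" for i
      using \<psi> that by (simp add: op_families_iff)
    have \<chi>i: "restrict \<chi> (?J i) \<in> op_families (graded_tensor C P) (?K i) (?J i) (restrict \<rho> (?K i))
        (restrict W (?K i)) (restrict X (?J i)) (restrict p (?J i))" for i
    proof (rule op_familiesI)
      fix j assume j: "j \<in> ?J i"
      then have "j \<in> J" by (simp add: fiber_def)
      then have "\<chi> j \<in> pretr_op P (fiber K \<rho> j) (restrict W (fiber K \<rho> j)) (X j) (p j)"
        using \<chi> by (simp add: op_families_iff)
      then show "restrict \<chi> (?J i) j \<in> TOp (graded_tensor C P) (fiber (?K i) (restrict \<rho> (?K i)) j)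
          (restrict (restrict W (?K i)) (fiber (?K i) (restrict \<rho> (?K i)) j)) (restrict X (?J i) j) (restrict p (?J i) j)"
        using j unfolding ffib[OF j] restrict_restrict Int_absorb1[OF fsub[OF j]] by simp
    qed simp
    have entry: "inner_ops K I \<sigma> \<Psi> a c = (\<lambda>i\<in>I. \<Sum>b\<in>?B i. h a i b)" if a: "a \<in> multi_range I Y" for a
    proof (rule restrict_ext)
      fix i assume i: "i \<in> I"
      show "\<Psi> i (a i) (restrict c (?K i)) = (\<Sum>b\<in>?B i. h a i b)"
        using i multi_range_mem[OF a i] res[of i]
        by (simp only: \<Psi>_def Let_def restrict_apply' pretr_op_cmp_def h_def if_True simp_thms)
    qed
    have h_closed: "h a i b \<in> TOp P (?K i) (restrict ?w (?K i)) (?y a i) (?D a i)"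
      if a: "a \<in> multi_range I Y" and i: "i \<in> I" and b: "b \<in> ?B i" for a i b
    proof -
      note Yi = PiE_mem[OF Y i] and ai = multi_range_mem[OF a i]
      have y: "?y a i = tw_ob (Y i) (a i)" using i by (simp add: obs_at_def)
      have W': "restrict W (?K i) \<in> ?K i \<rightarrow>\<^sub>E graded_objects C"
        and X': "restrict X (?J i) \<in> ?J i \<rightarrow>\<^sub>E graded_objects C"
        using W X by (auto simp: PiE_iff fiber_def)
      have "(\<Sum>j\<in>?J i. restrict p (?J i) j) = (\<Sum>j\<in>?J i. p j)"
        "(\<Sum>u\<in>?K i. restrict c (?K i) u) = (\<Sum>u\<in>?K i. c u)" by simp_all
      then have d: "?D a i = n i + (\<Sum>j\<in>?J i. restrict p (?J i) j) - a i + (\<Sum>u\<in>?K i. restrict c (?K i) u)"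
        using i by (simp add: n'_def)
      show ?thesis
        unfolding h_def y d obs_at_restrict[OF fiber_subset, symmetric]
        by (intro subgroup_ksign op_subgroup surjection_fiber[OF ss i] obs_at_family[OF W' res]
            graded_objects_ob[OF Yi ai] pretr_op_cmp_term[OF si[OF i] W' X' Yi \<psi>i[OF i] \<chi>i ai res b])
    qed
    have key: "h a i (restrict b (?J i)) = ksign (?e b i) (inner a b i)"
      if a: "a \<in> multi_range I Y" and b: "b \<in> multi_range J X" and i: "i \<in> I" for a b i
    proof -
      have "inner_deg (?K i) (?J i) (restrict \<rho> (?K i)) (restrict p (?J i)) (restrict b (?J i)) (restrict c (?K i))
          = restrict (?p b) (?J i)"
      proof (rule restrict_ext)
        fix j assume j: "j \<in> ?J i"
        then have "j \<in> J" by (simp add: fiber_def)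
        moreover have "(\<Sum>u\<in>fiber K \<rho> j. restrict c (?K i) u) = (\<Sum>u\<in>fiber K \<rho> j. c u)"
          using fsub[OF j] by (intro sum.cong) auto
        ultimately show "restrict p (?J i) j - restrict b (?J i) j
            + (\<Sum>u\<in>fiber (?K i) (restrict \<rho> (?K i)) j. restrict c (?K i) u) = ?p b j"
          using j by (simp only: ffib[OF j] restrict_apply')
      qed
      moreover have "inner_ops (?K i) (?J i) (restrict \<rho> (?K i)) (restrict \<chi> (?J i)) (restrict b (?J i)) (restrict c (?K i))
          = restrict (?h b) (?J i)"
      proof (rule restrict_ext)
        fix j assume j: "j \<in> ?J i"
        then have "j \<in> J" by (simp add: fiber_def)
        then show "restrict \<chi> (?J i) j (restrict b (?J i) j)
            (restrict (restrict c (?K i)) (fiber (?K i) (restrict \<rho> (?K i)) j)) = ?h b j"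
          using j by (simp only: ffib[OF j] restrict_apply' restrict_restrict Int_absorb1[OF fsub[OF j]])
      qed
      moreover have "(\<Sum>j\<in>?J i. restrict b (?J i) j) = (\<Sum>j\<in>?J i. b j)"
        "tw_ob (Y i) (a i) = ?y a i" using i by (simp_all add: obs_at_def)
      ultimately show ?thesis
        unfolding h_def inner_def using i
        by (simp only: obs_at_restrict[OF fiber_subset] restrict_apply')
    qed
    have deg: "?D a = (\<lambda>i\<in>I. ?n a b i + (\<Sum>j\<in>?J i. ?p b j))" for a b
    proof (rule restrict_ext)
      fix i assume i: "i \<in> I"
      have "(\<Sum>j\<in>?J i. ?p b j) = (\<Sum>j\<in>?J i. p j - b j + (\<Sum>u\<in>fiber K \<rho> j. c u))"
        by (intro sum.cong) (auto simp: fiber_def)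
      also have "\<dots> = (\<Sum>j\<in>?J i. p j) - (\<Sum>j\<in>?J i. b j) + (\<Sum>u\<in>?K i. c u)"
        unfolding \<sigma>_def fiber_compose[OF sp sr] by (simp add: sum.distrib sum_subtractf)
      finally show "n' i - a i + (\<Sum>u\<in>?K i. c u) = ?n a b i + (\<Sum>j\<in>?J i. ?p b j)"
        using i by (simp add: n'_def)
    qed
    have U_eq: "TCmp P K I \<sigma> ?w (?y a) (tw_ob Z k) (?m a) (?D a) (\<phi> k a) (\<lambda>i\<in>I. inner a b i)
        = ksign (assoc_exp J I \<pi> (?n a b) (?p b)) (U a b)"
      if a: "a \<in> multi_range I Y" and b: "b \<in> multi_range J X" for a b
      using tcmp_assoc[OF sr sp WO XO[OF b] YO[OF a] ZO restrict_extensional restrict_extensional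
          pretr_op_entry[OF \<phi> k a] inner_ops_family[OF \<psi> a b] inner_ops_family[OF \<chi> b c]]
      unfolding U_def V_def inner_def deg[of a b] unfolding \<sigma>_def inner_deg_sum[OF sp] Let_def .
    have lhs: "TCmp P K I \<sigma> ?w (?y a) (tw_ob Z k) (?m a) (?D a) (\<phi> k a) (inner_ops K I \<sigma> \<Psi> a c)
        = (\<Sum>b\<in>multi_range J X. ksign ((\<Sum>i\<in>I. ?e b i) + assoc_exp J I \<pi> (?n a b) (?p b)) (U a b))"
      if a: "a \<in> multi_range I Y" for a
    proof -
      let ?T = "TCmp P K I \<sigma> ?w (?y a) (tw_ob Z k) (?m a) (?D a) (\<phi> k a)"
      have "?T (inner_ops K I \<sigma> \<Psi> a c) = (\<Sum>bb\<in>(\<Pi>\<^sub>E i\<in>I. ?B i). ?T (\<lambda>i\<in>I. h a i (bb i)))"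
        unfolding entry[OF a]
        by (rule tcmp_sum_slots[OF ss WO YO[OF a] ZO restrict_extensional pretr_op_entry[OF \<phi> k a] h_closed[OF a]])
      also have "\<dots> = (\<Sum>b\<in>multi_range J X. ?T (\<lambda>i\<in>I. h a i ((\<lambda>i\<in>I. restrict b (?J i)) i)))"
        by (rule sum.reindex_bij_betw[OF multi_range_fibers[OF sp], symmetric])
      also have "\<dots> = (\<Sum>b\<in>multi_range J X.
          ksign ((\<Sum>i\<in>I. ?e b i) + assoc_exp J I \<pi> (?n a b) (?p b)) (U a b))"
      proof (intro sum.cong refl)
        fix b assume b: "b \<in> multi_range J X"
        have "(\<lambda>i\<in>I. h a i ((\<lambda>i\<in>I. restrict b (?J i)) i)) = (\<lambda>i\<in>I. ksign (?e b i) ((\<lambda>i\<in>I. inner a b i) i))"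
          by (rule restrict_ext) (simp only: key[OF a b] restrict_apply')
        moreover have "(\<lambda>i\<in>I. inner a b i) \<in> op_families P K I \<sigma> ?w (?y a) (?D a)"
        proof (rule op_familiesI)
          fix i assume i: "i \<in> I"
          have "inner a b i = ksign (?e b i) (h a i (restrict b (?J i)))"
            unfolding key[OF a b i] by simp
          moreover have "ksign (?e b i) (h a i (restrict b (?J i))) \<in> TOp P (?K i) (restrict ?w (?K i)) (?y a i) (?D a i)"
            by (intro subgroup_ksign fiber_op_subgroup[OF ss WO YO[OF a] i] h_closed[OF a i]
                multi_range_restrict[OF b fiber_subset])
          ultimately show "(\<lambda>i\<in>I. inner a b i) i \<in> TOp P (?K i) (restrict ?w (?K i)) (?y a i) (?D a i)"
            using i by (simp only: restrict_apply')
        qed simp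
        ultimately show "?T (\<lambda>i\<in>I. h a i ((\<lambda>i\<in>I. restrict b (?J i)) i))
          = ksign ((\<Sum>i\<in>I. ?e b i) + assoc_exp J I \<pi> (?n a b) (?p b)) (U a b)"
          using tcmp_ksign_slots[OF ss WO YO[OF a] ZO restrict_extensional pretr_op_entry[OF \<phi> k a]]
          by (simp only: U_eq[OF a b] ksign_ksign)
      qed
      finally show ?thesis .
    qed
    have rhs: "TCmp P K J \<rho> ?w (?x b) (tw_ob Z k) (m + (\<Sum>i\<in>I. n i) - k + (\<Sum>j\<in>J. b j)) (?p b)
        (pretr_op_cmp P J I \<pi> X Y Z m n \<phi> \<psi> k b) (?h b)
      = (\<Sum>a\<in>multi_range I Y. ksign (pretr_exp J I \<pi> a b n) (U a b))"
      if b: "b \<in> multi_range J X" for b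
    proof -
      have add: "additive_on (TOp P J (?x b) (tw_ob Z k) (m + (\<Sum>i\<in>I. n i) - k + (\<Sum>j\<in>J. b j)))
          (\<lambda>v. TCmp P K J \<rho> ?w (?x b) (tw_ob Z k) (m + (\<Sum>i\<in>I. n i) - k + (\<Sum>j\<in>J. b j)) (?p b) v (?h b))"
        by (rule tcmp_additive_left[OF sr WO XO[OF b] ZO restrict_extensional inner_ops_family[OF \<chi> b c]])
      have V: "V a b \<in> TOp P J (?x b) (tw_ob Z k) (m + (\<Sum>i\<in>I. n i) - k + (\<Sum>j\<in>J. b j))"
        if a: "a \<in> multi_range I Y" for a
        unfolding V_def by (rule pretr_op_cmp_term[OF sp X Y Z \<phi> \<psi> k b a])
      have e: "pretr_op_cmp P J I \<pi> X Y Z m n \<phi> \<psi> k b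
          = (\<Sum>a\<in>multi_range I Y. ksign (pretr_exp J I \<pi> a b n) (V a b))"
        using k b by (simp only: pretr_op_cmp_def V_def if_True simp_thms)
      show ?thesis
        unfolding e U_def
        by (subst additive_on_sum[OF add subgroup_ksign[OF additive_on_subgroup[OF add] V]])
          (simp_all only: additive_on_ksign[OF add V] cong: sum.cong)
    qed
    have "pretr_op_cmp P K I \<sigma> W Y Z m n' \<phi> \<Psi> k c
      = (\<Sum>a\<in>multi_range I Y. ksign (pretr_exp K I \<sigma> a c n')
          (TCmp P K I \<sigma> ?w (?y a) (tw_ob Z k) (?m a) (?D a) (\<phi> k a) (inner_ops K I \<sigma> \<Psi> a c)))"
      using True by (simp only: pretr_op_cmp_def if_True simp_thms)
    also have "\<dots> = (\<Sum>a\<in>multi_range I Y. \<Sum>b\<in>multi_range J X. ksign (pretr_exp K I \<sigma> a c n'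
          + ((\<Sum>i\<in>I. ?e b i) + assoc_exp J I \<pi> (?n a b) (?p b))) (U a b))"
      by (intro sum.cong refl) (simp only: lhs ksign_sum ksign_ksign)
    also have "\<dots> = (\<Sum>b\<in>multi_range J X. \<Sum>a\<in>multi_range I Y. ksign (pretr_exp K I \<sigma> a c n'
          + ((\<Sum>i\<in>I. ?e b i) + assoc_exp J I \<pi> (?n a b) (?p b))) (U a b))"
      by (rule sum.swap)
    also have "\<dots> = (\<Sum>b\<in>multi_range J X. \<Sum>a\<in>multi_range I Y.
          ksign (assoc_exp J I \<pi> n p + (pretr_exp K J \<rho> b c p + pretr_exp J I \<pi> a b n)) (U a b))"
    proof (rule sum.cong[OF refl], rule sum.cong[OF refl], rule ksign_cong)
      fix a b
      show "even (pretr_exp K I \<sigma> a c n' + ((\<Sum>i\<in>I. ?e b i) + assoc_exp J I \<pi> (?n a b) (?p b))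
          + (assoc_exp J I \<pi> n p + (pretr_exp K J \<rho> b c p + pretr_exp J I \<pi> a b n)))"
        using pretr_exp_assoc[OF sr sp, of a c n p b] unfolding \<sigma>_def n'_def by (simp only: ac_simps)
    qed
    also have "\<dots> = ksign (assoc_exp J I \<pi> n p) (\<Sum>b\<in>multi_range J X. ksign (pretr_exp K J \<rho> b c p)
        (TCmp P K J \<rho> ?w (?x b) (tw_ob Z k) (m + (\<Sum>i\<in>I. n i) - k + (\<Sum>j\<in>J. b j)) (?p b)
        (pretr_op_cmp P J I \<pi> X Y Z m n \<phi> \<psi> k b) (?h b)))"
      unfolding ksign_sum by (intro sum.cong refl) (simp only: rhs ksign_sum ksign_ksign)
    also have "\<dots> = ksign (assoc_exp J I \<pi> n p)
        (pretr_op_cmp P K J \<rho> W X Z (m + (\<Sum>i\<in>I. n i)) p (pretr_op_cmp P J I \<pi> X Y Z m n \<phi> \<psi>) \<chi> k c)"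
      using True by (simp only: pretr_op_cmp_def[of P K J] if_True simp_thms)
    finally show ?thesis .
  next
    case False
    show ?thesis unfolding pretr_op_cmp_def if_not_P[OF False] ksign_0_right ..
  qed
  then show "pretr_op_cmp P K I (compose K \<pi> \<rho>) W Y Z m (\<lambda>i\<in>I. n i + (\<Sum>j\<in>fiber J \<pi> i. p j)) \<phi>
      (\<lambda>i\<in>I. let Ji = fiber J \<pi> i; Ki = fiber K (compose K \<pi> \<rho>) i
        in pretr_op_cmp P Ki Ji (restrict \<rho> Ki) (restrict W Ki) (restrict X Ji) (Y i)
             (n i) (restrict p Ji) (\<psi> i) (restrict \<chi> Ji)) k c
    = ksign (assoc_exp J I \<pi> n p)
        (pretr_op_cmp P K J \<rho> W X Z (m + (\<Sum>i\<in>I. n i)) p (pretr_op_cmp P J I \<pi> X Y Z m n \<phi> \<psi>) \<chi>) k c"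
    unfolding ksign_apply n'_def \<Psi>_def \<sigma>_def .
qed

theorem graded_pseudo_tensor: "pseudo_tensor_structure (graded_cat C) (graded_tensor C P)"
proof (intro pseudo_tensor_structure.intro graded_dg_category pseudo_tensor_structure_axioms.intro,
    unfold graded_cat_simps graded_tensor_simps)
  fix I X B assume "index_set I" "X \<in> I \<rightarrow>\<^sub>E graded_objects C" "B \<in> graded_objects C"
  then show "cochain_complex (pretr_op P I X B) (graded_tdif P I X B)"
    unfolding cochain_complex_def
    by (auto simp: pretr_op_subgroup graded_tdif_closed graded_tdif_add graded_tdif_square)
qed (simp_all only: pretr_one_bij pretr_one_add pretr_one_dif pretr_one_cmp pretr_op_cmp_closed
    pretr_op_cmp_add_left pretr_op_cmp_add_right graded_tdif_cmp pretr_op_cmp_assoc pretr_op_id_left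
    pretr_op_id_right)

end

section \<open>Twisted objects\<close>

lemma pretr_twist:
  "twist_cat (graded_cat C) (pretr_objects C) tw_mor = pretr C"
proof -
  have "twist_dif (graded_cat C) tw_mor E F n \<phi> i j = pretr_dif C E F n \<phi> i j" for E F n \<phi> i j
  proof -
    have "1 + k - i = k - i + 1" "1 + j - k = j - k + 1" for k by simp_all
    then show ?thesis
      by (simp only: twist_dif_def pretr_dif_def graded_cat_simps graded_dif_def pretr_cmp_def
          fun_diff_def plus_fun_apply ksign_apply) simp
  qed
  then have "twist_dif (graded_cat C) tw_mor = pretr_dif C" by (intro ext)
  then show ?thesis by (simp add: twist_cat_def graded_cat_def pretr_def)
qed

context dg_category
begin

lemma pretr_objects_iff:
  assumes "E \<in> graded_objects C"
  shows "E \<in> pretr_objects C \<longleftrightarrow> mc_element (graded_cat C) E (tw_mor E)"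
proof -
  have "graded_dif C E E 1 (tw_mor E) + pretr_cmp C E E E 1 1 (tw_mor E) (tw_mor E) = 0
    \<longleftrightarrow> (\<forall>i\<in>tw_range E. \<forall>j\<in>tw_range E.
        ksign i (DDif C (tw_ob E j) (tw_ob E i) (j - i + 1) (tw_mor E i j))
        + (\<Sum>k\<in>tw_range E.
             DCmp C (tw_ob E j) (tw_ob E k) (tw_ob E i) (k - i + 1) (j - k + 1)
               (tw_mor E i k) (tw_mor E k j)) = 0)"
  proof -
    have d: "1 + j - i = j - i + 1" for i j :: int by simp
    have "graded_dif C E E 1 (tw_mor E) + pretr_cmp C E E E 1 1 (tw_mor E) (tw_mor E) = 0
      \<longleftrightarrow> (\<forall>i j. graded_dif C E E 1 (tw_mor E) i j + pretr_cmp C E E E 1 1 (tw_mor E) (tw_mor E) i j = 0)"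
      by (simp add: fun_eq_iff)
    then show ?thesis unfolding graded_dif_def pretr_cmp_def d by auto
  qed
  moreover have "tw_mor E \<in> pretr_hom C E E 1 \<longleftrightarrow>
     (\<forall>i\<in>tw_range E. \<forall>j\<in>tw_range E.
        tw_mor E i j \<in> DHom C (tw_ob E j) (tw_ob E i) (j - i + 1)) \<and>
     (\<forall>i j. i \<notin> tw_range E \<or> j \<notin> tw_range E \<longrightarrow> tw_mor E i j = 0)"
  proof -
    have d: "1 + j - i = j - i + 1" for i j :: int by simp
    show ?thesis unfolding pretr_hom_def mem_Collect_eq d ..
  qed
  ultimately show ?thesis
    using assms unfolding mc_element_def graded_cat_simps pretr_objects_def graded_objects_def by simp
qed

lemma pretr_objects_graded: "E \<in> pretr_objects C \<Longrightarrow> E \<in> graded_objects C"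
  by (simp add: pretr_objects_def graded_objects_def)

lemma tw_mor_update:
  fixes S :: "('o, 'm) twisted" and x
  defines "S' \<equiv> S\<lparr>tw_mor := x\<rparr>"
  shows "tw_ob S' = tw_ob S" "tw_range S' = tw_range S" "tw_mor S' = x"
    "S' \<in> graded_objects C \<longleftrightarrow> S \<in> graded_objects C"
    "pretr_hom C S' E = pretr_hom C S E" "pretr_hom C E S' = pretr_hom C E S"
    "graded_dif C S' E = graded_dif C S E" "graded_dif C E S' = graded_dif C E S"
    "pretr_cmp C S' E F = pretr_cmp C S E F" "pretr_cmp C E S' F = pretr_cmp C E S F"
    "pretr_cmp C E F S' = pretr_cmp C E F S" "pretr_id C S' = pretr_id C S"
  by (simp_all add: S'_def graded_objects_def pretr_hom_def graded_dif_def pretr_cmp_def pretr_id_def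
      fun_eq_iff)

lemma pretr_mc_family: "mc_family (graded_cat C) (pretr_objects C) tw_mor"
proof (intro mc_family.intro mc_family_axioms.intro graded_dg_category)
  fix E assume E: "E \<in> pretr_objects C"
  then show "E \<in> DOb (graded_cat C)" by (simp add: pretr_objects_graded)
  show "mc_element (graded_cat C) E (tw_mor E)"
    using E pretr_objects_iff[OF pretr_objects_graded[OF E]] by simp
next
  fix S x assume S: "S \<in> DOb (graded_cat C)" and x: "mc_element (graded_cat C) S x"
  note u = tw_mor_update[where S = S and x = x]
  have "S\<lparr>tw_mor := x\<rparr> \<in> pretr_objects C"
    using pretr_objects_iff[of "S\<lparr>tw_mor := x\<rparr>"] x S by (simp add: mc_element_def u)
  then show "\<exists>S'\<in>pretr_objects C. tw_mor S' = x \<and> DId (graded_cat C) S' = DId (graded_cat C) S \<and>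
        (\<forall>A. DHom (graded_cat C) A S' = DHom (graded_cat C) A S \<and>
             DHom (graded_cat C) S' A = DHom (graded_cat C) S A \<and>
             DDif (graded_cat C) A S' = DDif (graded_cat C) A S \<and>
             DDif (graded_cat C) S' A = DDif (graded_cat C) S A) \<and>
        (\<forall>A B. DCmp (graded_cat C) A B S' = DCmp (graded_cat C) A B S \<and>
               DCmp (graded_cat C) A S' B = DCmp (graded_cat C) A S B \<and>
               DCmp (graded_cat C) S' A B = DCmp (graded_cat C) S A B)"
    by (intro bexI[of _ "S\<lparr>tw_mor := x\<rparr>"]) (simp_all add: u)
qed

end

context pseudo_tensor_structure
begin

text \<open>The composite is a sum over all multi-indices. The identities in the slots other than \<open>i\<close> have
  diagonal matrices, so only the multi-indices \<open>\<kappa>(i := l)\<close> contribute, and for these the exponent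
  $S$ has the parity of $s(i,j_i,l)$.\<close>

lemma graded_pre_hom:
  assumes I: "index_set I" and X: "X \<in> I \<rightarrow>\<^sub>E graded_objects C" and B: "B \<in> graded_objects C"
    and \<phi>: "\<phi> \<in> pretr_op P I X B n" and i: "i \<in> I" and e: "e \<in> pretr_hom C (X i) (X i) 1"
    and k: "k \<in> tw_range B" and \<kappa>: "\<kappa> \<in> multi_range I X"
  shows "pre_hom (graded_cat C) (graded_tensor C P) I i (X i) X B n 1 \<phi> e k \<kappa>
    = (\<Sum>l\<in>tw_range (X i). ksign (insert_exp I \<kappa> i l)
        (pre_hom C P I i (tw_ob (X i) (\<kappa> i)) (obs_at I X (\<kappa>(i := l))) (tw_ob B k)
           (n - k + (\<Sum>a\<in>I. (\<kappa>(i := l)) a)) (\<kappa> i - l + 1) (\<phi> k (\<kappa>(i := l))) (e l (\<kappa> i))))"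
proof -
  have fI: "finite I" using I by (simp add: index_set_def)
  have XG: "X a \<in> graded_objects C" if "a \<in> I" for a using X that by auto
  note \<kappa>m = multi_range_mem[OF \<kappa>]
  let ?d = "\<lambda>a\<in>I. if a = i then 1 else 0 :: int"
  let ?u = "\<lambda>a. if a = i then e else pretr_id C (X a)"
  let ?\<psi> = "\<lambda>a\<in>I. if a = i then pretr_one P i (X i) (X i) 1 e
              else pretr_one P a (X a) (X a) 0 (pretr_id C (X a))"
  have XX: "X(i := X i) = X" by simp
  have u: "?u a \<in> pretr_hom C (X a) (X a) (delta i 1 a)" if "a \<in> I" for a
    using that e pretr_id_closed[OF XG[OF that]] by auto
  have \<psi>: "?\<psi> = graded_slots I X (delta i 1) ?u"
    by (rule restrict_ext) auto
  have slot: "inner_ops I I (\<lambda>a\<in>I. a) ?\<psi> j \<kappa> a = TOne P a (tw_ob (X a) (\<kappa> a))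
      (tw_ob (X a) (j a)) (delta i 1 a + \<kappa> a - j a) (?u a (j a) (\<kappa> a))"
    if "j \<in> multi_range I X" "a \<in> I" for j a
    unfolding \<psi> by (rule graded_slots_entry[OF I X u that(1) \<kappa> that(2)])
  let ?F = "\<lambda>j. ksign (pretr_exp I I (\<lambda>a\<in>I. a) j \<kappa> ?d)
          (TCmp P I I (\<lambda>a\<in>I. a) (obs_at I X \<kappa>) (obs_at I X j) (tw_ob B k) (n - k + (\<Sum>a\<in>I. j a))
            (inner_deg I I (\<lambda>a\<in>I. a) ?d j \<kappa>) (\<phi> k j) (inner_ops I I (\<lambda>a\<in>I. a) ?\<psi> j \<kappa>))"
  have upd: "\<kappa>(i := l) \<in> multi_range I X" if "l \<in> tw_range (X i)" for l
    using \<kappa> that i unfolding multi_range_def by (auto simp: PiE_iff extensional_def)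
  \<comment> \<open>A multi-index that differs from \<open>\<kappa>\<close> in a slot other than \<open>i\<close> meets an off-diagonal entry of
    an identity.\<close>
  have zero: "?F j = 0" if "j \<in> multi_range I X" and "a \<in> I" "a \<noteq> i" "j a \<noteq> \<kappa> a" for j a
    using that graded_slots_zero[OF I X u B \<phi> k that(1) \<kappa> that(2), folded \<psi>]
    by (simp add: pretr_id_def del: restrict_apply)
  have "pre_hom (graded_cat C) (graded_tensor C P) I i (X i) X B n 1 \<phi> e k \<kappa>
      = (\<Sum>j\<in>multi_range I X. ?F j)"
    unfolding pre_hom_def graded_tensor_simps graded_cat_simps XX pretr_op_cmp_def
    using k \<kappa> by (simp only: if_True simp_thms)
  also have "\<dots> = (\<Sum>j\<in>(\<lambda>l. \<kappa>(i := l)) ` tw_range (X i). ?F j)"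
  proof (rule sum.mono_neutral_right[OF finite_multi_range[OF fI]])
    show "(\<lambda>l. \<kappa>(i := l)) ` tw_range (X i) \<subseteq> multi_range I X" using upd by auto
    show "\<forall>j\<in>multi_range I X - (\<lambda>l. \<kappa>(i := l)) ` tw_range (X i). ?F j = 0"
    proof
      fix j assume "j \<in> multi_range I X - (\<lambda>l. \<kappa>(i := l)) ` tw_range (X i)"
      then have j: "j \<in> multi_range I X" and nj: "j \<noteq> \<kappa>(i := j i)"
        using multi_range_mem[of j I X i] i by (auto simp: image_iff)
      have "\<exists>a\<in>I. a \<noteq> i \<and> j a \<noteq> \<kappa> a"
      proof (rule ccontr)
        assume "\<not> (\<exists>a\<in>I. a \<noteq> i \<and> j a \<noteq> \<kappa> a)"
        then have "j = \<kappa>(i := j i)"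
          using multi_range_ext[OF j] multi_range_ext[OF \<kappa>] i by (auto simp: fun_eq_iff extensional_def)
        with nj show False by simp
      qed
      then show "?F j = 0" using zero[OF j] by blast
    qed
  qed
  also have "\<dots> = (\<Sum>l\<in>tw_range (X i). ?F (\<kappa>(i := l)))"
    by (rule sum.reindex_cong[of "\<lambda>l. \<kappa>(i := l)"]) (auto intro!: inj_onI dest: fun_upd_eqD)
  also have "\<dots> = (\<Sum>l\<in>tw_range (X i). ksign (insert_exp I \<kappa> i l)
        (pre_hom C P I i (tw_ob (X i) (\<kappa> i)) (obs_at I X (\<kappa>(i := l))) (tw_ob B k)
           (n - k + (\<Sum>a\<in>I. (\<kappa>(i := l)) a)) (\<kappa> i - l + 1) (\<phi> k (\<kappa>(i := l))) (e l (\<kappa> i))))"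
  proof (intro sum.cong refl)
    fix l assume l: "l \<in> tw_range (X i)"
    let ?j = "\<kappa>(i := l)"
    have ob: "(obs_at I X ?j)(i := tw_ob (X i) (\<kappa> i)) = obs_at I X \<kappa>"
      using i by (auto simp: obs_at_def fun_eq_iff)
    have dg: "inner_deg I I (\<lambda>a\<in>I. a) ?d ?j \<kappa> = (\<lambda>a\<in>I. if a = i then \<kappa> i - l + 1 else 0)"
      by (rule restrict_ext) auto
    have ops: "inner_ops I I (\<lambda>a\<in>I. a) ?\<psi> ?j \<kappa>
      = (\<lambda>a\<in>I. if a = i then TOne P i (tw_ob (X i) (\<kappa> i)) (obs_at I X ?j i) (\<kappa> i - l + 1) (e l (\<kappa> i))
           else TOne P a (obs_at I X ?j a) (obs_at I X ?j a) 0 (DId C (obs_at I X ?j a)))"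
    proof (rule ext)
      fix a
      have arith: "1 + \<kappa> i - l = \<kappa> i - l + 1" by simp
      show "inner_ops I I (\<lambda>a\<in>I. a) ?\<psi> ?j \<kappa> a
      = (\<lambda>a\<in>I. if a = i then TOne P i (tw_ob (X i) (\<kappa> i)) (obs_at I X ?j i) (\<kappa> i - l + 1) (e l (\<kappa> i))
           else TOne P a (obs_at I X ?j a) (obs_at I X ?j a) 0 (DId C (obs_at I X ?j a))) a"
      proof (cases "a \<in> I")
        case True
        show ?thesis
          unfolding slot[OF upd[OF l] True] using True \<kappa>m[OF True]
          by (cases "a = i") (simp_all add: obs_at_def pretr_id_def arith)
      qed simp
    qed
    have "even (pretr_exp I I (\<lambda>a\<in>I. a) ?j \<kappa> ?d + insert_exp I \<kappa> i l)"
    proof -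
      have "pretr_exp I I (\<lambda>a\<in>I. a) ?j \<kappa> ?d
        = (\<Sum>b\<in>I. \<Sum>p\<in>I. if b < p then ?j p * (?d b - ?j b + \<kappa> b) + \<kappa> b * ?d p else 0)"
      proof -
        have z: "(\<Sum>x\<in>I. \<Sum>y\<in>I. if x < y \<and> (\<lambda>a\<in>I. a) y < (\<lambda>a\<in>I. a) x then \<kappa> x * \<kappa> y else 0) = 0"
          by (intro sum.neutral ballI) auto
        show ?thesis
          unfolding pretr_exp_pairs[OF fI fI] z add_0_right
          by (rule sum.cong[OF refl], rule sum.cong[OF refl]) simp
      qed
      also have "\<dots> = (\<Sum>b\<in>I. \<Sum>p\<in>I. (if b = i then if i < p then \<kappa> p * (1 - l + \<kappa> i) else 0 else 0)
          + (if p = i then if b < i then \<kappa> b else 0 else 0))"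
        by (intro sum.cong refl) (auto split: if_splits)
      also have "\<dots> = (\<Sum>b\<in>I. \<Sum>p\<in>I. if b = i then if i < p then \<kappa> p * (1 - l + \<kappa> i) else 0 else 0)
          + (\<Sum>b\<in>I. \<Sum>p\<in>I. if p = i then if b < i then \<kappa> b else 0 else 0)"
        by (simp only: sum.distrib)
      also have "(\<Sum>b\<in>I. \<Sum>p\<in>I. if b = i then if i < p then \<kappa> p * (1 - l + \<kappa> i) else 0 else 0)
          = (\<Sum>p\<in>{p \<in> I. i < p}. \<kappa> p * (1 - l + \<kappa> i))"
        using fI i by (subst sum.swap) (simp add: sum.inter_filter)
      also have "(\<Sum>b\<in>I. \<Sum>p\<in>I. if p = i then if b < i then \<kappa> b else 0 else 0) = (\<Sum>b\<in>{b \<in> I. b < i}. \<kappa> b)"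
        using fI i by (simp add: sum.inter_filter)
      also have "(\<Sum>p\<in>{p \<in> I. i < p}. \<kappa> p * (1 - l + \<kappa> i)) = (\<kappa> i - l + 1) * (\<Sum>p\<in>{p \<in> I. i < p}. \<kappa> p)"
        by (simp add: sum_distrib_left algebra_simps)
      finally have e: "pretr_exp I I (\<lambda>a\<in>I. a) ?j \<kappa> ?d
          = (\<kappa> i - l + 1) * (\<Sum>p\<in>{p \<in> I. i < p}. \<kappa> p) + (\<Sum>b\<in>{b \<in> I. b < i}. \<kappa> b)" .
      have "even (a + b + (b + a))" for a b :: int by simp
      then show ?thesis unfolding e insert_exp_def .
    qed
    then have "ksign (pretr_exp I I (\<lambda>a\<in>I. a) ?j \<kappa> ?d) = (ksign (insert_exp I \<kappa> i l) :: 'p \<Rightarrow> 'p)"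
      by (intro ext ksign_cong)
    then show "?F ?j = ksign (insert_exp I \<kappa> i l)
        (pre_hom C P I i (tw_ob (X i) (\<kappa> i)) (obs_at I X ?j) (tw_ob B k)
           (n - k + (\<Sum>a\<in>I. ?j a)) (\<kappa> i - l + 1) (\<phi> k ?j) (e l (\<kappa> i)))"
      unfolding pre_hom_def ob dg ops by simp
  qed
  finally show ?thesis .
qed

lemma graded_post_hom:
  assumes B: "B \<in> graded_objects C" and e: "e \<in> pretr_hom C B B 1"
    and k: "k \<in> tw_range B" and \<kappa>: "\<kappa> \<in> multi_range I X"
  shows "post_hom (graded_tensor C P) I X B B 1 n e \<phi> k \<kappa>
    = (\<Sum>l\<in>tw_range B. post_hom P I (obs_at I X \<kappa>) (tw_ob B l) (tw_ob B k)
              (l - k + 1) (n - l + (\<Sum>i\<in>I. \<kappa> i)) (e k l) (\<phi> l \<kappa>))"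
proof -
  have eqs: "(\<lambda>i\<in>{1}. (\<lambda>_\<in>{1}. n) i - (\<lambda>_\<in>{1}. l) i + (\<Sum>x\<in>fiber I (\<lambda>_\<in>I. 1) i. \<kappa> x))
          = (\<lambda>_\<in>{1}. n - l + (\<Sum>i\<in>I. \<kappa> i))"
        "(\<lambda>i\<in>{1}. (\<lambda>_\<in>{1}. \<phi>) i ((\<lambda>_\<in>{1}. l) i) (restrict \<kappa> (fiber I (\<lambda>_\<in>I. 1) i))) = (\<lambda>_\<in>{1::nat}. \<phi> l \<kappa>)"
        "1 - k + (\<Sum>i\<in>{1::nat}. (\<lambda>_\<in>{1}. l) i) = l - k + 1" for l
    using multi_range_ext[OF \<kappa>] by (auto simp: fun_eq_iff extensional_restrict)
  have one: "pretr_one P 1 B B 1 e k (\<lambda>_\<in>{1}. l) = TOne P 1 (tw_ob B l) (tw_ob B k) (l - k + 1) (e k l)"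
    if "l \<in> tw_range B" for l
  proof -
    have "1 + l - k = l - k + 1" by simp
    then show ?thesis using pretr_one_entry[OF B B e k that, of 1] by (simp only:)
  qed
  have "post_hom (graded_tensor C P) I X B B 1 n e \<phi> k \<kappa>
    = (\<Sum>l\<in>tw_range B. TCmp P I {1} (\<lambda>_\<in>I. 1) (obs_at I X \<kappa>) (\<lambda>_\<in>{1}. tw_ob B l) (tw_ob B k) (l - k + 1)
          (\<lambda>_\<in>{1}. n - l + (\<Sum>i\<in>I. \<kappa> i)) (pretr_one P 1 B B 1 e k (\<lambda>_\<in>{1}. l)) (\<lambda>_\<in>{1}. \<phi> l \<kappa>))"
    unfolding post_hom_def graded_tensor_simps pretr_op_cmp_def
    using k \<kappa> by (simp only: if_True simp_thms sum_multi_range_singleton obs_at_singleton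
        pretr_exp_const ksign_0_left eqs)
  also have "\<dots> = (\<Sum>l\<in>tw_range B. post_hom P I (obs_at I X \<kappa>) (tw_ob B l) (tw_ob B k)
              (l - k + 1) (n - l + (\<Sum>i\<in>I. \<kappa> i)) (e k l) (\<phi> l \<kappa>))"
    unfolding post_hom_def by (intro sum.cong refl) (simp only: one)
  finally show ?thesis .
qed

lemma pretr_op_dif_twist:
  assumes I: "index_set I" and X: "X \<in> I \<rightarrow>\<^sub>E pretr_objects C" and B: "B \<in> pretr_objects C"
    and \<phi>: "\<phi> \<in> pretr_op P I X B n"
  shows "twist_tdif (graded_cat C) (graded_tensor C P) tw_mor I X B n \<phi> = pretr_op_dif C P I X B n \<phi>"
proof (intro ext)
  fix k \<kappa>
  interpret mc: mc_family "graded_cat C" "pretr_objects C" tw_mor by (rule pretr_mc_family)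
  have XG: "X \<in> I \<rightarrow>\<^sub>E graded_objects C" using X pretr_objects_graded by (auto simp: PiE_iff)
  note BG = pretr_objects_graded[OF B]
  have eB: "tw_mor B \<in> pretr_hom C B B 1" using mc.e_closed[OF B] by simp
  have eX: "tw_mor (X i) \<in> pretr_hom C (X i) (X i) 1" if "i \<in> I" for i
    using mc.e_closed[of "X i"] X that by auto
  show "twist_tdif (graded_cat C) (graded_tensor C P) tw_mor I X B n \<phi> k \<kappa> = pretr_op_dif C P I X B n \<phi> k \<kappa>"
  proof (cases "k \<in> tw_range B \<and> \<kappa> \<in> multi_range I X")
    case True
    then have k: "k \<in> tw_range B" and \<kappa>: "\<kappa> \<in> multi_range I X" by auto
    show ?thesis
      using True
      by (simp only: twist_tdif_def pretr_op_dif_def graded_tensor_simps graded_tdif_def fun_diff_def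
          plus_fun_apply ksign_apply sum_apply if_True simp_thms graded_post_hom[OF BG eB k \<kappa>]
          graded_pre_hom[OF I XG BG \<phi> _ eX k \<kappa>] cong: sum.cong)
  next
    case False
    have "graded_tdif P I X B n \<phi> k \<kappa> = 0" unfolding graded_tdif_def by (rule if_not_P[OF False])
    moreover have "post_hom (graded_tensor C P) I X B B 1 n (tw_mor B) \<phi> k \<kappa> = 0"
      unfolding post_hom_def graded_tensor_simps pretr_op_cmp_def by (rule if_not_P[OF False])
    moreover have "pre_hom (graded_cat C) (graded_tensor C P) I i (X i) X B n 1 \<phi> (tw_mor (X i)) k \<kappa> = 0" for i
      unfolding pre_hom_def graded_tensor_simps pretr_op_cmp_def fun_upd_triv by (rule if_not_P[OF False])
    moreover have "pretr_op_dif C P I X B n \<phi> k \<kappa> = 0" unfolding pretr_op_dif_def by (rule if_not_P[OF False])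
    ultimately show ?thesis
      by (simp add: twist_tdif_def ksign_apply sum_apply)
  qed
qed

text \<open>The two descriptions of the differential of Pre-Tr agree on operations only, because
  \<open>graded_pre_hom\<close> relies on additivity. The axioms apply the differential to nothing else.\<close>

lemma pseudo_tensor_structure_cong:
  assumes eq: "\<And>I X B n x. \<lbrakk>index_set I; X \<in> I \<rightarrow>\<^sub>E DOb C; B \<in> DOb C; x \<in> TOp P I X B n\<rbrakk>
      \<Longrightarrow> d I X B n x = TDif P I X B n x"
  shows "pseudo_tensor_structure C (P\<lparr>TDif := d\<rparr>)"
proof -
  have ops: "op_families (P\<lparr>TDif := d\<rparr>) = op_families P" by (simp add: op_families_def fun_eq_iff)
  have add: "TDif P I X B n (x + y) = TDif P I X B n x + TDif P I X B n y"
    if "index_set I" "X \<in> I \<rightarrow>\<^sub>E DOb C" "B \<in> DOb C" "x \<in> TOp P I X B n" "y \<in> TOp P I X B n"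
    for I X B n x y
    by (rule additive_on_add[OF tdif_additive[OF that(1-3)] that(4,5)])
  show ?thesis
  proof (intro pseudo_tensor_structure.intro pseudo_tensor_structure_axioms.intro, unfold ops)
    show "dg_category C" by (rule dg_category_axioms)
  next
    fix I X B assume a: "index_set I" "X \<in> I \<rightarrow>\<^sub>E DOb C" "B \<in> DOb C"
    then show "cochain_complex (TOp (P\<lparr>TDif := d\<rparr>) I X B) (TDif (P\<lparr>TDif := d\<rparr>) I X B)"
      unfolding cochain_complex_def
      by (auto simp: eq op_subgroup tdif_closed tdif_tdif add subgroup_add[OF op_subgroup])
  next
    fix A B u q i assume "A \<in> DOb C" "B \<in> DOb C" "u \<in> DHom C A B q"
    then show "TOne (P\<lparr>TDif := d\<rparr>) i A B (q + 1) (DDif C A B q u)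
          = TDif (P\<lparr>TDif := d\<rparr>) {i} (\<lambda>_\<in>{i}. A) B q (TOne (P\<lparr>TDif := d\<rparr>) i A B q u)"
      by (simp add: eq one_closed one_dif)
  next
    fix J I \<pi> X Y Z n f m g
    assume s: "surjection J I \<pi>" and X: "X \<in> J \<rightarrow>\<^sub>E DOb C" and Y: "Y \<in> I \<rightarrow>\<^sub>E DOb C" and Z: "Z \<in> DOb C"
      and n: "n \<in> extensional I" and "f \<in> TOp (P\<lparr>TDif := d\<rparr>) I Y Z m" and g: "g \<in> op_families P J I \<pi> X Y n"
    then have f: "f \<in> TOp P I Y Z m" by simp
    have gk: "d (fiber J \<pi> k) (restrict X (fiber J \<pi> k)) (Y k) (n k) (g k)
        = TDif P (fiber J \<pi> k) (restrict X (fiber J \<pi> k)) (Y k) (n k) (g k)" if "k \<in> I" for k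
      using that g Y by (intro eq surjection_fiber[OF s] fiber_objects[OF s X]) (auto simp: op_families_iff)
    show "TDif (P\<lparr>TDif := d\<rparr>) J X Z (m + (\<Sum>i\<in>I. n i)) (TCmp (P\<lparr>TDif := d\<rparr>) J I \<pi> X Y Z m n f g)
          = TCmp (P\<lparr>TDif := d\<rparr>) J I \<pi> X Y Z (m + 1) n (TDif (P\<lparr>TDif := d\<rparr>) I Y Z m f) g
            + (\<Sum>k\<in>I. ksign (m + (\<Sum>i\<in>{i \<in> I. i < k}. n i))
                (TCmp (P\<lparr>TDif := d\<rparr>) J I \<pi> X Y Z m (n(k := n k + 1)) f
                  (g(k := TDif (P\<lparr>TDif := d\<rparr>) (fiber J \<pi> k) (restrict X (fiber J \<pi> k)) (Y k) (n k) (g k)))))"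
      using tcmp_dif[OF s X Y Z n f g]
      by (simp add: gk eq[OF surjectionD(2)[OF s] Y Z f]
          eq[OF surjectionD(1)[OF s] X Z tcmp_closed[OF s X Y Z n f g]] cong: sum.cong)
  qed (simp_all add: one_bij one_add one_cmp tcmp_closed tcmp_add_left tcmp_add_right
      tcmp_id_left tcmp_id_right tcmp_assoc del: restrict_apply fun_upd_apply)
qed

end

theorem proposition2p2p1:
  fixes C :: "('o, 'm::ab_group_add) dg_cat"
    and P :: "('o, 'm, 'p::ab_group_add) pseudo_tensor"
  assumes "dg_category C"
    and "pseudo_tensor_structure C P"
  shows "pseudo_tensor_structure (pretr C) (pretr_pseudo_tensor C P)"
proof -
  interpret pseudo_tensor_structure C P by (rule assms(2))
  interpret graded: mc_tensor "graded_cat C" "pretr_objects C" tw_mor "graded_tensor C P"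
    by (intro mc_tensor.intro pretr_mc_family graded_pseudo_tensor)
  interpret twisted: pseudo_tensor_structure "pretr C" "twist_tensor (graded_cat C) (graded_tensor C P) tw_mor"
    using graded.twist_pseudo_tensor by (simp only: pretr_twist)
  have "pseudo_tensor_structure (pretr C)
      ((twist_tensor (graded_cat C) (graded_tensor C P) tw_mor)\<lparr>TDif := pretr_op_dif C P\<rparr>)"
    by (rule twisted.pseudo_tensor_structure_cong)
      (simp add: pretr_def pretr_op_dif_twist)
  then show ?thesis
    by (simp add: twist_tensor_def graded_tensor_def pretr_pseudo_tensor_def)
qed

end
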